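(* Let $b$ be a non-extreme point of the closed unit ball of $H^\infty$. Then the polynomials are dense in $\mathcal{H}(b)$ (with respect to the norm $\|\cdot\|_{\mathcal{H}(b)}$).
   Context: $H^2$ and $H^\infty$ are the usual Hardy spaces on the unit disk $\mathbb{D}$, and $\mathbb{T}$ is the unit circle. For $\psi\in L^\infty(\mathbb{T})$, the Toeplitz operator $T_\psi:H^2\to H^2$ is $T_\psi f:=P_+(\psi f)$, where $P_+:L^2(\mathbb{T})\to H^2$ is the orthogonal projection. For $b\in H^\infty$ with $\|b\|_{H^\infty}\le1$, the de Branges--Rovnyak space $\mathcal{H}(b)$ is the image of $H^2$ under $(I-T_bT_{\overline b})^{1/2}$, with the norm making this operator a partial isometry of $H^2$ onto $\mathcal{H}(b)$: $\|(I-T_bT_{\overline b})^{1/2}g\|_{\mathcal{H}(b)}:=\|g\|_{H^2}$ for $g\in H^2\ominus\ker(I-T_bT_{\overline b})^{1/2}$. "Non-extreme" means not an extreme point of the closed unit ball of $H^\infty$; equivalently, $\log(1-|b|^2)\in L^1(\mathbb{T})$. It is known that $\mathcal{H}(b)$ contains all polynomials when $b$ is non-extreme. *)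

theory Defs
  imports
    "HOL-Analysis.Analysis"
    "HOL-Library.Function_Algebras"
    "HOL-Computational_Algebra.Polynomial"
begin

text \<open>
  Pointwise scalar multiplication makes functions a real vector space, so that the library's
  \<^const>\<open>extreme_point_of\<close> applies to sets of functions.
\<close>

instantiation "fun" :: (type, real_vector) real_vector
begin

definition scaleR_fun :: "real \<Rightarrow> ('a \<Rightarrow> 'b) \<Rightarrow> 'a \<Rightarrow> 'b" where
  "scaleR_fun c f = (\<lambda>x. c *\<^sub>R f x)"

instance
  by standard (auto simp: fun_eq_iff scaleR_fun_def scaleR_add_right scaleR_add_left)

end


section \<open>The circle and Hardy spaces\<close>

text \<open>Normalised arc length on the unit circle, as a Borel measure on the plane carried by the circle.\<close>

definition circle_measure :: "complex measure" where
  "circle_measure = distr (uniform_measure lborel {0..2 * pi}) borel cis"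

text \<open>
  A function on the open unit disk is represented by its extension by \<open>0\<close> to the whole plane.
  Hence functions that agree on the disk are equal, and the spaces below are genuine vector spaces
  of functions.
\<close>

definition disk_holomorphic :: "(complex \<Rightarrow> complex) set" where
  "disk_holomorphic = {f. f holomorphic_on ball 0 1 \<and> (\<forall>z. z \<notin> ball 0 1 \<longrightarrow> f z = 0)}"

definition H2 :: "(complex \<Rightarrow> complex) set" where
  "H2 = {f \<in> disk_holomorphic.
           bdd_above ((\<lambda>r. LINT \<zeta>|circle_measure. (cmod (f (of_real r * \<zeta>)))\<^sup>2) ` {0..<1})}"

definition Hinf :: "(complex \<Rightarrow> complex) set" where
  "Hinf = {f \<in> disk_holomorphic. bounded (f ` ball 0 1)}"

definition Hinf_norm :: "(complex \<Rightarrow> complex) \<Rightarrow> real" where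
  "Hinf_norm f = (SUP z\<in>ball 0 1. cmod (f z))"

definition Hinf_unit_ball :: "(complex \<Rightarrow> complex) set" where
  "Hinf_unit_ball = {f \<in> Hinf. Hinf_norm f \<le> 1}"

definition polynomial_functions :: "(complex \<Rightarrow> complex) set" where
  "polynomial_functions = range (\<lambda>p z. if z \<in> ball 0 1 then poly p z else 0)"

text \<open>
  The radial limit function on the circle.  It exists almost everywhere for functions in the
  Hardy spaces (Fatou); elsewhere the value is irrelevant.
\<close>

definition boundary :: "(complex \<Rightarrow> complex) \<Rightarrow> complex \<Rightarrow> complex" where
  "boundary f \<zeta> = Lim (at_left (1::real)) (\<lambda>r. f (of_real r * \<zeta>))"

definition L2_inner :: "(complex \<Rightarrow> complex) \<Rightarrow> (complex \<Rightarrow> complex) \<Rightarrow> complex" where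
  "L2_inner f g = (LINT \<zeta>|circle_measure. f \<zeta> * cnj (g \<zeta>))"

text \<open>The Hilbert space structure of \<open>H2\<close> is that of a subspace of L2 of the circle, through boundary values.\<close>

definition H2_inner :: "(complex \<Rightarrow> complex) \<Rightarrow> (complex \<Rightarrow> complex) \<Rightarrow> complex" where
  "H2_inner f g = L2_inner (boundary f) (boundary g)"

definition H2_norm :: "(complex \<Rightarrow> complex) \<Rightarrow> real" where
  "H2_norm f = sqrt (LINT \<zeta>|circle_measure. (cmod (boundary f \<zeta>))\<^sup>2)"


section \<open>Toeplitz operators\<close>

text \<open>Orthogonal projection of L2 of the circle onto \<open>H2\<close>; the argument is a square-integrable function on the circle.\<close>

definition riesz_projection :: "(complex \<Rightarrow> complex) \<Rightarrow> complex \<Rightarrow> complex" where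
  "riesz_projection g =
     (THE h. h \<in> H2 \<and> (\<forall>k\<in>H2. L2_inner (\<lambda>\<zeta>. g \<zeta> - boundary h \<zeta>) (boundary k) = 0))"

definition toeplitz :: "(complex \<Rightarrow> complex) \<Rightarrow> (complex \<Rightarrow> complex) \<Rightarrow> complex \<Rightarrow> complex" where
  "toeplitz \<psi> f = riesz_projection (\<lambda>\<zeta>. \<psi> \<zeta> * boundary f \<zeta>)"


section \<open>Positive square roots of operators on \<open>H2\<close>\<close>

definition bounded_operator :: "((complex \<Rightarrow> complex) \<Rightarrow> complex \<Rightarrow> complex) \<Rightarrow> bool" where
  "bounded_operator S \<longleftrightarrow>
     (\<forall>f\<in>H2. S f \<in> H2) \<and>
     (\<forall>f\<in>H2. \<forall>g\<in>H2. S (\<lambda>z. f z + g z) = (\<lambda>z. S f z + S g z)) \<and>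
     (\<forall>c. \<forall>f\<in>H2. S (\<lambda>z. c * f z) = (\<lambda>z. c * S f z)) \<and>
     (\<exists>K. \<forall>f\<in>H2. H2_norm (S f) \<le> K * H2_norm f)"

definition positive_operator :: "((complex \<Rightarrow> complex) \<Rightarrow> complex \<Rightarrow> complex) \<Rightarrow> bool" where
  "positive_operator S \<longleftrightarrow>
     bounded_operator S \<and> (\<forall>f\<in>H2. H2_inner (S f) f \<in> \<real> \<and> Re (H2_inner (S f) f) \<ge> 0)"

text \<open>The value \<open>0\<close> outside \<open>H2\<close> only serves to make the square root unique as a total function.\<close>

definition sqrt_operator ::
    "((complex \<Rightarrow> complex) \<Rightarrow> complex \<Rightarrow> complex) \<Rightarrow> (complex \<Rightarrow> complex) \<Rightarrow> complex \<Rightarrow> complex" where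
  "sqrt_operator A =
     (THE S. positive_operator S \<and> (\<forall>f\<in>H2. S (S f) = A f) \<and> (\<forall>f. f \<notin> H2 \<longrightarrow> S f = (\<lambda>z. 0)))"


section \<open>de Branges--Rovnyak spaces\<close>

definition defect_root :: "(complex \<Rightarrow> complex) \<Rightarrow> (complex \<Rightarrow> complex) \<Rightarrow> complex \<Rightarrow> complex" where
  "defect_root b =
     sqrt_operator
       (\<lambda>f z. f z - toeplitz (boundary b) (toeplitz (\<lambda>\<zeta>. cnj (boundary b \<zeta>)) f) z)"

definition dBR_space :: "(complex \<Rightarrow> complex) \<Rightarrow> (complex \<Rightarrow> complex) set" where
  "dBR_space b = defect_root b ` H2"

definition dBR_norm :: "(complex \<Rightarrow> complex) \<Rightarrow> (complex \<Rightarrow> complex) \<Rightarrow> real" where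
  "dBR_norm b f =
     (THE c. \<exists>g\<in>H2. (\<forall>k\<in>H2. defect_root b k = (\<lambda>z. 0) \<longrightarrow> H2_inner g k = 0) \<and>
                     f = defect_root b g \<and> c = H2_norm g)"

end

(*
  A representation b = (1-u) p + u q with p <> q in the unit ball gives h <> 0 in H2 with
  |b|^2 + |h|^2 <= 1 on the circle, which is the only consequence of non-extremality that is used.
  Write T for the Toeplitz operator with symbol cnj b and D for the square root of I - T* T, so that
  |D f|^2 = |f|^2 - |T f|^2 >= |f|^2 - |b f|^2 >= |h f|^2.  Hence every F in Hinf with |F| <= C |h|
  on the circle satisfies |F f| <= C |D f|, and by the Riesz representation theorem the coanalytic
  Toeplitz operator with symbol cnj F maps H2 into the range of D.  This operator maps the
  polynomials onto themselves if F(0) <> 0, so the polynomials lie in H(b).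

  If g is orthogonal to all q with D q a polynomial, and D f_k -> g, then F f_k -> 0 for all these F.
  Taking for F the outer functions with boundary modulus min(1, n |h|), which tend to 1 in H2,
  forces <g, D e> = 0 for every monomial e, hence D g = 0 and g = 0.
*)
theory Submission
  imports Defs "HOL-Complex_Analysis.Cauchy_Integral_Formula"
begin

section \<open>Functionals and square roots on a Hilbert space\<close>

text \<open>Two obstacles shape the density argument. Convergence of D f_k says nothing about f_k
  itself, which may be unbounded in \<open>H2\<close>, so <D f_k, D e> has to be estimated by |F
  f_k| and |D f_k| alone. And <D f, D e> = <f, e> - <T f, T e> contains T f, which |F f| does not
  control; it disappears once multiplied by F, because F T f stays in \<open>H2\<close> while cnj b
  e - T e is orthogonal to \<open>H2\<close>. What is left carries either the factor F f or the
  small factor 1 - F. Since \<open>H2\<close> is a set of functions normed through radial limits, it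
  is traded for the Hilbert space \<open>ell2\<close> of Taylor coefficients; that the map
  \<open>ev\<close> between them is unitary is the Riesz-Fischer theorem together with Fatou's
  theorem on Poisson integrals. The inner product of the type class is real; complex identities are
  recovered by testing with \<open>cscale \<i>\<close> as well. Outer functions enter only as
  exponentials of Herglotz integrals, whose boundary modulus is again a matter of Fatou's theorem,
  so no inner-outer factorisation occurs.\<close>

lemma nonneg_quadratic_imp_linear_coeff_0:
  fixes a c :: real
  assumes ineq: "\<And>t. 0 \<le> 2 * t * a + t\<^sup>2 * c" and c: "0 \<le> c"
  shows "a = 0"
proof (rule ccontr)
  assume a: "a \<noteq> 0"
  \<comment> \<open>For c > 0 the quadratic is least at -a/c; the shift by 1 keeps the quotient
    meaningful for c = 0, and the value is still at most -a^2/(c+1) < 0.\<close>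
  define t where "t = - a / (c + 1)"
  have "2 * t * a + t\<^sup>2 * c \<le> 2 * t * a + t\<^sup>2 * (c + 1)" by (simp add: mult_left_mono)
  also have "\<dots> = t * (2 * a + t * (c + 1))" by (simp add: power2_eq_square algebra_simps)
  also have "t * (c + 1) = - a" unfolding t_def using c by simp
  also have "t * (2 * a + - a) = - (a\<^sup>2 / (c + 1))" unfolding t_def by (simp add: power2_eq_square)
  also have "\<dots> < 0" using a c by simp
  finally show False using ineq[of t] by simp
qed

text \<open>Direct method: minimise |x|^2 - 2 \<open>\<phi> x\<close> over \<open>V\<close>. As
  \<open>V\<close> need not be closed, the representing vector is only found in its closure. With
  \<open>\<phi> = inner g\<close> that vector is the orthogonal projection of g onto
  \<open>closure V\<close>; with \<open>\<phi>\<close> defined through the inverse of an injective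
  operator on its range, the lemma solves equations for that operator.\<close>

lemma riesz_on_subspace:
  fixes \<phi> :: "'h::{real_inner,banach} \<Rightarrow> real"
  assumes V: "subspace V"
    and add: "\<And>x y. x \<in> V \<Longrightarrow> y \<in> V \<Longrightarrow> \<phi> (x + y) = \<phi> x + \<phi> y"
    and scale: "\<And>c x. x \<in> V \<Longrightarrow> \<phi> (c *\<^sub>R x) = c * \<phi> x"
    and bound: "\<And>x. x \<in> V \<Longrightarrow> \<bar>\<phi> x\<bar> \<le> K * norm x"
  obtains x where "x \<in> closure V" "\<And>y. y \<in> V \<Longrightarrow> inner x y = \<phi> y"
proof -
  define J where "J x = (norm x)\<^sup>2 - 2 * \<phi> x" for x
  define m where "m = Inf (J ` V)"
  have V0: "0 \<in> V" using V by (rule subspace_0)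
  have J_lower: "- K\<^sup>2 \<le> J x" if "x \<in> V" for x
  proof -
    have "0 \<le> (norm x - K)\<^sup>2" by simp
    then have "- K\<^sup>2 \<le> (norm x)\<^sup>2 - 2 * (K * norm x)" by (simp add: power2_diff algebra_simps)
    then show ?thesis using bound[OF that] unfolding J_def by linarith
  qed
  then have bdd: "bdd_below (J ` V)" by (auto intro!: bdd_belowI)
  have m_le: "m \<le> J x" if "x \<in> V" for x
    unfolding m_def using bdd that by (intro cINF_lower)
  have "\<exists>x\<in>V. J x < m + 1 / real (Suc n)" for n
  proof -
    have "Inf (J ` V) < m + 1 / real (Suc n)" unfolding m_def by simp
    then show ?thesis using cInf_less_iff[OF _ bdd] V0 by blast
  qed
  then obtain x where xV: "\<And>n. x n \<in> V" and xJ: "\<And>n. J (x n) < m + 1 / real (Suc n)"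
    by metis
  have diff: "(norm (x n - x k))\<^sup>2 \<le> 2 / real (Suc n) + 2 / real (Suc k)" for n k
  proof -
    \<comment> \<open>The midpoint is a competitor, so \<open>m \<le> J z\<close>, and the
      parallelogram law forces the minimising sequence to be Cauchy.\<close>
    define z where "z = (1/2) *\<^sub>R (x n + x k)"
    have zV: "z \<in> V" unfolding z_def using V xV by (simp add: subspace_add subspace_scale)
    have "\<phi> z = (\<phi> (x n) + \<phi> (x k)) / 2"
      unfolding z_def using V xV by (simp add: subspace_add scale add)
    moreover have "(norm (x n - x k))\<^sup>2 = 2 * (norm (x n))\<^sup>2 + 2 * (norm (x k))\<^sup>2 - 4 * (norm z)\<^sup>2"
      unfolding z_def by (simp add: power2_norm_eq_inner inner_add_left inner_add_right
          inner_diff_left inner_diff_right inner_commute field_simps)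
    ultimately have "(norm (x n - x k))\<^sup>2 = 2 * J (x n) + 2 * J (x k) - 4 * J z"
      unfolding J_def by (simp add: field_simps)
    also have "\<dots> \<le> 2 / real (Suc n) + 2 / real (Suc k)"
      using xJ[of n] xJ[of k] m_le[OF zV] by linarith
    finally show ?thesis .
  qed
  have "Cauchy x"
  proof (rule metric_CauchyI)
    fix e :: real assume "0 < e"
    then obtain N where N: "4 / e\<^sup>2 < real (Suc N)"
      using reals_Archimedean2 less_trans lessI of_nat_less_iff by metis
    have "dist (x n) (x k) < e" if "N \<le> n" "N \<le> k" for n k
    proof -
      have "(norm (x n - x k))\<^sup>2 \<le> 2 / real (Suc N) + 2 / real (Suc N)"
        using diff[of n k] that frac_le[of 2 2 "real (Suc N)" "real (Suc n)"]
          frac_le[of 2 2 "real (Suc N)" "real (Suc k)"] by auto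
      also have "\<dots> = 4 / real (Suc N)" by simp
      also have "\<dots> < e\<^sup>2" using N \<open>0 < e\<close> by (simp add: divide_less_eq mult.commute)
      finally show ?thesis using \<open>0 < e\<close> by (simp add: dist_norm power_less_imp_less_base)
    qed
    then show "\<exists>N. \<forall>n\<ge>N. \<forall>k\<ge>N. dist (x n) (x k) < e" by blast
  qed
  then obtain x0 where x0: "x \<longlonglongrightarrow> x0" using Cauchy_convergent_iff convergent_def by blast
  have "x0 \<in> closure V" using xV x0 closure_sequential by blast
  moreover have "inner x0 y = \<phi> y" if y: "y \<in> V" for y
  proof -
    \<comment> \<open>Minimality along the line in direction \<open>y\<close>, passed to the limit;
      its first-order condition is the representation formula.\<close>
    have ineq: "0 \<le> 2 * t * (inner x0 y - \<phi> y) + t\<^sup>2 * (norm y)\<^sup>2" for t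
    proof -
      have "- (1 / real (Suc n)) \<le> 2 * t * (inner (x n) y - \<phi> y) + t\<^sup>2 * (norm y)\<^sup>2" for n
      proof -
        have "x n + t *\<^sub>R y \<in> V" using V xV y by (simp add: subspace_add subspace_scale)
        then have "m \<le> J (x n + t *\<^sub>R y)" by (rule m_le)
        also have "\<dots> = J (x n) + 2 * t * (inner (x n) y - \<phi> y) + t\<^sup>2 * (norm y)\<^sup>2"
        proof -
          have "(norm (x n + t *\<^sub>R y))\<^sup>2 = (norm (x n))\<^sup>2 + 2 * t * inner (x n) y + t\<^sup>2 * (norm y)\<^sup>2"
            unfolding power2_norm_eq_inner
            by (simp add: inner_add_left inner_add_right inner_commute[of y "x n"] algebra_simps power2_eq_square)
          then show ?thesis
            unfolding J_def using V xV y by (simp add: add scale subspace_scale algebra_simps)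
        qed
        finally show ?thesis using xJ[of n] by linarith
      qed
      moreover have "(\<lambda>n. - (1 / real (Suc n))) \<longlonglongrightarrow> - 0"
        by (intro tendsto_minus LIMSEQ_Suc[OF lim_1_over_n])
      moreover have "(\<lambda>n. 2 * t * (inner (x n) y - \<phi> y) + t\<^sup>2 * (norm y)\<^sup>2)
          \<longlonglongrightarrow> 2 * t * (inner x0 y - \<phi> y) + t\<^sup>2 * (norm y)\<^sup>2"
        by (intro tendsto_intros x0)
      ultimately show ?thesis using LIMSEQ_le by fastforce
    qed
    have "inner x0 y - \<phi> y = 0"
      using nonneg_quadratic_imp_linear_coeff_0[OF ineq] by simp
    then show ?thesis by simp
  qed
  ultimately show ?thesis using that by blast
qed

text \<open>Symmetry for the real inner product; together with complex linearity it yields the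
  complex version through \<open>complex_adjoint\<close>.\<close>

definition self_adjoint :: "('h::real_inner \<Rightarrow>\<^sub>L 'h) \<Rightarrow> bool" where
  "self_adjoint T \<longleftrightarrow> (\<forall>x y. inner (T x) y = inner x (T y))"

text \<open>With S = I - Z the equation S^2 = I - X becomes Z = (X + Z^2)/2, solved by iteration
  from 0. The scalar iteration \<open>y\<close>, with X replaced by 1, dominates both the iterates
  and their increments, so \<open>norm X \<le> 1\<close> gives convergence in operator norm. Every
  iterate is a polynomial in X, hence the limit commutes with whatever commutes with X; uniqueness
  of the root and its complex linearity both rest on that last clause.\<close>

lemma positive_sqrt_exists:
  fixes X :: "'h::{real_inner,banach} \<Rightarrow>\<^sub>L 'h"
  assumes X: "self_adjoint X" and normX: "norm X \<le> 1"
  obtains S :: "'h \<Rightarrow>\<^sub>L 'h" where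
    "self_adjoint S" "\<And>x. 0 \<le> inner (S x) x" "\<And>x. S (S x) = x - X x"
    "\<And>T. X o\<^sub>L T = T o\<^sub>L X \<Longrightarrow> S o\<^sub>L T = T o\<^sub>L S"
proof -
  define Y where "Y = rec_nat (0 :: 'h \<Rightarrow>\<^sub>L 'h) (\<lambda>_ W. (1/2) *\<^sub>R (X + (W o\<^sub>L W)))"
  have Y0: "Y 0 = 0" and YS: "Y (Suc k) = (1/2) *\<^sub>R (X + (Y k o\<^sub>L Y k))" for k
    by (simp_all add: Y_def)
  define y where "y = rec_nat (0::real) (\<lambda>_ w. (1 + w\<^sup>2) / 2)"
  have y0: "y 0 = 0" and yS: "y (Suc k) = (1 + (y k)\<^sup>2) / 2" for k
    by (simp_all add: y_def)
  have y_bd: "0 \<le> y k \<and> y k \<le> 1" for k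
    by (induction k) (auto simp: y0 yS power_le_one)
  have Yy: "norm (Y k) \<le> y k" for k
  proof (induction k)
    case (Suc k)
    have "norm (Y k o\<^sub>L Y k) \<le> (y k)\<^sup>2"
      using norm_blinfun_compose[of "Y k" "Y k"] mult_mono[OF Suc Suc] y_bd[of k]
      by (simp add: power2_eq_square)
    then have "norm (X + (Y k o\<^sub>L Y k)) \<le> 1 + (y k)\<^sup>2"
      using normX norm_triangle_ineq[of X "Y k o\<^sub>L Y k"] by linarith
    then show ?case by (simp add: YS yS)
  qed (simp add: Y0 y0)
  have comm: "Y k o\<^sub>L T = T o\<^sub>L Y k" if T: "X o\<^sub>L T = T o\<^sub>L X" for k T
  proof (induction k)
    case (Suc k)
    have "(Y (Suc k)) (T v) = T (Y (Suc k) v)" for v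
    proof -
      have c: "Y k (T w) = T (Y k w)" "X (T w) = T (X w)" for w
        using Suc T by (metis blinfun_apply_blinfun_compose)+
      show ?thesis by (simp add: YS c blinfun.add_right blinfun.scaleR_right
            blinfun.add_left blinfun.scaleR_left)
    qed
    then show ?case by (intro blinfun_eqI) simp
  qed (auto simp: Y0 intro!: blinfun_eqI)
  have commX: "Y k o\<^sub>L X = X o\<^sub>L Y k" for k by (rule comm) simp
  have commY: "Y k o\<^sub>L Y j = Y j o\<^sub>L Y k" for k j
    by (rule comm) (simp add: commX)
  \<comment> \<open>Commuting iterates allow W^2 - V^2 = (W + V)(W - V), and the scalar increments
    obey the same factorisation exactly.\<close>
  have step: "norm (Y (Suc k) - Y k) \<le> y (Suc k) - y k" for k
  proof (induction k)
    case 0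
    show ?case using Yy[of 1] by (simp add: Y0 y0)
  next
    case (Suc k)
    have "Y (Suc (Suc k)) - Y (Suc k) = (1/2) *\<^sub>R ((Y (Suc k) + Y k) o\<^sub>L (Y (Suc k) - Y k))"
    proof (rule blinfun_eqI)
      fix v
      have "Y (Suc k) (Y k v) = Y k (Y (Suc k) v)"
        using commY by (metis blinfun_apply_blinfun_compose)
      then show "(Y (Suc (Suc k)) - Y (Suc k)) v = ((1/2) *\<^sub>R ((Y (Suc k) + Y k) o\<^sub>L (Y (Suc k) - Y k))) v"
        unfolding YS[of "Suc k"]
        by (subst (3) YS) (simp add: blinfun.add_left blinfun.scaleR_left blinfun.diff_left
            blinfun.diff_right algebra_simps)
    qed
    then have "norm (Y (Suc (Suc k)) - Y (Suc k)) =
        norm ((Y (Suc k) + Y k) o\<^sub>L (Y (Suc k) - Y k)) / 2" by simp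
    also have "\<dots> \<le> norm (Y (Suc k) + Y k) * norm (Y (Suc k) - Y k) / 2"
      by (simp add: norm_blinfun_compose)
    also have "\<dots> \<le> (y (Suc k) + y k) * (y (Suc k) - y k) / 2"
      using Suc y_bd norm_triangle_ineq[of "Y (Suc k)" "Y k"] Yy[of k] Yy[of "Suc k"]
      by (intro divide_right_mono mult_mono) auto
    also have "\<dots> = y (Suc (Suc k)) - y (Suc k)"
    proof -
      have "(1 + v\<^sup>2) / 2 - v = (v + w) * (v - w) / 2" if "v = (1 + w\<^sup>2) / 2" for v w :: real
      proof -
        have "w * w = 2 * v - 1" using that by (simp add: power2_eq_square)
        then have "(v + w) * (v - w) = v * v - (2 * v - 1)" by (simp add: algebra_simps)
        then show ?thesis unfolding power2_eq_square
          by (simp only: diff_divide_distrib add_divide_distrib)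
      qed
      from this[OF yS[of k]] show ?thesis unfolding yS[of "Suc k"] by (rule sym)
    qed
    finally show ?case .
  qed
  have mono_y: "incseq y"
    by (rule incseq_SucI) (use step norm_ge_zero order_trans in \<open>smt (verit)\<close>)
  have "convergent y"
    using Bseq_mono_convergent[of y] mono_y y_bd
    by (metis BseqI' abs_of_nonneg incseqD real_norm_def)
  then have Cy: "Cauchy y" by (rule convergent_Cauchy)
  have dist_le: "norm (Y (n + j) - Y n) \<le> y (n + j) - y n" for n j
  proof (induction j)
    case (Suc j)
    then show ?case using step[of "n + j"]
        norm_triangle_ineq[of "Y (Suc (n + j)) - Y (n + j)" "Y (n + j) - Y n"] by simp
  qed simp
  have dist_le': "dist (Y n) (Y k) \<le> dist (y n) (y k)" for n k
  proof (cases "n \<le> k")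
    case True
    then show ?thesis using dist_le[of n "k - n"] by (simp add: dist_norm norm_minus_commute)
  next
    case False
    then show ?thesis using dist_le[of k "n - k"] by (simp add: dist_norm norm_minus_commute)
  qed
  have "Cauchy Y"
    using Cy dist_le' unfolding Cauchy_def by (meson le_less_trans)
  then obtain Z where Z: "Y \<longlonglongrightarrow> Z" using Cauchy_convergent_iff convergent_def by blast
  have Zv: "(\<lambda>k. Y k v) \<longlonglongrightarrow> Z v" for v
    using bounded_linear.tendsto[OF blinfun.bounded_linear_left Z] .
  have "(\<lambda>k. (1/2) *\<^sub>R (X + (Y k o\<^sub>L Y k))) \<longlonglongrightarrow> (1/2) *\<^sub>R (X + (Z o\<^sub>L Z))"
    by (intro tendsto_intros Z bounded_bilinear.tendsto[OF bounded_bilinear_blinfun_compose])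
  then have "(\<lambda>k. Y (Suc k)) \<longlonglongrightarrow> (1/2) *\<^sub>R (X + (Z o\<^sub>L Z))" by (simp add: YS)
  then have Zeq: "Z = (1/2) *\<^sub>R (X + (Z o\<^sub>L Z))"
    using LIMSEQ_unique LIMSEQ_Suc[OF Z] by blast
  have normZ: "norm Z \<le> 1"
    using LIMSEQ_le_const2[OF tendsto_norm[OF Z]] Yy y_bd order_trans by metis
  have adjY: "inner (Y k v) w = inner v (Y k w)" for k v w
  proof (induction k arbitrary: v w)
    case (Suc k)
    then show ?case using X unfolding self_adjoint_def
      by (simp add: YS blinfun.add_left blinfun.scaleR_left inner_add_left inner_add_right)
  qed (simp add: Y0)
  have adjZ: "inner (Z v) w = inner v (Z w)" for v w
    using LIMSEQ_unique[of "\<lambda>k. inner (Y k v) w"] tendsto_inner[OF Zv tendsto_const]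
      tendsto_inner[OF tendsto_const Zv] adjY by (metis (no_types, lifting) ext)
  define S where "S = id_blinfun - Z"
  have Sv: "S v = v - Z v" for v by (simp add: S_def blinfun.diff_left)
  have "self_adjoint S"
    unfolding self_adjoint_def Sv by (simp add: inner_diff_left inner_diff_right adjZ)
  moreover have "0 \<le> inner (S v) v" for v
  proof -
    have "inner (Z v) v \<le> norm (Z v) * norm v" by (rule norm_cauchy_schwarz)
    also have "\<dots> \<le> (1 * norm v) * norm v"
      using order_trans[OF norm_blinfun[of Z v] mult_right_mono[OF normZ norm_ge_zero]]
      by (intro mult_right_mono) simp_all
    finally have "inner (Z v) v \<le> inner v v" by (simp add: power2_norm_eq_inner flip: power2_eq_square)
    then show ?thesis by (simp add: Sv inner_diff_left)
  qed
  moreover have "S (S v) = v - X v" for v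
  proof -
    have "Z v = (1/2) *\<^sub>R (X v + Z (Z v))"
      using Zeq by (metis blinfun.add_left blinfun.scaleR_left blinfun_apply_blinfun_compose)
    from arg_cong[OF this, of "\<lambda>u. 2 *\<^sub>R u"] have "Z v + Z v = X v + Z (Z v)"
      by (simp add: scaleR_2)
    then show ?thesis by (simp add: Sv blinfun.diff_right algebra_simps)
  qed
  moreover have "S o\<^sub>L T = T o\<^sub>L S" if T: "X o\<^sub>L T = T o\<^sub>L X" for T
  proof (rule blinfun_eqI)
    fix v
    have "(\<lambda>k. T (Y k v)) \<longlonglongrightarrow> T (Z v)"
      by (intro bounded_linear.tendsto[OF blinfun.bounded_linear_right] Zv)
    moreover have "T (Y k v) = Y k (T v)" for k
      using comm[OF T] by (metis blinfun_apply_blinfun_compose)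
    ultimately have "Z (T v) = T (Z v)" using Zv[of "T v"] LIMSEQ_unique by simp
    then show "(S o\<^sub>L T) v = (T o\<^sub>L S) v" by (simp add: Sv blinfun.diff_right)
  qed
  ultimately show ?thesis using that by blast
qed

text \<open>The degenerate case of the Cauchy-Schwarz inequality for the form of \<open>S\<close>:
  perturbing \<open>x\<close> in the direction \<open>S x\<close> gives a nonnegative quadratic with
  linear coefficient |S x|^2 and no constant term.\<close>

lemma positive_apply_eq_0:
  fixes S :: "'h::real_inner \<Rightarrow>\<^sub>L 'h"
  assumes "self_adjoint S" "\<And>x. 0 \<le> inner (S x) x" "inner (S x) x = 0"
  shows "S x = 0"
proof (rule ccontr)
  assume nz: "S x \<noteq> 0"
  define a where "a = (norm (S x))\<^sup>2"
  define c where "c = inner (S (S x)) (S x)"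
  have a: "a > 0" using nz by (simp add: a_def)
  have ineq: "0 \<le> 2 * t * a + t\<^sup>2 * c" for t
  proof -
    have "inner (S (S x)) x = a"
      using assms(1) by (simp add: self_adjoint_def a_def power2_norm_eq_inner)
    moreover have "0 \<le> inner (S (x + t *\<^sub>R S x)) (x + t *\<^sub>R S x)" by (rule assms)
    moreover have "inner (S x) (S x) = a" by (simp add: a_def power2_norm_eq_inner)
    moreover have "inner (S (x + t *\<^sub>R S x)) (x + t *\<^sub>R S x) =
        inner (S x) x + t * inner (S x) (S x) + t * inner (S (S x)) x + t * (t * c)"
      by (simp add: blinfun.add_right blinfun.scaleR_right inner_add_left inner_add_right c_def algebra_simps)
    ultimately have "0 \<le> 0 + t * a + t * a + t * (t * c)" using assms(3) by metis
    then show ?thesis by (simp add: power2_eq_square algebra_simps)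
  qed
  have "c \<ge> 0" unfolding c_def by (rule assms)
  from nonneg_quadratic_imp_linear_coeff_0[OF ineq this] a show False by simp
qed

text \<open>For commuting roots (S + T)(S - T) = 0. On y = S x - T x the two nonnegative forms
  therefore sum to zero, whence S y = T y = 0 and |y|^2 = <(S - T) y, x> = 0.\<close>

lemma positive_sqrt_unique:
  fixes S T :: "'h::real_inner \<Rightarrow>\<^sub>L 'h"
  assumes S: "self_adjoint S" "\<And>x. 0 \<le> inner (S x) x"
    and T: "self_adjoint T" "\<And>x. 0 \<le> inner (T x) x"
    and eq: "\<And>x. S (S x) = T (T x)" and comm: "S o\<^sub>L T = T o\<^sub>L S"
  shows "S = T"
proof (rule blinfun_eqI)
  fix x
  define y where "y = S x - T x"
  have c: "S (T v) = T (S v)" for v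
    using comm by (metis blinfun_apply_blinfun_compose)
  have "S y + T y = 0" by (simp add: y_def blinfun.diff_right eq c)
  then have "inner (S y) y + inner (T y) y = 0" by (metis inner_add_left inner_zero_left)
  then have "inner (S y) y = 0" "inner (T y) y = 0" using S(2)[of y] T(2)[of y] by linarith+
  then have "S y = 0" "T y = 0" using positive_apply_eq_0 S T by blast+
  have "inner y y = inner (S y - T y) x"
    using S(1) T(1) unfolding self_adjoint_def y_def
    by (metis inner_diff_left inner_diff_right)
  then show "S x = T x" using \<open>S y = 0\<close> \<open>T y = 0\<close> by (simp add: y_def)
qed

section \<open>Square-integrable functions and termwise integration of series\<close>

lemma L2_Cauchy_Schwarz:
  fixes f g :: "'a \<Rightarrow> complex"
  assumes [measurable]: "f \<in> borel_measurable M" "g \<in> borel_measurable M"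
    and f: "integrable M (\<lambda>x. (cmod (f x))\<^sup>2)" and g: "integrable M (\<lambda>x. (cmod (g x))\<^sup>2)"
  shows "integrable M (\<lambda>x. f x * g x)"
    and "cmod (LINT x|M. f x * g x) \<le>
      sqrt (LINT x|M. (cmod (f x))\<^sup>2) * sqrt (LINT x|M. (cmod (g x))\<^sup>2)"
proof -
  have "integrable M (\<lambda>x. (cmod (f x))\<^sup>2 + (cmod (g x))\<^sup>2)" using f g by simp
  then show int: "integrable M (\<lambda>x. f x * g x)"
  proof (rule Bochner_Integration.integrable_bound)
    have "cmod (f x) * cmod (g x) \<le> (cmod (f x))\<^sup>2 + (cmod (g x))\<^sup>2" for x
      using sum_squares_bound[of "cmod (f x)" "cmod (g x)"]
        mult_nonneg_nonneg[OF norm_ge_zero[of "f x"] norm_ge_zero[of "g x"]] by linarith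
    then show "AE x in M. norm (f x * g x) \<le> norm ((cmod (f x))\<^sup>2 + (cmod (g x))\<^sup>2)"
      by (simp add: norm_mult)
  qed simp
  define I where "I = (LINT x|M. cmod (f x) * cmod (g x))"
  define A where "A = (LINT x|M. (cmod (f x))\<^sup>2)"
  define B where "B = (LINT x|M. (cmod (g x))\<^sup>2)"
  have I0: "I \<ge> 0" "A \<ge> 0" "B \<ge> 0" unfolding I_def A_def B_def by simp_all
  have int': "integrable M (\<lambda>x. cmod (f x) * cmod (g x))"
    using integrable_norm[OF int] by (simp add: norm_mult)
  have "(\<integral>\<^sup>+x. ennreal (cmod (f x)) * ennreal (cmod (g x)) \<partial>M)\<^sup>2 \<le>
      (\<integral>\<^sup>+x. ennreal (cmod (f x)) ^ 2 \<partial>M) * (\<integral>\<^sup>+x. ennreal (cmod (g x)) ^ 2 \<partial>M)"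
    by (rule Cauchy_Schwarz_nn_integral) measurable
  also have "(\<integral>\<^sup>+x. ennreal (cmod (f x)) * ennreal (cmod (g x)) \<partial>M) = ennreal I"
    unfolding I_def by (subst nn_integral_eq_integral[OF int', symmetric]) (simp_all add: ennreal_mult)
  also have "(\<integral>\<^sup>+x. ennreal (cmod (f x)) ^ 2 \<partial>M) = ennreal A"
    unfolding A_def by (subst nn_integral_eq_integral[OF f, symmetric]) (simp_all add: ennreal_power)
  also have "(\<integral>\<^sup>+x. ennreal (cmod (g x)) ^ 2 \<partial>M) = ennreal B"
    unfolding B_def by (subst nn_integral_eq_integral[OF g, symmetric]) (simp_all add: ennreal_power)
  finally have "I\<^sup>2 \<le> A * B"
    using I0 by (simp add: ennreal_power flip: ennreal_mult)
  then have "I \<le> sqrt (A * B)" by (rule real_le_rsqrt)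
  moreover have "cmod (LINT x|M. f x * g x) \<le> I"
    using integral_norm_bound[of M "\<lambda>x. f x * g x"] unfolding I_def by (simp add: norm_mult)
  ultimately show "cmod (LINT x|M. f x * g x) \<le> sqrt A * sqrt B"
    by (simp add: real_sqrt_mult)
qed

lemma integrable_square_add:
  fixes f g :: "'a \<Rightarrow> complex"
  assumes [measurable]: "f \<in> borel_measurable M" "g \<in> borel_measurable M"
    and f: "integrable M (\<lambda>x. (cmod (f x))\<^sup>2)" and g: "integrable M (\<lambda>x. (cmod (g x))\<^sup>2)"
  shows "integrable M (\<lambda>x. (cmod (f x + g x))\<^sup>2)"
proof -
  have "integrable M (\<lambda>x. 2 * (cmod (f x))\<^sup>2 + 2 * (cmod (g x))\<^sup>2)" using f g by simp
  then show ?thesis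
  proof (rule Bochner_Integration.integrable_bound)
    have "(cmod (f x + g x))\<^sup>2 \<le> 2 * (cmod (f x))\<^sup>2 + 2 * (cmod (g x))\<^sup>2" for x
    proof -
      have "(cmod (f x + g x))\<^sup>2 \<le> (cmod (f x) + cmod (g x))\<^sup>2"
        by (simp add: norm_triangle_ineq power_mono)
      then show ?thesis
        using sum_squares_bound[of "cmod (f x)" "cmod (g x)"] by (simp add: power2_sum)
    qed
    then show "AE x in M. norm ((cmod (f x + g x))\<^sup>2) \<le> norm (2 * (cmod (f x))\<^sup>2 + 2 * (cmod (g x))\<^sup>2)"
      by simp
  qed simp
qed

text \<open>Everything is dominated by |g| times the sum of the |d n|. It is applied to powers of
  cnj \<zeta>, for the Herglotz kernel, and to powers of \<zeta>, for absolutely convergent Fourier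
  series.\<close>

lemma integral_series_exchange:
  fixes \<phi> :: "nat \<Rightarrow> 'a \<Rightarrow> complex" and g :: "'a \<Rightarrow> complex"
  assumes [measurable]: "\<And>n. \<phi> n \<in> borel_measurable M"
    and \<phi>: "AE x in M. \<forall>n. cmod (\<phi> n x) \<le> 1"
    and g: "integrable M g" and d: "summable (\<lambda>n. cmod (d n))"
  shows "integrable M (\<lambda>x. (\<Sum>n. d n * \<phi> n x) * g x)"
    and "(\<lambda>n. d n * (LINT x|M. \<phi> n x * g x)) sums (LINT x|M. (\<Sum>n. d n * \<phi> n x) * g x)"
proof -
  have [measurable]: "g \<in> borel_measurable M" using g by simp
  have int0: "integrable M (\<lambda>x. \<phi> n x * g x)" for n
  proof (rule Bochner_Integration.integrable_bound[OF g])
    show "AE x in M. norm (\<phi> n x * g x) \<le> norm (g x)"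
      using \<phi> by eventually_elim (simp add: norm_mult mult_left_le_one_le)
  qed simp
  have int: "integrable M (\<lambda>x. d n * (\<phi> n x * g x))" for n using int0 by simp
  have bd: "AE x in M. \<forall>n. norm (d n * (\<phi> n x * g x)) \<le> cmod (d n) * cmod (g x)"
    using \<phi> by eventually_elim (simp add: norm_mult mult_left_mono mult_left_le_one_le)
  have sumAE: "AE x in M. summable (\<lambda>n. norm (d n * (\<phi> n x * g x)))"
    using bd
  proof eventually_elim
    case (elim x)
    have "summable (\<lambda>n. cmod (d n) * cmod (g x))" using d by (rule summable_mult2)
    then show ?case by (rule summable_comparison_test') (use elim in auto)
  qed
  have sumI: "summable (\<lambda>n. LINT x|M. norm (d n * (\<phi> n x * g x)))"
  proof (rule summable_comparison_test')
    show "summable (\<lambda>n. cmod (d n) * (LINT x|M. cmod (g x)))" using d by (rule summable_mult2)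
    fix n
    have "(LINT x|M. norm (d n * (\<phi> n x * g x))) \<le> (LINT x|M. cmod (d n) * cmod (g x))"
      using bd int g by (intro integral_mono_AE) auto
    then show "norm (LINT x|M. norm (d n * (\<phi> n x * g x))) \<le> cmod (d n) * (LINT x|M. cmod (g x))"
      by (simp add: norm_mult)
  qed
  have eq: "AE x in M. (\<Sum>n. d n * (\<phi> n x * g x)) = (\<Sum>n. d n * \<phi> n x) * g x"
    using \<phi>
  proof eventually_elim
    case (elim x)
    have "summable (\<lambda>n. d n * \<phi> n x)"
      by (rule summable_comparison_test'[OF d])
        (use elim in \<open>auto simp: norm_mult mult_left_le\<close>)
    from suminf_mult2[OF this, of "g x"] show ?case by (simp add: mult.assoc)
  qed
  show "integrable M (\<lambda>x. (\<Sum>n. d n * \<phi> n x) * g x)"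
    using integrable_suminf[OF int sumAE sumI] eq by (subst (asm) integrable_cong_AE) auto
  have "(\<lambda>n. LINT x|M. d n * (\<phi> n x * g x)) sums (LINT x|M. (\<Sum>n. d n * (\<phi> n x * g x)))"
    by (rule sums_integral[OF int sumAE sumI])
  also have "(LINT x|M. (\<Sum>n. d n * (\<phi> n x * g x))) = (LINT x|M. (\<Sum>n. d n * \<phi> n x) * g x)"
    using eq by (intro integral_cong_AE) auto
  finally show "(\<lambda>n. d n * (LINT x|M. \<phi> n x * g x)) sums (LINT x|M. (\<Sum>n. d n * \<phi> n x) * g x)"
    by simp
qed

section \<open>The circle\<close>

lemma circle_measure_density:
  "circle_measure = distr (density lborel (\<lambda>x. ennreal (indicator {0..2 * pi} x / (2 * pi)))) borel cis"
proof -
  have "uniform_measure lborel {0..2 * pi} =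
      density lborel (\<lambda>x. ennreal (indicator {0..2 * pi} x / (2 * pi)))"
    unfolding uniform_measure_def
    by (rule density_cong) (auto simp: divide_ennreal[symmetric] split: split_indicator)
  then show ?thesis by (simp add: circle_measure_def)
qed

lemma sets_circle_measure [simp, measurable_cong]: "sets circle_measure = sets borel"
  by (simp add: circle_measure_def)

lemma space_circle_measure [simp]: "space circle_measure = UNIV"
  by (simp add: circle_measure_def)

lemma cis_measurable [measurable]: "cis \<in> borel_measurable borel"
  by (intro borel_measurable_continuous_onI) (auto intro!: continuous_intros)

lemma cnj_measurable [measurable]: "cnj \<in> borel_measurable borel"
  by (intro borel_measurable_continuous_onI) (auto intro!: continuous_intros)

lemma integrable_circle_iff:
  fixes f :: "complex \<Rightarrow> 'b::{banach,second_countable_topology}"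
  assumes [measurable]: "f \<in> borel_measurable borel"
  shows "integrable circle_measure f \<longleftrightarrow> set_integrable lborel {0..2 * pi} (\<lambda>t. f (cis t))"
proof -
  have "integrable circle_measure f \<longleftrightarrow>
      integrable lborel (\<lambda>t. (indicator {0..2 * pi} t / (2 * pi)) *\<^sub>R f (cis t))"
    unfolding circle_measure_density
    by (subst integrable_distr_eq) (simp_all add: integrable_density)
  also have "(\<lambda>t. (indicator {0..2 * pi} t / (2 * pi)) *\<^sub>R f (cis t)) =
      (\<lambda>t. (1 / (2 * pi)) *\<^sub>R (indicator {0..2 * pi} t *\<^sub>R f (cis t)))" by auto
  also have "integrable lborel \<dots> \<longleftrightarrow> set_integrable lborel {0..2 * pi} (\<lambda>t. f (cis t))"
    unfolding set_integrable_def
    using integrable_scaleR_right[of "1 / (2 * pi)" lborel "\<lambda>t. indicator {0..2 * pi} t *\<^sub>R f (cis t)"]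
      integrable_scaleR_right[of "2 * pi" lborel "\<lambda>t. (1 / (2 * pi)) *\<^sub>R (indicator {0..2 * pi} t *\<^sub>R f (cis t))"]
    by auto
  finally show ?thesis .
qed

lemma integral_circle:
  fixes f :: "complex \<Rightarrow> 'b::{banach,second_countable_topology}"
  assumes [measurable]: "f \<in> borel_measurable borel"
  shows "(LINT \<zeta>|circle_measure. f \<zeta>) = (1 / (2 * pi)) *\<^sub>R (LINT t:{0..2 * pi}|lborel. f (cis t))"
proof -
  have "(LINT \<zeta>|circle_measure. f \<zeta>) =
      (LINT t|lborel. (indicator {0..2 * pi} t / (2 * pi)) *\<^sub>R f (cis t))"
    unfolding circle_measure_density
    by (subst integral_distr) (simp_all add: integral_density)
  also have "(\<lambda>t. (indicator {0..2 * pi} t / (2 * pi)) *\<^sub>R f (cis t)) =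
      (\<lambda>t. (1 / (2 * pi)) *\<^sub>R (indicator {0..2 * pi} t *\<^sub>R f (cis t)))" by auto
  also have "(LINT t|lborel. (1 / (2 * pi)) *\<^sub>R (indicator {0..2 * pi} t *\<^sub>R f (cis t))) =
      (1 / (2 * pi)) *\<^sub>R (LINT t|lborel. indicator {0..2 * pi} t *\<^sub>R f (cis t))"
    by (rule integral_scaleR_right)
  finally show ?thesis by (simp only: set_lebesgue_integral_def)
qed

lemma AE_circle_iff:
  assumes [measurable]: "Measurable.pred borel P"
  shows "(AE \<zeta> in circle_measure. P \<zeta>) \<longleftrightarrow> (AE t in lborel. t \<in> {0..2 * pi} \<longrightarrow> P (cis t))"
proof -
  have "(AE \<zeta> in circle_measure. P \<zeta>) \<longleftrightarrow>
    (AE t in lborel. 0 < ennreal (indicator {0..2 * pi} t / (2 * pi)) \<longrightarrow> P (cis t))"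
    unfolding circle_measure_density by (subst AE_distr_iff) (simp_all add: AE_density)
  also have "\<dots> \<longleftrightarrow> (AE t in lborel. t \<in> {0..2 * pi} \<longrightarrow> P (cis t))"
    by (intro AE_cong) (auto simp: indicator_def)
  finally show ?thesis .
qed

lemma AE_circle_norm: "AE \<zeta> in circle_measure. cmod \<zeta> = 1"
  by (subst AE_circle_iff) auto

lemma emeasure_circle_UNIV: "emeasure circle_measure UNIV = 1"
proof -
  have "emeasure (uniform_measure lborel {0..2 * pi}) UNIV = 1"
    by (subst emeasure_uniform_measure) (auto simp: ennreal_divide_self)
  then show ?thesis
    by (simp add: circle_measure_def emeasure_distr)
qed

interpretation circle: finite_measure circle_measure
  by standard (simp add: emeasure_circle_UNIV)

lemma circle_integrable_bounded:
  fixes f :: "complex \<Rightarrow> 'b::{banach,second_countable_topology}"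
  assumes "f \<in> borel_measurable borel" "AE \<zeta> in circle_measure. norm (f \<zeta>) \<le> K"
  shows "integrable circle_measure f"
  using assms by (intro circle.integrable_const_bound[of _ K]) simp_all

lemma integral_circle_cis_int:
  fixes k :: int
  shows "(LINT t:{0..2 * pi}|lborel. cis (of_int k * t)) = (if k = 0 then 2 * pi else 0)"
proof (cases "k = 0")
  case True
  then show ?thesis by (simp add: set_lebesgue_integral_def complex_eq_iff)
next
  case False
  define F where "F z = exp (\<i> * of_int k * z) / (\<i> * of_int k)" for z
  have F: "F (of_real t) = cis (of_int k * t) / (\<i> * of_int k)" for t
    by (simp add: F_def cis_conv_exp mult.assoc)
  have "(F has_field_derivative cis (of_int k * t)) (at (of_real t))" for t
    unfolding F_def cis_conv_exp using False by (auto intro!: derivative_eq_intros simp: mult.assoc)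
  then have "((\<lambda>t. F (of_real t)) has_vector_derivative cis (of_int k * t)) (at t within {0..2*pi})" for t
    by (rule has_vector_derivative_real_field)
  then have "((\<lambda>t. cis (of_int k * t)) has_integral (F (of_real (2 * pi)) - F (of_real 0))) {0..2*pi}"
    by (intro fundamental_theorem_of_calculus) auto
  then have "((\<lambda>t. cis (of_int k * t)) has_integral
     (cis (of_int k * (2 * pi)) / (\<i> * of_int k) - cis (of_int k * 0) / (\<i> * of_int k))) {0..2*pi}"
    unfolding F .
  moreover have "cis (of_int k * (2 * pi)) = 1" using cis_multiple_2pi[of "of_int k"] by (simp add: mult.commute mult.left_commute)
  moreover have "set_integrable lborel {0..2*pi} (\<lambda>t. cis (of_int k * t))"
    unfolding set_integrable_def by (intro borel_integrable_compact) (auto intro!: continuous_intros)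
  ultimately show ?thesis
    using False by (simp add: set_borel_integral_eq_integral integral_unique)
qed

lemma integral_circle_powers:
  "(LINT \<zeta>|circle_measure. \<zeta> ^ n * cnj \<zeta> ^ m) = (if n = m then 1 else 0)"
proof -
  have "cis t ^ n * cnj (cis t) ^ m = cis (of_int (int n - int m) * t)" for t
  proof -
    have "cis t ^ n * cnj (cis t) ^ m = cis (real n * t) * cis (real m * - t)"
      by (metis Complex.DeMoivre cis_cnj)
    also have "\<dots> = cis (real n * t + real m * - t)" by (rule cis_mult)
    finally show ?thesis by (simp add: algebra_simps)
  qed
  then show ?thesis
    by (subst integral_circle) (auto simp: integral_circle_cis_int scaleR_conv_of_real simp del: of_int_diff)
qed

section \<open>Square-summable sequences\<close>

text \<open>\<open>H2\<close> is a set of functions whose norm goes through boundary values, whereas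
  the operator theory above needs a complete inner product type. Sequences of Taylor coefficients
  provide one, and \<open>ev\<close> later carries it onto \<open>H2\<close>.\<close>

typedef ell2 = "{a :: nat \<Rightarrow> complex. summable (\<lambda>n. (cmod (a n))\<^sup>2)}"
  morphisms coef Abs_ell2
  by (rule exI[of _ "\<lambda>_. 0"]) simp

setup_lifting type_definition_ell2

lemma coef_eqI: "(\<And>n. coef x n = coef y n) \<Longrightarrow> x = y"
  by (metis coef_inject ext)

lemma summable_coef_sq: "summable (\<lambda>n. (cmod (coef x n))\<^sup>2)"
  using coef by simp

lemma summable_square_add:
  fixes a b :: "nat \<Rightarrow> complex"
  assumes "summable (\<lambda>n. (cmod (a n))\<^sup>2)" "summable (\<lambda>n. (cmod (b n))\<^sup>2)"
  shows "summable (\<lambda>n. (cmod (a n + b n))\<^sup>2)"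
proof (rule summable_comparison_test')
  show "summable (\<lambda>n. 2 * (cmod (a n))\<^sup>2 + 2 * (cmod (b n))\<^sup>2)"
    using assms by (intro summable_add summable_mult)
  fix n
  have "(cmod (a n + b n))\<^sup>2 \<le> (cmod (a n) + cmod (b n))\<^sup>2"
    by (simp add: norm_triangle_ineq power_mono)
  then show "norm ((cmod (a n + b n))\<^sup>2) \<le> 2 * (cmod (a n))\<^sup>2 + 2 * (cmod (b n))\<^sup>2"
    using sum_squares_bound[of "cmod (a n)" "cmod (b n)"] by (simp add: power2_sum)
qed

lemma summable_square_cmult:
  fixes a :: "nat \<Rightarrow> complex"
  assumes "summable (\<lambda>n. (cmod (a n))\<^sup>2)"
  shows "summable (\<lambda>n. (cmod (c * a n))\<^sup>2)"
  using summable_mult[OF assms, of "(cmod c)\<^sup>2"] by (simp add: norm_mult power_mult_distrib)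

text \<open>Complex scaling is kept apart from the real scaling of the type class; a bounded
  real-linear operator is complex linear when it commutes with \<open>cscale\<close>.\<close>

lift_definition cscale :: "complex \<Rightarrow> ell2 \<Rightarrow> ell2" is "\<lambda>c a n. c * a n"
  by (rule summable_square_cmult)

instantiation ell2 :: real_vector
begin

lift_definition zero_ell2 :: ell2 is "\<lambda>_. 0" by simp
lift_definition plus_ell2 :: "ell2 \<Rightarrow> ell2 \<Rightarrow> ell2" is "\<lambda>a b n. a n + b n"
  by (rule summable_square_add)
lift_definition uminus_ell2 :: "ell2 \<Rightarrow> ell2" is "\<lambda>a n. - a n" by simp
definition minus_ell2 :: "ell2 \<Rightarrow> ell2 \<Rightarrow> ell2" where "minus_ell2 x y = x + (- y)"
definition scaleR_ell2 :: "real \<Rightarrow> ell2 \<Rightarrow> ell2" where "scaleR_ell2 r x = cscale (of_real r) x"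

lemma coef_pointwise [simp]:
  "coef 0 n = 0" "coef (x + y) n = coef x n + coef y n" "coef (- x) n = - coef x n"
  "coef (x - y) n = coef x n - coef y n" "coef (cscale c x) n = c * coef x n"
  "coef (r *\<^sub>R x) n = of_real r * coef x n"
  by (simp_all add: zero_ell2.rep_eq plus_ell2.rep_eq uminus_ell2.rep_eq minus_ell2_def
      scaleR_ell2_def cscale.rep_eq)

instance
  by standard (rule coef_eqI, simp add: algebra_simps)+

end

lemma summable_cinner: "summable (\<lambda>n. coef x n * cnj (coef y n))"
proof (rule summable_comparison_test')
  show "summable (\<lambda>n. (cmod (coef x n))\<^sup>2 + (cmod (coef y n))\<^sup>2)"
    by (intro summable_add summable_coef_sq)
  fix n
  show "norm (coef x n * cnj (coef y n)) \<le> (cmod (coef x n))\<^sup>2 + (cmod (coef y n))\<^sup>2"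
    using sum_squares_bound[of "cmod (coef x n)" "cmod (coef y n)"]
      mult_nonneg_nonneg[OF norm_ge_zero[of "coef x n"] norm_ge_zero[of "coef y n"]]
    unfolding norm_mult complex_mod_cnj by linarith
qed

definition cinner :: "ell2 \<Rightarrow> ell2 \<Rightarrow> complex" where
  "cinner x y = (\<Sum>n. coef x n * cnj (coef y n))"

lemma cinner_add_left: "cinner (x + y) z = cinner x z + cinner y z"
  unfolding cinner_def by (subst suminf_add[OF summable_cinner summable_cinner]) (simp add: algebra_simps)

lemma cinner_scale_left: "cinner (cscale c x) y = c * cinner x y"
  unfolding cinner_def by (subst suminf_mult[OF summable_cinner, symmetric]) (simp add: algebra_simps)

lemma cinner_commute: "cinner y x = cnj (cinner x y)"
  unfolding cinner_def using bounded_linear.suminf[OF bounded_linear_cnj summable_cinner, of x y]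
  by (simp add: mult.commute)

lemma cinner_self: "cinner x x = of_real (\<Sum>n. (cmod (coef x n))\<^sup>2)"
  unfolding cinner_def by (subst suminf_of_real[OF summable_coef_sq]) (simp only: complex_norm_square)

instantiation ell2 :: real_inner
begin

definition inner_ell2 :: "ell2 \<Rightarrow> ell2 \<Rightarrow> real" where "inner_ell2 x y = Re (cinner x y)"
definition norm_ell2 :: "ell2 \<Rightarrow> real" where "norm_ell2 x = sqrt (inner x x)"
definition sgn_ell2 :: "ell2 \<Rightarrow> ell2" where "sgn_ell2 x = x /\<^sub>R norm x"
definition dist_ell2 :: "ell2 \<Rightarrow> ell2 \<Rightarrow> real" where "dist_ell2 x y = norm (x - y)"
definition uniformity_ell2 :: "(ell2 \<times> ell2) filter" where
  "uniformity_ell2 = (INF e\<in>{0 <..}. principal {(x, y). dist x y < e})"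
definition open_ell2 :: "ell2 set \<Rightarrow> bool" where
  "open_ell2 S = (\<forall>x\<in>S. \<forall>\<^sub>F (x', y) in uniformity. x' = x \<longrightarrow> y \<in> S)"

instance
proof
  fix x y z :: ell2 and r :: real
  show "inner x y = inner y x"
    by (simp add: inner_ell2_def cinner_commute[of x y])
  show "inner (x + y) z = inner x z + inner y z"
    by (simp add: inner_ell2_def cinner_add_left)
  show "inner (r *\<^sub>R x) y = r * inner x y"
    by (simp add: inner_ell2_def scaleR_ell2_def cinner_scale_left)
  show "0 \<le> inner x x"
    by (simp add: inner_ell2_def cinner_self suminf_nonneg summable_coef_sq)
  show "inner x x = 0 \<longleftrightarrow> x = 0"
  proof
    assume "inner x x = 0"
    then have "\<forall>n. (cmod (coef x n))\<^sup>2 = 0"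
      by (subst suminf_eq_zero_iff[symmetric]) (auto simp: inner_ell2_def cinner_self summable_coef_sq)
    then show "x = 0" by (intro coef_eqI) simp
  qed (simp add: inner_ell2_def cinner_def)
qed (rule norm_ell2_def sgn_ell2_def dist_ell2_def uniformity_ell2_def open_ell2_def)+

end

lemma norm_ell2_sq: "(norm x)\<^sup>2 = (\<Sum>n. (cmod (coef x n))\<^sup>2)"
  by (simp add: power2_norm_eq_inner inner_ell2_def cinner_self)

lemma norm_coef_le: "cmod (coef x n) \<le> norm x"
proof -
  have "(\<Sum>k\<in>{n}. (cmod (coef x k))\<^sup>2) \<le> (norm x)\<^sup>2"
    unfolding norm_ell2_sq by (intro sum_le_suminf summable_coef_sq) auto
  then have "(cmod (coef x n))\<^sup>2 \<le> (norm x)\<^sup>2" by simp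
  then show ?thesis by (rule power2_le_imp_le) simp
qed

lemma inner_eq_Re_cinner: "inner x y = Re (cinner x y)"
  by (simp add: inner_ell2_def)

lemma norm_cscale [simp]: "norm (cscale c x) = cmod c * norm x"
proof -
  have "(norm (cscale c x))\<^sup>2 = (cmod c * norm x)\<^sup>2"
    by (simp add: norm_ell2_sq norm_mult power_mult_distrib suminf_mult summable_coef_sq)
  then show ?thesis by (rule power2_eq_imp_eq) simp_all
qed

text \<open>Membership and norm bound come from finite sums only, so the criterion applies to
  sequences known merely as coordinatewise limits.\<close>

lemma ell2_partial_sums_bounded:
  assumes "\<And>N. (\<Sum>n<N. (cmod (a n))\<^sup>2) \<le> K\<^sup>2" "0 \<le> K"
  shows "\<exists>x. coef x = a \<and> norm x \<le> K"
proof -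
  have s: "summable (\<lambda>n. (cmod (a n))\<^sup>2)"
    by (rule summableI_nonneg_bounded[OF _ assms(1)]) simp
  then have c: "coef (Abs_ell2 a) = a" by (simp add: Abs_ell2_inverse)
  have "(norm (Abs_ell2 a))\<^sup>2 \<le> K\<^sup>2"
    unfolding norm_ell2_sq c by (rule suminf_le_const[OF s assms(1)])
  then show ?thesis using c assms(2) power2_le_imp_le by blast
qed

instance ell2 :: banach
proof
  fix X :: "nat \<Rightarrow> ell2"
  assume X: "Cauchy X"
  have "Cauchy (\<lambda>k. coef (X k) n)" for n
  proof (rule metric_CauchyI)
    fix e :: real assume "0 < e"
    then obtain M where "\<forall>m\<ge>M. \<forall>k\<ge>M. dist (X m) (X k) < e" using X metric_CauchyD by blast
    then show "\<exists>M. \<forall>m\<ge>M. \<forall>k\<ge>M. dist (coef (X m) n) (coef (X k) n) < e"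
      using norm_coef_le[of "X _ - X _" n] by (metis coef_pointwise(4) dist_norm le_less_trans)
  qed
  then have "\<exists>a. (\<lambda>k. coef (X k) n) \<longlonglongrightarrow> a" for n
    using Cauchy_convergent_iff convergent_def by blast
  then obtain a where a: "\<And>n. (\<lambda>k. coef (X k) n) \<longlonglongrightarrow> a n" by metis
  \<comment> \<open>The coordinatewise limit \<open>a\<close> is not yet known to be square
    summable. The partial sums for \<open>X m - a\<close> are limits of those for
    \<open>X m - X k\<close>, so the difference lies in \<open>ell2\<close>; the limit is then
    reached as \<open>X M1\<close> minus such a difference.\<close>
  have close: "\<exists>d. coef d = (\<lambda>n. coef (X m) n - a n) \<and> norm d \<le> e"
    if e: "0 < e" and M: "\<And>m k. m \<ge> M \<Longrightarrow> k \<ge> M \<Longrightarrow> dist (X m) (X k) < e" and m: "m \<ge> M" for e M m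
  proof (rule ell2_partial_sums_bounded)
    fix N
    have "(\<lambda>k. \<Sum>n<N. (cmod (coef (X m) n - coef (X k) n))\<^sup>2) \<longlonglongrightarrow> (\<Sum>n<N. (cmod (coef (X m) n - a n))\<^sup>2)"
      by (intro tendsto_intros a)
    moreover have "(\<Sum>n<N. (cmod (coef (X m) n - coef (X k) n))\<^sup>2) \<le> e\<^sup>2" if "k \<ge> M" for k
    proof -
      have "(\<Sum>n<N. (cmod (coef (X m - X k) n))\<^sup>2) \<le> (norm (X m - X k))\<^sup>2"
        unfolding norm_ell2_sq by (intro sum_le_suminf summable_coef_sq) auto
      also have "\<dots> \<le> e\<^sup>2"
        using M[OF m that] by (intro power_mono) (auto simp: dist_norm)
      finally show ?thesis by simp
    qed
    ultimately show "(\<Sum>n<N. (cmod (coef (X m) n - a n))\<^sup>2) \<le> e\<^sup>2"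
      by (intro LIMSEQ_le_const2) auto
  qed (use e in simp)
  obtain M1 where M1: "\<And>m k. m \<ge> M1 \<Longrightarrow> k \<ge> M1 \<Longrightarrow> dist (X m) (X k) < 1"
    using X metric_CauchyD zero_less_one by metis
  obtain d where d: "coef d = (\<lambda>n. coef (X M1) n - a n)"
    using close[OF zero_less_one M1] by blast
  define L where "L = X M1 - d"
  have L: "coef L n = a n" for n by (simp add: L_def d)
  have "X \<longlonglongrightarrow> L"
  proof (rule metric_LIMSEQ_I)
    fix e :: real assume "0 < e"
    then have e2: "0 < e / 2" by simp
    obtain M where M: "\<And>m k. m \<ge> M \<Longrightarrow> k \<ge> M \<Longrightarrow> dist (X m) (X k) < e / 2"
      using X metric_CauchyD e2 by metis
    have "dist (X m) L < e" if m: "m \<ge> M" for m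
    proof -
      obtain d where d: "coef d = (\<lambda>n. coef (X m) n - a n)" "norm d \<le> e / 2"
        using close[OF e2 M m] by blast
      have "X m - L = d" by (intro coef_eqI) (simp add: d L)
      then show ?thesis using d(2) \<open>0 < e\<close> by (simp add: dist_norm)
    qed
    then show "\<exists>M. \<forall>m\<ge>M. dist (X m) L < e" by blast
  qed
  then show "convergent X" unfolding convergent_def by blast
qed

lift_definition basis :: "nat \<Rightarrow> ell2" is "\<lambda>k n. if n = k then 1 else 0"
  by (intro summable_finite[of "{_}"]) auto

lemma coef_basis [simp]: "coef (basis k) n = (if n = k then 1 else 0)"
  by (simp add: basis.rep_eq)

lemma cinner_basis [simp]: "cinner x (basis k) = coef x k"
  unfolding cinner_def by (subst suminf_finite[of "{k}"]) auto

text \<open>Im <x, y> = Re <x, i y> for a form that is conjugate linear in the second argument.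
  Facts about the real inner product become complex ones through this identity.\<close>

lemma cinner_eq_inner: "cinner x y = Complex (inner x y) (inner x (cscale \<i> y))"
  using cinner_scale_left[of \<i> y x] cinner_commute[of x y] cinner_commute[of x "cscale \<i> y"]
  by (simp add: inner_eq_Re_cinner complex_eq_iff)

text \<open>Multiplication by z^k in terms of Taylor coefficients.\<close>

lift_definition shift :: "nat \<Rightarrow> ell2 \<Rightarrow> ell2" is "\<lambda>k a n. if n < k then 0 else a (n - k)"
proof -
  fix k :: nat and a :: "nat \<Rightarrow> complex"
  assume "summable (\<lambda>n. (cmod (a n))\<^sup>2)"
  then have "summable (\<lambda>n. (cmod (if n + k < k then 0 else a (n + k - k)))\<^sup>2)" by simp
  then show "summable (\<lambda>n. (cmod (if n < k then 0 else a (n - k)))\<^sup>2)"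
    by (subst (asm) summable_iff_shift)
qed

lemma coef_shift: "coef (shift k x) n = (if n < k then 0 else coef x (n - k))"
  by (simp add: shift.rep_eq)

section \<open>Poisson integrals and Fatou's theorem\<close>

definition poisson :: "complex \<Rightarrow> complex \<Rightarrow> real" where
  "poisson z \<zeta> = (1 - (cmod z)\<^sup>2) / (cmod (\<zeta> - z))\<^sup>2"

text \<open>Coefficients of the Herglotz kernel (\<zeta> + z)/(\<zeta> - z) = 1 + 2 (w + w^2 + ...)
  with w = z cnj \<zeta>, for \<zeta> on the circle.\<close>

definition herglotz_coeff :: "nat \<Rightarrow> complex" where
  "herglotz_coeff n = (if n = 0 then 1 else 2)"

lemma herglotz_kernel_sums:
  assumes "cmod \<zeta> = 1" "cmod z < 1"
  shows "(\<lambda>n. herglotz_coeff n * z ^ n * cnj \<zeta> ^ n) sums ((\<zeta> + z) / (\<zeta> - z))"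
proof -
  define w where "w = z * cnj \<zeta>"
  have w: "cmod w < 1" using assms by (simp add: w_def norm_mult)
  have "(\<lambda>n. 2 * w ^ n - (if n = 0 then 1 else 0)) sums (2 * (1 / (1 - w)) - 1)"
    using sums_single[of 0 "\<lambda>_. 1 :: complex"]
    by (intro sums_diff sums_mult geometric_sums w) (simp add: eq_commute)
  also have "(\<lambda>n. 2 * w ^ n - (if n = 0 then 1 else 0)) = (\<lambda>n. herglotz_coeff n * z ^ n * cnj \<zeta> ^ n)"
    by (auto simp: fun_eq_iff herglotz_coeff_def w_def power_mult_distrib)
  also have "2 * (1 / (1 - w)) - 1 = (\<zeta> + z) / (\<zeta> - z)"
  proof -
    have "\<zeta> * cnj \<zeta> = 1" using assms(1) complex_norm_square[of \<zeta>] by simp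
    then have w': "\<zeta> * w = z" by (simp add: w_def algebra_simps)
    have nz: "1 - w \<noteq> 0" "\<zeta> \<noteq> 0" using w assms by auto
    have "(\<zeta> + z) / (\<zeta> - z) = (\<zeta> * (1 + w)) / (\<zeta> * (1 - w))" by (simp add: algebra_simps w')
    also have "\<dots> = (1 + w) / (1 - w)" using nz by simp
    also have "\<dots> = 2 * (1 / (1 - w)) - 1" using nz by (simp add: field_simps)
    finally show ?thesis ..
  qed
  finally show ?thesis .
qed

lemma Re_herglotz_kernel:
  assumes "cmod \<zeta> = 1" "cmod z < 1"
  shows "Re ((\<zeta> + z) / (\<zeta> - z)) = poisson z \<zeta>"
proof -
  have "Re ((\<zeta> + z) * cnj (\<zeta> - z)) = (cmod \<zeta>)\<^sup>2 - (cmod z)\<^sup>2"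
    unfolding cmod_power2 by (simp add: algebra_simps power2_eq_square)
  then show ?thesis
    by (simp add: poisson_def complex_div_cnj[of "\<zeta> + z"] Re_divide_of_real assms(1) flip: of_real_power)
qed

lemma poisson_measurable [measurable]: "poisson z \<in> borel_measurable borel"
  unfolding poisson_def by measurable

lemma poisson_nonneg: "cmod z < 1 \<Longrightarrow> 0 \<le> poisson z \<zeta>"
  unfolding poisson_def by (simp add: abs_square_le_1)

lemma poisson_bounded:
  assumes "cmod \<zeta> = 1" "cmod z < 1"
  shows "poisson z \<zeta> \<le> 1 / (1 - cmod z)\<^sup>2"
proof -
  have "1 - cmod z \<le> cmod (\<zeta> - z)" using norm_triangle_ineq2[of \<zeta> z] assms by simp
  then have "(1 - cmod z)\<^sup>2 \<le> (cmod (\<zeta> - z))\<^sup>2" using assms by (intro power_mono) auto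
  moreover have "0 < (1 - cmod z)\<^sup>2" using assms by simp
  ultimately show ?thesis unfolding poisson_def by (intro frac_le) auto
qed

lemma integrable_poisson_mult:
  fixes u :: "complex \<Rightarrow> complex"
  assumes u: "integrable circle_measure u" and z: "cmod z < 1"
  shows "integrable circle_measure (\<lambda>\<zeta>. poisson z \<zeta> *\<^sub>R u \<zeta>)"
proof -
  have [measurable]: "u \<in> borel_measurable borel" using borel_measurable_integrable[OF u] by simp
  have "integrable circle_measure (\<lambda>\<zeta>. (1 / (1 - cmod z)\<^sup>2) *\<^sub>R u \<zeta>)" using u by simp
  then show ?thesis
  proof (rule Bochner_Integration.integrable_bound)
    show "AE \<zeta> in circle_measure. norm (poisson z \<zeta> *\<^sub>R u \<zeta>) \<le> norm ((1 / (1 - cmod z)\<^sup>2) *\<^sub>R u \<zeta>)"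
      using AE_circle_norm
    proof eventually_elim
      case (elim \<zeta>)
      show ?case using poisson_bounded[OF elim z] poisson_nonneg[OF z, of \<zeta>]
        using mult_right_mono[OF poisson_bounded[OF elim z] norm_ge_zero[of "u \<zeta>"]] by simp
    qed
  qed measurable
qed

text \<open>Expanding the kernel turns the integral into a power series in z whose coefficients are
  Fourier coefficients of \<open>u\<close>. This yields the normalisation of the Poisson kernel and,
  later, analytic functions with prescribed real part on the circle.\<close>

lemma integral_herglotz_sums:
  fixes u :: "complex \<Rightarrow> complex"
  assumes u: "integrable circle_measure u" and z: "cmod z < 1"
  shows "integrable circle_measure (\<lambda>\<zeta>. (\<zeta> + z) / (\<zeta> - z) * u \<zeta>)"
    and "(\<lambda>n. herglotz_coeff n * z ^ n * (LINT \<zeta>|circle_measure. cnj \<zeta> ^ n * u \<zeta>)) sums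
      (LINT \<zeta>|circle_measure. (\<zeta> + z) / (\<zeta> - z) * u \<zeta>)"
proof -
  have [measurable]: "u \<in> borel_measurable borel" using borel_measurable_integrable[OF u] by simp
  have \<phi>: "AE \<zeta> in circle_measure. \<forall>n. cmod (cnj \<zeta> ^ n) \<le> 1"
    using AE_circle_norm by eventually_elim (simp add: norm_power)
  have "summable (\<lambda>n. 2 * cmod z ^ n)"
    using z by (intro summable_mult summable_geometric) simp
  then have d: "summable (\<lambda>n. cmod (herglotz_coeff n * z ^ n))"
    by (rule summable_comparison_test') (auto simp: herglotz_coeff_def norm_mult norm_power)
  have eq: "AE \<zeta> in circle_measure. (\<Sum>n. herglotz_coeff n * z ^ n * cnj \<zeta> ^ n) * u \<zeta> = (\<zeta> + z) / (\<zeta> - z) * u \<zeta>"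
    using AE_circle_norm by eventually_elim (simp add: sums_unique[OF herglotz_kernel_sums[OF _ z], symmetric])
  have m: "(\<lambda>\<zeta>. cnj \<zeta> ^ n) \<in> borel_measurable circle_measure" for n by measurable
  note ex = integral_series_exchange[OF m \<phi> u d]
  show "integrable circle_measure (\<lambda>\<zeta>. (\<zeta> + z) / (\<zeta> - z) * u \<zeta>)"
    using integrable_cong_AE_imp[OF ex(1) _ eq] by simp
  show "(\<lambda>n. herglotz_coeff n * z ^ n * (LINT \<zeta>|circle_measure. cnj \<zeta> ^ n * u \<zeta>)) sums
      (LINT \<zeta>|circle_measure. (\<zeta> + z) / (\<zeta> - z) * u \<zeta>)"
    using ex(2) integral_cong_AE[OF _ _ eq] borel_measurable_integrable[OF ex(1)] by simp
qed

lemma integral_poisson: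
  assumes z: "cmod z < 1"
  shows "(LINT \<zeta>|circle_measure. poisson z \<zeta>) = 1"
proof -
  have c: "(LINT \<zeta>|circle_measure. cnj \<zeta> ^ n) = (if n = 0 then 1 else 0)" for n
    using integral_circle_powers[of 0 n] by auto
  have int1: "integrable circle_measure (\<lambda>_. 1 :: complex)" by simp
  have "(\<lambda>n. if n = 0 then 1 else 0) sums (LINT \<zeta>|circle_measure. (\<zeta> + z) / (\<zeta> - z))"
    using integral_herglotz_sums(2)[OF int1 z]
    by (simp add: c herglotz_coeff_def if_distrib cong: if_cong)
  then have "(LINT \<zeta>|circle_measure. (\<zeta> + z) / (\<zeta> - z)) = 1"
    using sums_single[of 0 "\<lambda>_. 1 :: complex"] by (simp add: sums_iff eq_commute[of 0])
  moreover have "(LINT \<zeta>|circle_measure. poisson z \<zeta>) = (LINT \<zeta>|circle_measure. Re ((\<zeta> + z) / (\<zeta> - z)))"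
    using AE_circle_norm by (intro integral_cong_AE) (auto elim!: eventually_mono simp: Re_herglotz_kernel[OF _ z])
  ultimately show ?thesis
    using integral_herglotz_sums(1)[OF int1 z] by simp
qed

section \<open>The Poisson kernel as a function of the angle\<close>

definition poisson_arc :: "real \<Rightarrow> real \<Rightarrow> real" where
  "poisson_arc r x = (1 - r\<^sup>2) / (1 - 2 * r * cos x + r\<^sup>2)"

lemma poisson_arc_denominator:
  fixes r :: real
  assumes "0 \<le> r" "r < 1"
  shows "(1 - r)\<^sup>2 \<le> 1 - 2 * r * cos x + r\<^sup>2" "0 < 1 - 2 * r * cos x + r\<^sup>2"
proof -
  have "r * cos x \<le> r * 1" using assms by (intro mult_left_mono) auto
  then show *: "(1 - r)\<^sup>2 \<le> 1 - 2 * r * cos x + r\<^sup>2" by (simp add: power2_diff)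
  have "0 < (1 - r)\<^sup>2" using assms by simp
  then show "0 < 1 - 2 * r * cos x + r\<^sup>2" using * by linarith
qed

lemma poisson_cis:
  assumes "0 \<le> r" "r < 1"
  shows "poisson (of_real r * cis \<theta>) (cis t) = poisson_arc r (t - \<theta>)"
proof -
  have "(cmod (cis t - of_real r * cis \<theta>))\<^sup>2 = (cos t - r * cos \<theta>)\<^sup>2 + (sin t - r * sin \<theta>)\<^sup>2"
    unfolding cmod_power2 by simp
  also have "\<dots> =
    ((cos t)\<^sup>2 + (sin t)\<^sup>2) - 2 * r * (cos t * cos \<theta> + sin t * sin \<theta>) + r\<^sup>2 * ((cos \<theta>)\<^sup>2 + (sin \<theta>)\<^sup>2)"
    by (simp only: power2_diff power_mult_distrib) (simp only: algebra_simps)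
  finally have "(cmod (cis t - of_real r * cis \<theta>))\<^sup>2 = 1 - 2 * r * cos (t - \<theta>) + r\<^sup>2"
    by (simp add: cos_diff)
  then show ?thesis using assms by (simp add: poisson_def poisson_arc_def norm_mult)
qed

lemma poisson_arc_minus [simp]: "poisson_arc r (- x) = poisson_arc r x"
  by (simp add: poisson_arc_def)

lemma continuous_on_poisson_arc [continuous_intros]:
  assumes "0 \<le> r" "r < 1"
  shows "continuous_on S (poisson_arc r)"
  unfolding poisson_arc_def using poisson_arc_denominator(2)[OF assms]
  by (auto intro!: continuous_intros simp: less_imp_neq[THEN not_sym])

lemma poisson_arc_nonneg: "0 \<le> r \<Longrightarrow> r < 1 \<Longrightarrow> 0 \<le> poisson_arc r x"
  using poisson_arc_denominator(2)[of r x] by (simp add: poisson_arc_def abs_square_le_1)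

lemma integral_poisson_arc_le:
  assumes r: "0 \<le> r" "r < 1" and d: "0 \<le> d" "d \<le> 2 * pi"
  shows "integral {0..d} (poisson_arc r) \<le> 2 * pi"
proof -
  have cont: "continuous_on S (poisson_arc r)" for S by (rule continuous_on_poisson_arc[OF r])
  have si: "set_integrable lborel {0..2 * pi} (poisson_arc r)"
    unfolding set_integrable_def by (intro borel_integrable_compact cont) auto
  have "1 = (LINT \<zeta>|circle_measure. poisson (of_real r) \<zeta>)"
    using r by (simp add: integral_poisson)
  also have "\<dots> = (1 / (2 * pi)) *\<^sub>R (LINT t:{0..2 * pi}|lborel. poisson (of_real r) (cis t))"
    by (rule integral_circle) measurable
  also have "(LINT t:{0..2 * pi}|lborel. poisson (of_real r) (cis t)) = (LINT t:{0..2 * pi}|lborel. poisson_arc r t)"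
    using poisson_cis[OF r, of 0] by simp
  also have "\<dots> = integral {0..2 * pi} (poisson_arc r)"
    using si by (rule set_borel_integral_eq_integral)
  finally have "integral {0..2 * pi} (poisson_arc r) = 2 * pi" by (simp add: field_simps)
  moreover have "integral {0..d} (poisson_arc r) \<le> integral {0..2 * pi} (poisson_arc r)"
    using d poisson_arc_nonneg[OF r] by (intro integral_subset_le integrable_continuous_real cont) auto
  ultimately show ?thesis by simp
qed

section \<open>Integration by parts against a decreasing kernel\<close>

text \<open>Holds for arbitrary \<open>f\<close>, measurable or not: a function that is not
  integrable has integral 0 by convention, and \<open>g\<close> is nonnegative.\<close>

lemma integral_norm_le_integral:
  fixes f :: "'a \<Rightarrow> 'b::{banach,second_countable_topology}"
  assumes "integrable M g" "\<And>x. norm (f x) \<le> g x"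
  shows "norm (integral\<^sup>L M f) \<le> integral\<^sup>L M g"
proof (cases "integrable M f")
  case True
  have "norm (integral\<^sup>L M f) \<le> (LINT x|M. norm (f x))" by (rule integral_norm_bound)
  also have "\<dots> \<le> integral\<^sup>L M g" using True assms by (intro integral_mono) auto
  finally show ?thesis .
next
  case False
  moreover have "0 \<le> integral\<^sup>L M g"
    by (intro Bochner_Integration.integral_nonneg) (metis assms(2) norm_ge_zero order_trans)
  ultimately show ?thesis by (simp add: not_integrable_integral_eq)
qed

text \<open>Both sides integrate \<open>w t * q s\<close> over the triangle 0 <= t <= s <= d. The
  cut-off \<open>h\<close> is dominated by a product of functions of one variable, which supplies
  the integrability for Fubini's theorem.\<close>

lemma triangle_Fubini:
  fixes w :: "real \<Rightarrow> complex" and q :: "real \<Rightarrow> real"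
  assumes w: "set_integrable lborel {0..d} w" and q: "continuous_on {0..d} q"
  shows "(LINT t:{0..d}|lborel. w t * of_real (integral {t..d} q)) =
    (LINT s:{0..d}|lborel. of_real (q s) * (LINT t:{0..s}|lborel. w t))"
proof -
  define W where "W t = indicator {0..d} t *\<^sub>R w t" for t
  define Q where "Q s = indicator {0..d} s *\<^sub>R q s" for s
  have W: "integrable lborel W" using w unfolding set_integrable_def W_def .
  have Q: "integrable lborel Q" unfolding Q_def by (intro borel_integrable_compact q) auto
  have [measurable]: "W \<in> borel_measurable borel" "Q \<in> borel_measurable borel"
    using borel_measurable_integrable[OF W] borel_measurable_integrable[OF Q] by auto
  define h where "h t s = indicator {t..} s *\<^sub>R (W t * of_real (Q s))" for t s
  have hm: "(\<lambda>(t, s). h t s) \<in> borel_measurable (lborel \<Otimes>\<^sub>M lborel)"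
  proof -
    have "(\<lambda>(t, s). h t s) = (\<lambda>x. if fst x \<le> snd x then W (fst x) * of_real (Q (snd x)) else 0)"
      by (auto simp: h_def indicator_def fun_eq_iff)
    moreover have "\<dots> \<in> borel_measurable (lborel \<Otimes>\<^sub>M lborel)" by measurable
    ultimately show ?thesis by simp
  qed
  have WQ: "integrable (lborel \<Otimes>\<^sub>M lborel) (\<lambda>(t, s). W t * of_real (Q s))"
  proof (rule lborel_pair.Fubini_integrable)
    have "(\<lambda>t. LINT s|lborel. cmod (case (t, s) of (t, s) \<Rightarrow> W t * of_real (Q s))) =
      (\<lambda>t. cmod (W t) * (LINT s|lborel. \<bar>Q s\<bar>))"
      by (simp add: norm_mult)
    then show "integrable lborel (\<lambda>t. LINT s|lborel. cmod (case (t, s) of (t, s) \<Rightarrow> W t * of_real (Q s)))"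
      using W by simp
    show "AE t in lborel. integrable lborel (\<lambda>s. case (t, s) of (t, s) \<Rightarrow> W t * of_real (Q s))"
      using Q by simp
  qed measurable
  have h: "integrable (lborel \<Otimes>\<^sub>M lborel) (\<lambda>(t, s). h t s)"
    by (rule Bochner_Integration.integrable_bound[OF WQ hm]) (auto simp: h_def split: split_indicator)
  have "(LINT t:{0..d}|lborel. w t * of_real (integral {t..d} q)) = (LINT t|lborel. LINT s|lborel. h t s)"
    unfolding set_lebesgue_integral_def
  proof (rule Bochner_Integration.integral_cong)
    fix t
    show "indicator {0..d} t *\<^sub>R (w t * of_real (integral {t..d} q)) = (LINT s|lborel. h t s)"
    proof (cases "t \<in> {0..d}")
      case True
      have si: "set_integrable lborel {t..d} q"
        unfolding set_integrable_def using True
        by (intro borel_integrable_compact continuous_on_subset[OF q]) auto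
      have "integral {t..d} q = (LINT s|lborel. indicator {t..d} s *\<^sub>R q s)"
        using set_borel_integral_eq_integral(2)[OF si] by (simp add: set_lebesgue_integral_def)
      also have "of_real \<dots> = (LINT s|lborel. complex_of_real (indicator {t..d} s *\<^sub>R q s))"
        using si unfolding set_integrable_def by (rule integral_of_real[symmetric])
      finally have "w t * of_real (integral {t..d} q) = (LINT s|lborel. w t * of_real (indicator {t..d} s *\<^sub>R q s))"
        by simp
      also have "\<dots> = (LINT s|lborel. h t s)"
        using True by (intro Bochner_Integration.integral_cong) (auto simp: h_def W_def Q_def indicator_def)
      finally show ?thesis using True by simp
    qed (simp add: h_def W_def)
  qed simp
  also have "\<dots> = (LINT s|lborel. LINT t|lborel. h t s)"
    by (rule lborel_pair.Fubini_integral[OF h, symmetric])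
  also have "\<dots> = (LINT s:{0..d}|lborel. of_real (q s) * (LINT t:{0..s}|lborel. w t))"
    unfolding set_lebesgue_integral_def
  proof (rule Bochner_Integration.integral_cong)
    fix s
    have "h t s = (indicator {0..d} s * of_real (q s)) * (indicator {0..s} t *\<^sub>R w t)" for t
      by (auto simp: h_def W_def Q_def indicator_def)
    then show "(LINT t|lborel. h t s) =
        indicator {0..d} s *\<^sub>R (of_real (q s) * (LINT t|lborel. indicator {0..s} t *\<^sub>R w t))"
      by (simp add: scaleR_conv_of_real indicator_def)
  qed simp
  finally show ?thesis .
qed

text \<open>
  Integration by parts against the primitive of \<open>w\<close>: writing \<open>P t = P d + \<integral>\<^bsub>[t,d]\<^esub> (- P')\<close>
  represents \<open>P\<close> as a positive mixture of indicators of intervals \<open>[0,s]\<close>.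
\<close>

lemma decreasing_kernel_bound:
  fixes w :: "real \<Rightarrow> complex" and P P' :: "real \<Rightarrow> real"
  assumes w: "set_integrable lborel {0..d} w" and d: "0 \<le> d" and e: "0 \<le> e"
    and small: "\<And>s. 0 \<le> s \<Longrightarrow> s \<le> d \<Longrightarrow> cmod (LINT t:{0..s}|lborel. w t) \<le> e * s"
    and deriv: "\<And>t. 0 \<le> t \<Longrightarrow> t \<le> d \<Longrightarrow> (P has_real_derivative P' t) (at t)"
    and cont: "continuous_on {0..d} P'" and P': "\<And>t. 0 \<le> t \<Longrightarrow> t \<le> d \<Longrightarrow> P' t \<le> 0"
    and P: "0 \<le> P d"
  shows "cmod (LINT t:{0..d}|lborel. w t * of_real (P t)) \<le> e * integral {0..d} P"
proof -
  define q where "q s = - P' s" for s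
  have q: "continuous_on {0..d} q" unfolding q_def by (intro continuous_intros cont)
  have contP: "continuous_on {0..d} P"
    using deriv by (intro continuous_at_imp_continuous_on ballI DERIV_isCont) auto
  have Pq: "P t = P d + integral {t..d} q" if "0 \<le> t" "t \<le> d" for t
  proof -
    have "(P has_vector_derivative P' s) (at s within {t..d})" if "s \<in> {t..d}" for s
      using deriv[of s] that \<open>0 \<le> t\<close>
      by (simp add: has_field_derivative_at_within has_real_derivative_iff_has_vector_derivative[symmetric])
    then have "(P' has_integral (P d - P t)) {t..d}"
      using that by (intro fundamental_theorem_of_calculus) auto
    from has_integral_neg[OF this] have "integral {t..d} q = - (P d - P t)"
      unfolding q_def by (rule integral_unique)
    then show ?thesis by simp
  qed
  \<comment> \<open>Stated for general \<open>v\<close> because it is used twice: for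
    \<open>w\<close>, where \<open>small\<close> bounds the inner integrals by e s, and for the
    constant 1, where they equal s and the same formula evaluates the integral of
    \<open>P\<close>.\<close>
  have key: "(LINT t:{0..d}|lborel. v t * of_real (P t)) =
      of_real (P d) * (LINT t:{0..d}|lborel. v t) + (LINT s:{0..d}|lborel. of_real (q s) * (LINT t:{0..s}|lborel. v t))"
    if v: "set_integrable lborel {0..d} v" for v :: "real \<Rightarrow> complex"
  proof -
    have vi: "set_integrable lborel {0..d} (\<lambda>t. v t * of_real (f t))" if f: "continuous_on {0..d} f" for f :: "real \<Rightarrow> real"
    proof -
      obtain B where "\<forall>x\<in>f ` {0..d}. norm x \<le> B"
        using compact_imp_bounded[OF compact_continuous_image[OF f compact_Icc]]
        unfolding bounded_iff by blast
      then have B: "\<bar>f t\<bar> \<le> B" if "t \<in> {0..d}" for t using that by auto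
      have fm: "(\<lambda>t. indicator {0..d} t *\<^sub>R f t) \<in> borel_measurable borel"
        using f by (intro borel_measurable_continuous_on_indicator) auto
      have vm: "(\<lambda>t. indicator {0..d} t *\<^sub>R v t) \<in> borel_measurable borel"
        using v unfolding set_integrable_def by (simp add: borel_measurable_integrable)
      have "integrable lborel (\<lambda>t. B *\<^sub>R (indicator {0..d} t *\<^sub>R v t))"
        using v unfolding set_integrable_def by (intro integrable_scaleR_right)
      then show ?thesis unfolding set_integrable_def
      proof (rule Bochner_Integration.integrable_bound)
        have "(\<lambda>t. indicator {0..d} t *\<^sub>R (v t * of_real (f t))) =
          (\<lambda>t. (indicator {0..d} t *\<^sub>R v t) * of_real (indicator {0..d} t *\<^sub>R f t))"
          by (auto simp: indicator_def fun_eq_iff)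
        moreover define V F where "V = (\<lambda>t. indicator {0..d} t *\<^sub>R v t)"
          and "F = (\<lambda>t. indicator {0..d} t *\<^sub>R f t)"
        have [measurable]: "V \<in> borel_measurable lborel" "F \<in> borel_measurable lborel"
          using fm vm by (simp_all add: V_def F_def)
        have "(\<lambda>t. V t * of_real (F t)) \<in> borel_measurable lborel" by measurable
        ultimately show "(\<lambda>t. indicator {0..d} t *\<^sub>R (v t * of_real (f t))) \<in> borel_measurable lborel"
          unfolding V_def F_def by metis
        have "cmod (v t) * \<bar>f t\<bar> \<le> \<bar>B\<bar> * cmod (v t)" if "t \<in> {0..d}" for t
          using mult_left_mono[OF order_trans[OF B[OF that] abs_ge_self[of B]] norm_ge_zero[of "v t"]] by (simp add: mult.commute)
        then show "AE t in lborel. norm (indicator {0..d} t *\<^sub>R (v t * of_real (f t))) \<le>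
            norm (B *\<^sub>R (indicator {0..d} t *\<^sub>R v t))"
          by (auto simp: norm_mult indicator_def)
      qed
    qed
    have contI: "continuous_on {0..d} (\<lambda>t. integral {t..d} q)"
    proof -
      have "continuous_on {0..d} (\<lambda>t. P t - P d)" by (intro continuous_intros contP)
      moreover have "P t - P d = integral {t..d} q" if "t \<in> {0..d}" for t using Pq[of t] that by simp
      ultimately show ?thesis by (rule continuous_on_eq)
    qed
    have split: "v t * of_real (P t) = v t * of_real (P d) + v t * of_real (integral {t..d} q)" if "t \<in> {0..d}" for t
      by (subst Pq) (use that in \<open>simp_all add: algebra_simps\<close>)
    have "(LINT t:{0..d}|lborel. v t * of_real (P t)) =
        (LINT t:{0..d}|lborel. v t * of_real (P d) + v t * of_real (integral {t..d} q))"
      by (rule set_lebesgue_integral_cong) (simp_all add: split)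
    also have "\<dots> = (LINT t:{0..d}|lborel. v t * of_real (P d)) + (LINT t:{0..d}|lborel. v t * of_real (integral {t..d} q))"
      by (rule set_integral_add(2)[OF vi vi[OF contI]]) auto
    finally show ?thesis unfolding triangle_Fubini[OF v q] by (simp add: mult.commute)
  qed
  have one: "set_integrable lborel {0..d} (\<lambda>_. 1 :: complex)"
    unfolding set_integrable_def by (intro borel_integrable_compact) auto
  have len: "(LINT t:{0..s}|lborel. 1 :: complex) = of_real s" if "0 \<le> s" for s :: real
    using that by (simp add: set_lebesgue_integral_def scaleR_conv_of_real)
  have si_P: "set_integrable lborel {0..d} P"
    unfolding set_integrable_def by (intro borel_integrable_compact contP) auto
  have si_qs: "set_integrable lborel {0..d} (\<lambda>s. q s * s)"
    unfolding set_integrable_def by (intro borel_integrable_compact) (auto intro!: continuous_intros q)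
  have "of_real (integral {0..d} P) = (LINT t:{0..d}|lborel. 1 * complex_of_real (P t))"
    using set_borel_integral_eq_integral(2)[OF si_P] by (simp add: set_integral_complex_of_real)
  also have "\<dots> = of_real (P d) * of_real d + (LINT s:{0..d}|lborel. of_real (q s) * (LINT t:{0..s}|lborel. 1))"
    unfolding key[OF one] len[OF d] ..
  also have "(LINT s:{0..d}|lborel. of_real (q s) * (LINT t:{0..s}|lborel. 1)) =
      (LINT s:{0..d}|lborel. complex_of_real (q s * s))"
    by (rule set_lebesgue_integral_cong) (auto simp: len)
  also have "\<dots> = of_real (LINT s:{0..d}|lborel. q s * s)" by (rule set_integral_complex_of_real)
  finally have intP: "integral {0..d} P = P d * d + (LINT s:{0..d}|lborel. q s * s)"
    by (simp flip: of_real_mult of_real_add)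
  have "cmod (LINT s:{0..d}|lborel. of_real (q s) * (LINT t:{0..s}|lborel. w t)) \<le> (LINT s:{0..d}|lborel. e * (q s * s))"
    unfolding set_lebesgue_integral_def
  proof (rule integral_norm_le_integral)
    show "integrable lborel (\<lambda>s. indicator {0..d} s *\<^sub>R (e * (q s * s)))"
      using si_qs by (subst set_integrable_def[symmetric]) (intro set_integrable_mult_right)
    fix s
    show "norm (indicator {0..d} s *\<^sub>R (of_real (q s) * (LINT t|lborel. indicator {0..s} t *\<^sub>R w t))) \<le>
        indicator {0..d} s *\<^sub>R (e * (q s * s))"
    proof (cases "s \<in> {0..d}")
      case True
      then have "q s * cmod (LINT t:{0..s}|lborel. w t) \<le> q s * (e * s)"
        using small P' by (intro mult_left_mono) (auto simp: q_def)
      then show ?thesis using True P'[of s] by (simp add: norm_mult set_lebesgue_integral_def q_def mult_ac)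
    qed simp
  qed
  moreover have "cmod (of_real (P d) * (LINT t:{0..d}|lborel. w t)) \<le> P d * (e * d)"
    using P small[of d] d by (simp add: norm_mult mult_left_mono)
  moreover have "(LINT s:{0..d}|lborel. e * (q s * s)) = e * (LINT s:{0..d}|lborel. q s * s)" by simp
  ultimately show ?thesis unfolding key[OF w] intP
    by (intro order_trans[OF norm_triangle_ineq]) (simp add: algebra_simps)
qed

section \<open>Lebesgue points and null sets of the circle\<close>

text \<open>Lebesgue differentiation along one-sided intervals. The modulus stands outside the
  integral: against a monotone kernel, control of the primitive of
  \<open>v (\<theta> + t) - v \<theta>\<close> is what counts.\<close>

lemma right_lebesgue_point:
  fixes v :: "real \<Rightarrow> complex"
  assumes v: "integrable lborel v"
  shows "AE \<theta> in lborel. \<forall>e>0. \<exists>d>0. \<forall>s. 0 < s \<and> s < d \<longrightarrow>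
    cmod (LINT t:{0..s}|lborel. v (\<theta> + t) - v \<theta>) \<le> e * s"
proof -
  have "set_integrable lborel (cbox a b) v" for a b
    using v unfolding set_integrable_def by (intro integrable_mult_indicator) auto
  then have hk: "set_integrable lborel {a..b} v" for a b by simp
  then have "v integrable_on cbox a b" for a b
    using set_borel_integral_eq_integral(1) by fastforce
  then obtain N where N: "negligible N" and lim: "\<And>\<theta> e. \<theta> \<notin> N \<Longrightarrow> 0 < e \<Longrightarrow>
    \<exists>d>0. \<forall>h. 0 < h \<and> h < d \<longrightarrow> norm (integral (cbox \<theta> (\<theta> + h *\<^sub>R One)) v /\<^sub>R h ^ DIM(real) - v \<theta>) < e"
    using integrable_ccontinuous_explicit by blast
  have conv: "cmod (LINT t:{0..s}|lborel. v (\<theta> + t) - v \<theta>) = s * norm (integral (cbox \<theta> (\<theta> + s *\<^sub>R One)) v /\<^sub>R s ^ DIM(real) - v \<theta>)"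
    if s: "0 < s" for s \<theta>
  proof -
    have "(LINT t:{0..s}|lborel. v (\<theta> + t) - v \<theta>) =
        (LINT t|lborel. indicator {\<theta>..\<theta>+s} (\<theta> + 1 * t) *\<^sub>R (v (\<theta> + 1 * t) - v \<theta>))"
      unfolding set_lebesgue_integral_def
      by (intro Bochner_Integration.integral_cong) (auto simp: indicator_def)
    also have "\<dots> = (LINT t:{\<theta>..\<theta>+s}|lborel. v t - v \<theta>)"
      using lborel_integral_real_affine[of 1 "\<lambda>t. indicator {\<theta>..\<theta>+s} t *\<^sub>R (v t - v \<theta>)" \<theta>]
      by (simp add: set_lebesgue_integral_def)
    also have "\<dots> = (LINT t:{\<theta>..\<theta>+s}|lborel. v t) - (LINT t:{\<theta>..\<theta>+s}|lborel. v \<theta>)"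
    proof (rule set_integral_diff(2)[OF hk])
      show "set_integrable lborel {\<theta>..\<theta>+s} (\<lambda>_. v \<theta>)"
        unfolding set_integrable_def by (intro borel_integrable_compact) auto
    qed
    also have "(LINT t:{\<theta>..\<theta>+s}|lborel. v t) = integral {\<theta>..\<theta>+s} v"
      by (rule set_borel_integral_eq_integral(2)[OF hk])
    also have "(LINT t:{\<theta>..\<theta>+s}|lborel. v \<theta>) = s *\<^sub>R v \<theta>"
      using s by (simp add: set_lebesgue_integral_def)
    also have "integral {\<theta>..\<theta>+s} v - s *\<^sub>R v \<theta> =
        s *\<^sub>R (integral (cbox \<theta> (\<theta> + s *\<^sub>R One)) v /\<^sub>R s ^ DIM(real) - v \<theta>)"
      using s by (simp add: scaleR_diff_right)
    finally show ?thesis using s by simp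
  qed
  have "AE \<theta> in lebesgue. \<theta> \<notin> N"
    using N by (simp add: negligible_iff_null_sets AE_not_in)
  then have "AE \<theta> in lborel. \<theta> \<notin> N" using AE_completion_iff by metis
  then show ?thesis
  proof eventually_elim
    case (elim \<theta>)
    show ?case
    proof (intro allI impI)
      fix e :: real assume "0 < e"
      then obtain d where d: "0 < d" "\<And>h. 0 < h \<Longrightarrow> h < d \<Longrightarrow>
          norm (integral (cbox \<theta> (\<theta> + h *\<^sub>R One)) v /\<^sub>R h ^ DIM(real) - v \<theta>) < e"
        using lim[OF elim] by blast
      have "cmod (LINT t:{0..s}|lborel. v (\<theta> + t) - v \<theta>) \<le> e * s" if "0 < s" "s < d" for s
        unfolding conv[OF that(1)] using d(2)[OF that] that(1) by (simp add: mult.commute)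
      then show "\<exists>d>0. \<forall>s. 0 < s \<and> s < d \<longrightarrow> cmod (LINT t:{0..s}|lborel. v (\<theta> + t) - v \<theta>) \<le> e * s"
        using d(1) by blast
    qed
  qed
qed

text \<open>Left averages of \<open>v\<close> are right averages of its reflection, and Lebesgue
  measure is invariant under negation.\<close>

lemma two_sided_lebesgue_point:
  fixes v :: "real \<Rightarrow> complex"
  assumes v: "integrable lborel v"
  shows "AE \<theta> in lborel. \<forall>e>0. \<exists>d>0. \<forall>s. 0 < s \<and> s < d \<longrightarrow>
    cmod (LINT t:{0..s}|lborel. v (\<theta> + t) - v \<theta>) \<le> e * s \<and>
    cmod (LINT t:{0..s}|lborel. v (\<theta> - t) - v \<theta>) \<le> e * s"
proof -
  have "integrable lborel (\<lambda>t. v (0 + (-1) * t))"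
    using lborel_integrable_real_affine[OF v, of "-1" 0] by simp
  then have "integrable lborel (\<lambda>t. v (- t))" by simp
  from right_lebesgue_point[OF this]
  have "AE \<theta> in distr lborel borel uminus. \<forall>e>0. \<exists>d>0. \<forall>s. 0 < s \<and> s < d \<longrightarrow>
    cmod (LINT t:{0..s}|lborel. v (- (\<theta> + t)) - v (- \<theta>)) \<le> e * s"
    unfolding lborel_distr_uminus by simp
  then have "AE \<theta> in lborel. \<forall>e>0. \<exists>d>0. \<forall>s. 0 < s \<and> s < d \<longrightarrow>
    cmod (LINT t:{0..s}|lborel. v (- (- \<theta> + t)) - v (- (- \<theta>))) \<le> e * s"
    by (rule AE_distrD[rotated]) simp
  then have left: "AE \<theta> in lborel. \<forall>e>0. \<exists>d>0. \<forall>s. 0 < s \<and> s < d \<longrightarrow>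
    cmod (LINT t:{0..s}|lborel. v (\<theta> - t) - v \<theta>) \<le> e * s"
    by simp
  have comb: "\<forall>e>0. \<exists>d>0. \<forall>s. 0 < s \<and> s < d \<longrightarrow> f s \<le> e * s \<and> g s \<le> e * s"
    if f: "\<forall>e>0. \<exists>d>0. \<forall>s. 0 < s \<and> s < d \<longrightarrow> f s \<le> e * s" and g: "\<forall>e>0. \<exists>d>0. \<forall>s. 0 < s \<and> s < d \<longrightarrow> g s \<le> e * s"
    for f g :: "real \<Rightarrow> real"
  proof (intro allI impI)
    fix e :: real assume e: "0 < e"
    obtain d1 where d1: "0 < d1" "\<forall>s. 0 < s \<and> s < d1 \<longrightarrow> f s \<le> e * s"
      using f e by blast
    obtain d2 where d2: "0 < d2" "\<forall>s. 0 < s \<and> s < d2 \<longrightarrow> g s \<le> e * s"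
      using g e by blast
    from d1 d2 show "\<exists>d>0. \<forall>s. 0 < s \<and> s < d \<longrightarrow> f s \<le> e * s \<and> g s \<le> e * s"
      by (intro exI[of _ "min d1 d2"]) simp
  qed
  show ?thesis using right_lebesgue_point[OF v] left
    by (rule AE_mp[OF _ AE_mp[OF _ AE_I2]]) (intro impI comb)
qed

text \<open>\<open>P\<close> may be any predicate, measurable or not. The exceptional angles are
  enclosed in a Borel null set, which is pulled back to the circle along \<open>Arg2pi\<close>, the
  inverse of \<open>cis\<close> on the open interval from 0 to 2 pi.\<close>

lemma AE_circleI:
  assumes "AE t in lborel. 0 < t \<and> t < 2 * pi \<longrightarrow> P (cis t)"
  shows "AE \<zeta> in circle_measure. P \<zeta>"
proof -
  obtain N where N: "N \<in> null_sets lborel" and sub: "{t. \<not> (0 < t \<and> t < 2 * pi \<longrightarrow> P (cis t))} \<subseteq> N"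
    using assms by (auto simp: eventually_ae_filter)
  \<comment> \<open>\<open>Arg2pi\<close> is continuous off the nonnegative reals and 0 on them; the
    case split exhibits it as a Borel function.\<close>
  define A where "A \<zeta> = (if \<zeta> \<in> \<real>\<^sub>\<ge>\<^sub>0 then 0 else Arg2pi \<zeta>)" for \<zeta>
  have A: "A \<zeta> = Arg2pi \<zeta>" for \<zeta>
    unfolding A_def by (auto simp: Arg2pi_eq_0 nonneg_Reals_def complex_nonneg_Reals_iff complex_is_Real_iff)
  have "A \<in> borel_measurable borel"
    unfolding A_def
    by (rule borel_measurable_continuous_on_if)
      (auto intro!: continuous_at_imp_continuous_on continuous_at_Arg2pi closed_nonneg_Reals_complex borel_closed)
  then have [measurable]: "Arg2pi \<in> borel_measurable borel" unfolding A by (simp add: eta_contract_eq A[abs_def])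
  have [measurable]: "N \<in> sets borel" using N by auto
  have "AE t in lborel. t \<notin> N" using N by (rule AE_not_in)
  moreover have "AE t in lborel. t \<noteq> 0" "AE t in lborel. t \<noteq> 2 * pi"
    by (rule AE_lborel_singleton)+
  ultimately have "AE t in lborel. t \<in> {0..2 * pi} \<longrightarrow> Arg2pi (cis t) \<notin> N \<and> 0 < Arg2pi (cis t)"
  proof eventually_elim
    case (elim t)
    show ?case
    proof
      assume "t \<in> {0..2*pi}"
      then have "Arg2pi (cis t) = t"
        using elim by (intro Arg2pi_unique[of 1]) (auto simp: cis_conv_exp)
      then show "Arg2pi (cis t) \<notin> N \<and> 0 < Arg2pi (cis t)" using elim \<open>t \<in> _\<close> by auto
    qed
  qed
  then have "AE \<zeta> in circle_measure. Arg2pi \<zeta> \<notin> N \<and> 0 < Arg2pi \<zeta>"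
    by (subst AE_circle_iff) measurable
  then show ?thesis using AE_circle_norm
  proof eventually_elim
    case (elim \<zeta>)
    have "\<zeta> = cis (Arg2pi \<zeta>)" using Arg2pi_eq[of \<zeta>] elim by (simp add: cis_conv_exp)
    then show ?case using sub elim Arg2pi_lt_2pi[of \<zeta>] by (metis (mono_tags, lifting) mem_Collect_eq subsetD)
  qed
qed

section \<open>Radial limits of Poisson integrals at Lebesgue points\<close>

lemma poisson_arc_deriv:
  assumes "0 \<le> r" "r < 1"
  shows "(poisson_arc r has_real_derivative
    - ((1 - r\<^sup>2) * (2 * r * sin x) / (1 - 2 * r * cos x + r\<^sup>2)\<^sup>2)) (at x)"
  unfolding poisson_arc_def using poisson_arc_denominator(2)[OF assms, of x]
  by (auto intro!: derivative_eq_intros simp: power2_eq_square)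

text \<open>On [0, pi] the sine is nonnegative, so the Poisson kernel decreases and
  \<open>decreasing_kernel_bound\<close> applies. Its total mass 2 pi makes the bound independent of
  \<open>r\<close>, as the limit r -> 1 demands.\<close>

lemma poisson_arc_local:
  fixes w :: "real \<Rightarrow> complex"
  assumes r: "0 \<le> r" "r < 1" and d: "0 \<le> d" "d \<le> pi" and e: "0 \<le> e"
    and w: "set_integrable lborel {0..d} w"
    and small: "\<And>s. 0 \<le> s \<Longrightarrow> s \<le> d \<Longrightarrow> cmod (LINT t:{0..s}|lborel. w t) \<le> e * s"
  shows "cmod (LINT t:{0..d}|lborel. w t * of_real (poisson_arc r t)) \<le> e * (2 * pi)"
proof -
  have "cmod (LINT t:{0..d}|lborel. w t * of_real (poisson_arc r t)) \<le> e * integral {0..d} (poisson_arc r)"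
  proof (rule decreasing_kernel_bound[OF w d(1) e small poisson_arc_deriv[OF r]])
    show "continuous_on {0..d} (\<lambda>x. - ((1 - r\<^sup>2) * (2 * r * sin x) / (1 - 2 * r * cos x + r\<^sup>2)\<^sup>2))"
      using poisson_arc_denominator(2)[OF r] by (auto intro!: continuous_intros simp: less_imp_neq[THEN not_sym])
    show "- ((1 - r\<^sup>2) * (2 * r * sin t) / (1 - 2 * r * cos t + r\<^sup>2)\<^sup>2) \<le> 0" if "0 \<le> t" "t \<le> d" for t
      using r d that by (simp add: abs_square_le_1 sin_ge_zero)
    show "0 \<le> poisson_arc r d" by (rule poisson_arc_nonneg[OF r])
  qed
  also have "\<dots> \<le> e * (2 * pi)"
    using e d by (intro mult_left_mono integral_poisson_arc_le r) auto
  finally show ?thesis .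
qed

text \<open>The denominator is (1 - r)^2 + 2 r (1 - cos x), and 2 r \<ge> 1. The upper bound on |x|
  reflects periodicity: angles near 2 pi are close to 0 again.\<close>

lemma poisson_arc_far:
  assumes r: "1/2 \<le> r" "r < 1" and d: "0 < d" "d \<le> pi" and x: "d \<le> \<bar>x\<bar>" "\<bar>x\<bar> \<le> 2 * pi - d"
  shows "poisson_arc r x \<le> (1 - r\<^sup>2) / (1 - cos d)"
proof -
  have "cos \<bar>x\<bar> \<le> cos d"
  proof (cases "\<bar>x\<bar> \<le> pi")
    case True
    then show ?thesis using x d by (intro cos_monotone_0_pi_le) auto
  next
    case False
    have "cos \<bar>x\<bar> = cos (2 * pi - \<bar>x\<bar>)" by (simp add: cos_diff)
    also have "\<dots> \<le> cos d" using x d False by (intro cos_monotone_0_pi_le) auto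
    finally show ?thesis .
  qed
  then have c: "cos x \<le> cos d" by simp
  have d1: "cos d < 1" using cos_monotone_0_pi[of 0 d] d by simp
  have "1 - cos d \<le> 2 * r * (1 - cos x)"
    using mult_mono[of 1 "2 * r" "1 - cos d" "1 - cos x"] r c d1 by simp
  also have "\<dots> \<le> (1 - r)\<^sup>2 + 2 * r * (1 - cos x)" by simp
  also have "\<dots> = 1 - 2 * r * cos x + r\<^sup>2" by (simp add: power2_diff algebra_simps)
  finally show ?thesis unfolding poisson_arc_def
    using d1 r by (intro frac_le) (auto simp: abs_square_le_1)
qed

theorem Fatou_poisson:
  fixes u :: "complex \<Rightarrow> complex"
  assumes u: "integrable circle_measure u"
  shows "AE \<zeta> in circle_measure.
    ((\<lambda>r. LINT \<eta>|circle_measure. poisson (of_real r * \<zeta>) \<eta> *\<^sub>R u \<eta>) \<longlongrightarrow> u \<zeta>) (at_left 1)"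
proof (rule AE_circleI)
  have [measurable]: "u \<in> borel_measurable borel" using borel_measurable_integrable[OF u] by simp
  define v where "v t = indicator {0..2 * pi} t *\<^sub>R u (cis t)" for t
  have v: "integrable lborel v"
    using u integrable_circle_iff[of u] by (simp add: v_def[abs_def] set_integrable_def)
  show "AE \<theta> in lborel. 0 < \<theta> \<and> \<theta> < 2 * pi \<longrightarrow>
    ((\<lambda>r. LINT \<eta>|circle_measure. poisson (of_real r * cis \<theta>) \<eta> *\<^sub>R u \<eta>) \<longlongrightarrow> u (cis \<theta>)) (at_left 1)"
    using two_sided_lebesgue_point[OF v]
  proof (rule AE_mp[OF _ AE_I2], intro impI)
    fix \<theta> :: real
    assume leb: "\<forall>e>0. \<exists>d>0. \<forall>s. 0 < s \<and> s < d \<longrightarrow>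
      cmod (LINT t:{0..s}|lborel. v (\<theta> + t) - v \<theta>) \<le> e * s \<and>
      cmod (LINT t:{0..s}|lborel. v (\<theta> - t) - v \<theta>) \<le> e * s"
      and \<theta>: "0 < \<theta> \<and> \<theta> < 2 * pi"
    define c where "c = u (cis \<theta>)"
    have vc: "v \<theta> = c" using \<theta> by (simp add: v_def c_def)
    \<comment> \<open>The Poisson integral of the constant \<open>c\<close> is \<open>c\<close>, so
      it suffices that the Poisson integral of u - c tends to 0.\<close>
    define Q where "Q t = indicator {0..2*pi} t *\<^sub>R (u (cis t) - c)" for t
    have uc: "integrable circle_measure (\<lambda>\<eta>. u \<eta> - c)" using u by simp
    have Q: "integrable lborel Q"
      using uc integrable_circle_iff[of "\<lambda>\<eta>. u \<eta> - c"] by (simp add: Q_def[abs_def] set_integrable_def)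
    define K where "K = (LINT t|lborel. cmod (Q t))"
    show "((\<lambda>r. LINT \<eta>|circle_measure. poisson (of_real r * cis \<theta>) \<eta> *\<^sub>R u \<eta>) \<longlongrightarrow> u (cis \<theta>)) (at_left 1)"
    proof (rule tendstoI)
      fix e :: real assume e: "0 < e"
      \<comment> \<open>The choice e / 4 on each of the two arcs costs e / 2 after division by 2 pi
        and leaves e / 2 for the rest of the circle.\<close>
      then obtain d0 where d0: "0 < d0" and leb': "\<And>s. 0 < s \<Longrightarrow> s < d0 \<Longrightarrow>
          cmod (LINT t:{0..s}|lborel. v (\<theta> + t) - v \<theta>) \<le> e / 4 * s \<and>
          cmod (LINT t:{0..s}|lborel. v (\<theta> - t) - v \<theta>) \<le> e / 4 * s"
        using leb[rule_format, of "e / 4"] by (auto simp del: times_divide_eq_left)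
      \<comment> \<open>Half of \<open>d0\<close> makes the inequality strict;
        \<open>\<theta>\<close> and \<open>2 * pi - \<theta>\<close> keep both arcs inside the
        interval where \<open>v\<close> is not cut off; \<open>pi\<close> keeps the kernel
        monotone.\<close>
      define d where "d = min (d0 / 2) (min \<theta> (min (2 * pi - \<theta>) pi))"
      have d: "0 < d" "d < d0" "d \<le> \<theta>" "d \<le> 2 * pi - \<theta>" "d \<le> pi"
        using d0 \<theta> by (auto simp: d_def)
      have zero: "(LINT t:{0..0::real}|lborel. f t) = 0" for f :: "real \<Rightarrow> complex"
      proof -
        have "AE t in lborel. indicator {0..0::real} t *\<^sub>R f t = 0"
          using AE_lborel_singleton[of "0::real"] by eventually_elim simp
        then show ?thesis unfolding set_lebesgue_integral_def by (rule integral_eq_zero_AE)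
      qed
      have small: "cmod (LINT t:{0..s}|lborel. v (\<theta> + t) - c) \<le> e / 4 * s \<and>
          cmod (LINT t:{0..s}|lborel. v (\<theta> - t) - c) \<le> e / 4 * s" if s: "0 \<le> s" "s \<le> d" for s
      proof (cases "s = 0")
        case False
        then show ?thesis using leb'[of s] s d by (simp add: vc)
      next
        case True
        show ?thesis unfolding True zero by simp
      qed
      have aff: "set_integrable lborel {0..d} (\<lambda>t. v (\<theta> + k * t) - c)" if k: "k \<noteq> 0" for k
      proof -
        have "integrable lborel (\<lambda>t. v (\<theta> + k * t))" by (rule lborel_integrable_real_affine[OF v k])
        then have "set_integrable lborel {0..d} (\<lambda>t. v (\<theta> + k * t))"
          unfolding set_integrable_def by (intro integrable_mult_indicator) auto
        moreover have "set_integrable lborel {0..d} (\<lambda>_. c)"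
          unfolding set_integrable_def by (intro borel_integrable_compact) auto
        ultimately show ?thesis by (rule set_integral_diff(1))
      qed
      have cd: "cos d < 1" using cos_monotone_0_pi[of 0 d] d by simp
      have "((\<lambda>r. (1 - r\<^sup>2) / (1 - cos d) * K / (2 * pi)) \<longlongrightarrow> (1 - 1\<^sup>2) / (1 - cos d) * K / (2 * pi)) (at_left (1::real))"
        using cd by (intro tendsto_intros) auto
      then have "eventually (\<lambda>r. (1 - r\<^sup>2) / (1 - cos d) * K / (2 * pi) < e / 2) (at_left 1)"
        using e by (intro order_tendstoD(2)) auto
      moreover have "eventually (\<lambda>r. r \<in> {1/2<..<1}) (at_left (1::real))"
        by (rule eventually_at_left_real) simp
      ultimately show "eventually (\<lambda>r. dist (LINT \<eta>|circle_measure. poisson (of_real r * cis \<theta>) \<eta> *\<^sub>R u \<eta>) (u (cis \<theta>)) < e) (at_left 1)"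
      proof eventually_elim
        case (elim r)
        then have r: "0 \<le> r" "r < 1" "1/2 \<le> r" by auto
        define z where "z = of_real r * cis \<theta>"
        have z: "cmod z < 1" using r by (simp add: z_def norm_mult)
        define g where "g t = poisson_arc r (t - \<theta>) *\<^sub>R Q t" for t
        have g_eq: "g t = indicator {0..2*pi} t *\<^sub>R (poisson z (cis t) *\<^sub>R (u (cis t) - c))" for t
          unfolding g_def Q_def z_def poisson_cis[OF r(1,2)] by simp
        have pm: "integrable circle_measure (\<lambda>\<eta>. poisson z \<eta> *\<^sub>R (u \<eta> - c))"
          by (rule integrable_poisson_mult[OF uc z])
        then have g: "integrable lborel g"
          using integrable_circle_iff[of "\<lambda>\<eta>. poisson z \<eta> *\<^sub>R (u \<eta> - c)"]
          by (simp add: g_eq[abs_def] set_integrable_def)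
        have ic: "integrable circle_measure (\<lambda>\<eta>. poisson z \<eta> *\<^sub>R c)"
          using integrable_poisson_mult[of "\<lambda>_. c", OF _ z] by simp
        have "(LINT \<eta>|circle_measure. poisson z \<eta> *\<^sub>R c) = c"
        proof -
          have "integrable circle_measure (poisson z)"
            using integrable_Re[OF integrable_poisson_mult[of "\<lambda>_. 1", OF _ z]] by (simp add: eta_contract_eq)
          then show ?thesis using integral_poisson[OF z] by (subst integral_scaleR_left) auto
        qed
        then have "(LINT \<eta>|circle_measure. poisson z \<eta> *\<^sub>R u \<eta>) - c =
            (LINT \<eta>|circle_measure. poisson z \<eta> *\<^sub>R u \<eta>) - (LINT \<eta>|circle_measure. poisson z \<eta> *\<^sub>R c)" by simp
        also have "\<dots> = (LINT \<eta>|circle_measure. poisson z \<eta> *\<^sub>R (u \<eta> - c))"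
          by (subst Bochner_Integration.integral_diff[symmetric])
            (simp_all add: integrable_poisson_mult[OF u z] ic scaleR_diff_right del: scaleR_conv_of_real)
        also have "\<dots> = (1 / (2 * pi)) *\<^sub>R (LINT t|lborel. g t)"
          by (subst integral_circle) (simp_all add: set_lebesgue_integral_def g_eq[abs_def])
        finally have main: "(LINT \<eta>|circle_measure. poisson z \<eta> *\<^sub>R u \<eta>) - c = (1 / (2 * pi)) *\<^sub>R (LINT t|lborel. g t)" .
        define g1 where "g1 t = indicator {\<theta>..\<theta>+d} t *\<^sub>R g t" for t
        define g2 where "g2 t = indicator {\<theta>-d..\<theta>} t *\<^sub>R g t" for t
        define g3 where "g3 t = indicator (- {\<theta>-d..\<theta>+d}) t *\<^sub>R g t" for t
        have int: "integrable lborel g1" "integrable lborel g2" "integrable lborel g3"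
          unfolding g1_def g2_def g3_def by (intro integrable_mult_indicator g; simp)+
        have "AE t in lborel. g t = g1 t + g2 t + g3 t"
          using AE_lborel_singleton[of \<theta>]
          by eventually_elim (auto simp: g1_def g2_def g3_def indicator_def)
        then have "(LINT t|lborel. g t) = (LINT t|lborel. g1 t + g2 t + g3 t)"
          using g int by (intro integral_cong_AE) auto
        also have "\<dots> = (LINT t|lborel. g1 t) + (LINT t|lborel. g2 t) + (LINT t|lborel. g3 t)"
          using int by simp
        finally have split: "(LINT t|lborel. g t) = (LINT t|lborel. g1 t) + (LINT t|lborel. g2 t) + (LINT t|lborel. g3 t)" .
        have Qv: "Q t = v t - c" if "0 \<le> t" "t \<le> 2 * pi" for t
          using that by (simp add: Q_def v_def)
        have "(LINT t|lborel. g1 t) = (LINT t:{0..d}|lborel. (v (\<theta> + 1 * t) - c) * of_real (poisson_arc r t))"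
        proof -
          have "(LINT t|lborel. g1 t) = (LINT t|lborel. g1 (\<theta> + 1 * t))"
            using lborel_integral_real_affine[of 1 g1 \<theta>] by simp
          also have "\<dots> = (LINT t:{0..d}|lborel. (v (\<theta> + 1 * t) - c) * of_real (poisson_arc r t))"
            unfolding set_lebesgue_integral_def using d \<theta>
            by (intro Bochner_Integration.integral_cong)
              (auto simp: g1_def g_def indicator_def Qv scaleR_conv_of_real mult.commute)
          finally show ?thesis .
        qed
        also have "cmod \<dots> \<le> e / 4 * (2 * pi)"
          using small d e by (intro poisson_arc_local r aff) auto
        finally have b1: "cmod (LINT t|lborel. g1 t) \<le> e / 4 * (2 * pi)" .
        have "(LINT t|lborel. g2 t) = (LINT t:{0..d}|lborel. (v (\<theta> + (-1) * t) - c) * of_real (poisson_arc r t))"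
        proof -
          have "(LINT t|lborel. g2 t) = (LINT t|lborel. g2 (\<theta> + (-1) * t))"
            using lborel_integral_real_affine[of "-1" g2 \<theta>] by simp
          also have "\<dots> = (LINT t:{0..d}|lborel. (v (\<theta> + (-1) * t) - c) * of_real (poisson_arc r t))"
            unfolding set_lebesgue_integral_def using d \<theta>
            by (intro Bochner_Integration.integral_cong)
              (auto simp: g2_def g_def indicator_def Qv scaleR_conv_of_real mult.commute)
          finally show ?thesis .
        qed
        also have "cmod \<dots> \<le> e / 4 * (2 * pi)"
          using small d e by (intro poisson_arc_local r aff) auto
        finally have b2: "cmod (LINT t|lborel. g2 t) \<le> e / 4 * (2 * pi)" .
        define M where "M = (1 - r\<^sup>2) / (1 - cos d)"
        have M: "0 \<le> M" using r cd by (simp add: M_def abs_square_le_1)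
        have "cmod (LINT t|lborel. g3 t) \<le> (LINT t|lborel. M * cmod (Q t))"
        proof (rule integral_norm_le_integral)
          show "integrable lborel (\<lambda>t. M * cmod (Q t))" using Q by simp
          fix t
          show "cmod (g3 t) \<le> M * cmod (Q t)"
          proof (cases "t \<in> {0..2*pi} \<and> t \<notin> {\<theta>-d..\<theta>+d}")
            case True
            then have "poisson_arc r (t - \<theta>) \<le> M"
              unfolding M_def using d \<theta> r by (intro poisson_arc_far) auto
            then show ?thesis using True poisson_arc_nonneg[OF r(1,2), of "t - \<theta>"]
              by (simp add: g3_def g_def mult_right_mono)
          next
            case False
            then have "g3 t = 0" by (auto simp: g3_def g_def Q_def)
            then show ?thesis using M by simp
          qed
        qed
        then have b3: "cmod (LINT t|lborel. g3 t) \<le> M * K" by (simp add: K_def)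
        have "cmod (LINT t|lborel. g t) \<le> e * pi + M * K"
          unfolding split using b1 b2 b3
            norm_triangle_ineq[of "(LINT t|lborel. g1 t) + (LINT t|lborel. g2 t)" "LINT t|lborel. g3 t"]
            norm_triangle_ineq[of "LINT t|lborel. g1 t" "LINT t|lborel. g2 t"] by linarith
        then have "cmod (LINT t|lborel. g t) / (2 * pi) \<le> (e * pi + M * K) / (2 * pi)"
          by (simp add: divide_right_mono)
        also have "\<dots> = e / 2 + M * K / (2 * pi)" by (simp add: field_simps)
        also have "\<dots> < e" using elim(1) unfolding M_def[symmetric] by linarith
        finally show ?case using main by (simp add: dist_norm z_def c_def)
      qed
    qed
  qed
qed

section \<open>Fourier series in the Hardy space\<close>

lemma measure_circle_UNIV [simp]: "measure circle_measure UNIV = 1"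
  by (simp add: measure_def emeasure_circle_UNIV)

lemma AE_circle_power_le: "AE \<zeta> in circle_measure. \<forall>n. cmod (\<zeta> ^ n) \<le> 1"
  using AE_circle_norm by eventually_elim (simp add: norm_power)

lemma integral_cnj_complex:
  fixes f :: "'a \<Rightarrow> complex"
  shows "(LINT x|M. cnj (f x)) = cnj (LINT x|M. f x)"
  by (rule integral_bounded_linear'[OF bounded_linear_cnj bounded_linear_cnj]) simp

lemma integrable_cnj_iff [simp]:
  fixes f :: "'a \<Rightarrow> complex"
  shows "integrable M (\<lambda>x. cnj (f x)) \<longleftrightarrow> integrable M f"
  using integrable_bounded_linear[OF bounded_linear_cnj, of M f]
    integrable_bounded_linear[OF bounded_linear_cnj, of M "\<lambda>x. cnj (f x)"] by auto

text \<open>Termwise integration against cnj \<zeta>^k isolates one coefficient by orthonormality;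
  termwise integration against cnj f then produces the sum of squares.\<close>

lemma absolutely_convergent_Parseval:
  fixes d :: "nat \<Rightarrow> complex"
  assumes d: "summable (\<lambda>n. cmod (d n))"
  defines "f \<equiv> \<lambda>\<zeta>. \<Sum>n. d n * \<zeta> ^ n"
  shows "integrable circle_measure f"
    and "(LINT \<zeta>|circle_measure. f \<zeta> * cnj \<zeta> ^ k) = d k"
    and "integrable circle_measure (\<lambda>\<zeta>. (cmod (f \<zeta>))\<^sup>2)"
    and "(\<lambda>n. (cmod (d n))\<^sup>2) sums (LINT \<zeta>|circle_measure. (cmod (f \<zeta>))\<^sup>2)"
proof -
  have m: "(\<lambda>\<zeta>. \<zeta> ^ n) \<in> borel_measurable circle_measure" for n :: nat by measurable
  have [measurable]: "f \<in> borel_measurable borel" unfolding f_def by measurable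
  have fa: "(\<Sum>n. d n * \<zeta> ^ n) = f \<zeta>" for \<zeta> by (simp add: f_def)
  note ex = integral_series_exchange[OF m AE_circle_power_le _ d, unfolded fa]
  have bd: "AE \<zeta> in circle_measure. cmod (f \<zeta>) \<le> (\<Sum>n. cmod (d n))"
    using AE_circle_norm
  proof eventually_elim
    case (elim \<zeta>)
    then have n: "norm (d n * \<zeta> ^ n) = cmod (d n)" for n by (simp add: norm_mult norm_power)
    show ?case unfolding f_def using summable_norm[of "\<lambda>n. d n * \<zeta> ^ n"] d unfolding n by simp
  qed
  show int: "integrable circle_measure f"
    using bd by (intro circle_integrable_bounded) auto
  have ip: "integrable circle_measure (\<lambda>\<zeta>. cnj \<zeta> ^ k)" for k
    by (rule circle_integrable_bounded[of _ 1]) (use AE_circle_norm in \<open>auto elim: eventually_mono simp: norm_power\<close>)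
  show coeff: "(LINT \<zeta>|circle_measure. f \<zeta> * cnj \<zeta> ^ k) = d k" for k
  proof -
    have "(\<lambda>n. d n * (if n = k then 1 else 0)) sums (LINT \<zeta>|circle_measure. f \<zeta> * cnj \<zeta> ^ k)"
      using ex(2)[OF ip[of k]] by (simp add: integral_circle_powers)
    moreover have "(\<lambda>n. d n * (if n = k then 1 else 0)) sums d k"
      using sums_single[of k d] by (simp add: if_distrib cong: if_cong)
    ultimately show ?thesis by (rule sums_unique2)
  qed
  have intc: "integrable circle_measure (\<lambda>\<zeta>. cnj (f \<zeta>))" using int by simp
  have sq: "f \<zeta> * cnj (f \<zeta>) = of_real ((cmod (f \<zeta>))\<^sup>2)" for \<zeta>
    by (rule complex_norm_square[symmetric])
  have "(LINT \<zeta>|circle_measure. \<zeta> ^ n * cnj (f \<zeta>)) = cnj (d n)" for n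
    unfolding coeff[of n, symmetric] integral_cnj_complex[symmetric] by (simp add: mult.commute)
  then have "(\<lambda>n. d n * cnj (d n)) sums (LINT \<zeta>|circle_measure. f \<zeta> * cnj (f \<zeta>))"
    using ex(2)[OF intc] by simp
  then have "(\<lambda>n. complex_of_real ((cmod (d n))\<^sup>2)) sums of_real (LINT \<zeta>|circle_measure. (cmod (f \<zeta>))\<^sup>2)"
    unfolding sq integral_complex_of_real complex_norm_square[symmetric] .
  then show "(\<lambda>n. (cmod (d n))\<^sup>2) sums (LINT \<zeta>|circle_measure. (cmod (f \<zeta>))\<^sup>2)"
    by (simp only: sums_of_real_iff)
  have "integrable circle_measure (\<lambda>\<zeta>. complex_of_real ((cmod (f \<zeta>))\<^sup>2))"
    using ex(1)[OF intc] unfolding sq .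
  then show "integrable circle_measure (\<lambda>\<zeta>. (cmod (f \<zeta>))\<^sup>2)"
    using complex_of_real_integrable_eq by blast
qed

lemma finite_Parseval:
  fixes a :: "nat \<Rightarrow> complex"
  assumes "finite A"
  shows "integrable circle_measure (\<lambda>\<zeta>. \<Sum>n\<in>A. a n * \<zeta> ^ n)"
    and "(LINT \<zeta>|circle_measure. (\<Sum>n\<in>A. a n * \<zeta> ^ n) * cnj \<zeta> ^ k) = (if k \<in> A then a k else 0)"
    and "integrable circle_measure (\<lambda>\<zeta>. (cmod (\<Sum>n\<in>A. a n * \<zeta> ^ n))\<^sup>2)"
    and "(LINT \<zeta>|circle_measure. (cmod (\<Sum>n\<in>A. a n * \<zeta> ^ n))\<^sup>2) = (\<Sum>n\<in>A. (cmod (a n))\<^sup>2)"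
proof -
  define d where "d n = (if n \<in> A then a n else 0)" for n
  have d: "summable (\<lambda>n. cmod (d n))" using assms by (intro summable_finite[of A]) (auto simp: d_def)
  have f: "(\<Sum>n. d n * \<zeta> ^ n) = (\<Sum>n\<in>A. a n * \<zeta> ^ n)" for \<zeta>
    using assms by (subst suminf_finite[of A]) (auto simp: d_def)
  note P = absolutely_convergent_Parseval[OF d, unfolded f]
  show "integrable circle_measure (\<lambda>\<zeta>. \<Sum>n\<in>A. a n * \<zeta> ^ n)"
    "(LINT \<zeta>|circle_measure. (\<Sum>n\<in>A. a n * \<zeta> ^ n) * cnj \<zeta> ^ k) = (if k \<in> A then a k else 0)"
    "integrable circle_measure (\<lambda>\<zeta>. (cmod (\<Sum>n\<in>A. a n * \<zeta> ^ n))\<^sup>2)"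
    using P by (simp_all add: d_def)
  have "(\<lambda>n. (cmod (d n))\<^sup>2) sums (\<Sum>n\<in>A. (cmod (d n))\<^sup>2)"
    using assms by (intro sums_finite) (auto simp: d_def)
  then show "(LINT \<zeta>|circle_measure. (cmod (\<Sum>n\<in>A. a n * \<zeta> ^ n))\<^sup>2) = (\<Sum>n\<in>A. (cmod (a n))\<^sup>2)"
    using sums_unique2[OF P(4)] by (simp add: d_def)
qed

lemma ell2_tail_small:
  assumes "0 < e"
  shows "\<exists>N. \<forall>M\<ge>N. (\<Sum>n\<in>{N..<M}. (cmod (coef x n))\<^sup>2) < e"
proof -
  obtain N where N: "\<And>M. M \<ge> N \<Longrightarrow> norm (\<Sum>n\<in>{N..<M}. (cmod (coef x n))\<^sup>2) < e"
    using summable_coef_sq[of x, unfolded summable_Cauchy, rule_format, OF assms] by blast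
  have "(\<Sum>n\<in>{N..<M}. (cmod (coef x n))\<^sup>2) < e" if "M \<ge> N" for M
    using N[OF that] by simp
  then show ?thesis by blast
qed

text \<open>A subsequence of the partial sums is chosen whose consecutive blocks are summable in L1.
  The block series then converges almost everywhere and in mean, which preserves all Fourier
  coefficients. The norm identity is Fatou's lemma in one direction and a Bessel inequality in the
  other. The vanishing of the negative coefficients is what later makes the Poisson integral of f
  analytic.\<close>

theorem Riesz_Fischer:
  obtains f where "f \<in> borel_measurable borel" "integrable circle_measure f"
    "integrable circle_measure (\<lambda>\<zeta>. (cmod (f \<zeta>))\<^sup>2)"
    "\<And>k. (LINT \<zeta>|circle_measure. f \<zeta> * cnj \<zeta> ^ k) = coef x k"
    "\<And>k. (LINT \<zeta>|circle_measure. f \<zeta> * \<zeta> ^ Suc k) = 0"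
    "(LINT \<zeta>|circle_measure. (cmod (f \<zeta>))\<^sup>2) = (norm x)\<^sup>2"
proof -
  define S where "S N \<zeta> = (\<Sum>n<N. coef x n * \<zeta> ^ n)" for N \<zeta>
  have [measurable]: "S N \<in> borel_measurable borel" for N unfolding S_def by measurable
  \<comment> \<open>Tails below (1/4)^k give blocks of L2 norm at most (1/2)^k, and on a probability
    space the L1 norm is no larger.\<close>
  have "\<exists>N. strict_mono N \<and> (\<forall>k. \<forall>M\<ge>N k. (\<Sum>n\<in>{N k..<M}. (cmod (coef x n))\<^sup>2) < (1/4) ^ k)"
  proof -
    have ex: "\<exists>N'>N. \<forall>M\<ge>N'. (\<Sum>n\<in>{N'..<M}. (cmod (coef x n))\<^sup>2) < (1/4) ^ k" for N k
    proof -
      obtain N0 where N0: "\<forall>M\<ge>N0. (\<Sum>n\<in>{N0..<M}. (cmod (coef x n))\<^sup>2) < (1/4) ^ k"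
        using ell2_tail_small[of "(1/4) ^ k" x] by auto
      have "(\<Sum>n\<in>{N0 + Suc N..<M}. (cmod (coef x n))\<^sup>2) < (1/4) ^ k" if "M \<ge> N0 + Suc N" for M
      proof -
        have "(\<Sum>n\<in>{N0 + Suc N..<M}. (cmod (coef x n))\<^sup>2) \<le> (\<Sum>n\<in>{N0..<M}. (cmod (coef x n))\<^sup>2)"
          by (intro sum_mono2) auto
        also have "\<dots> < (1/4) ^ k" using N0 that by simp
        finally show ?thesis .
      qed
      then show ?thesis by (intro exI[of _ "N0 + Suc N"]) auto
    qed
    define P where "P k N \<longleftrightarrow> (\<forall>M\<ge>N. (\<Sum>n\<in>{N..<M}. (cmod (coef x n))\<^sup>2) < (1/4) ^ k)" for k N
    have "\<exists>N. \<forall>k. P k (N k) \<and> N k < N (Suc k)"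
    proof (rule dependent_nat_choice)
      show "\<exists>N. P 0 N" using ex[of 0 0] unfolding P_def by blast
      show "\<exists>N'. P (Suc k) N' \<and> N < N'" for N k using ex[of N "Suc k"] unfolding P_def by blast
    qed
    then obtain N where "\<forall>k. P k (N k) \<and> N k < N (Suc k)" by (elim exE)
    then show ?thesis
      by (intro exI[of _ N]) (simp add: strict_mono_Suc_iff P_def)
  qed
  then obtain N where N: "strict_mono N"
    and tail: "\<And>k M. N k \<le> M \<Longrightarrow> (\<Sum>n\<in>{N k..<M}. (cmod (coef x n))\<^sup>2) < (1/4) ^ k" by blast
  define D where "D k \<zeta> = (\<Sum>n\<in>{N k..<N (Suc k)}. coef x n * \<zeta> ^ n)" for k \<zeta>
  have [measurable]: "D k \<in> borel_measurable borel" for k unfolding D_def by measurable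
  have Nle: "N k \<le> N (Suc k)" for k using N by (simp add: strict_mono_less_eq)
  have SD: "S (N k) \<zeta> = S (N 0) \<zeta> + (\<Sum>j<k. D j \<zeta>)" for k \<zeta>
  proof (induction k)
    case (Suc k)
    have "{..<N (Suc k)} = {..<N k} \<union> {N k..<N (Suc k)}" using Nle[of k] by auto
    then have "S (N (Suc k)) \<zeta> = S (N k) \<zeta> + D k \<zeta>"
      unfolding S_def D_def by (simp add: sum.union_disjoint ivl_disj_int)
    then show ?case using Suc by simp
  qed simp
  have intD: "integrable circle_measure (D k)" for k
    unfolding D_def by (rule finite_Parseval(1)) simp
  have intS: "integrable circle_measure (S k)" for k
    unfolding S_def by (rule finite_Parseval(1)) simp
  have D1: "(LINT \<zeta>|circle_measure. cmod (D k \<zeta>)) \<le> (1/2) ^ k" for k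
  proof -
    have sq: "integrable circle_measure (\<lambda>\<zeta>. (cmod (D k \<zeta>))\<^sup>2)"
      and val: "(LINT \<zeta>|circle_measure. (cmod (D k \<zeta>))\<^sup>2) = (\<Sum>n\<in>{N k..<N (Suc k)}. (cmod (coef x n))\<^sup>2)"
      unfolding D_def using finite_Parseval(3,4)[of "{N k..<N (Suc k)}" "coef x"] by auto
    have "cmod (LINT \<zeta>|circle_measure. complex_of_real (cmod (D k \<zeta>)) * 1) \<le>
      sqrt (LINT \<zeta>|circle_measure. (cmod (complex_of_real (cmod (D k \<zeta>))))\<^sup>2) * sqrt (LINT \<zeta>|circle_measure. (cmod 1)\<^sup>2)"
      using sq by (intro L2_Cauchy_Schwarz(2)) auto
    also have "\<dots> \<le> sqrt ((1/4) ^ k)"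
      using tail[OF Nle[of k]] by (simp add: val)
    also have "(1/4) ^ k = (((1/2) ^ k)\<^sup>2 :: real)" by (simp add: power2_eq_square flip: power_mult_distrib)
    finally show ?thesis by (simp add: integral_complex_of_real)
  qed
  have summ: "AE \<zeta> in circle_measure. summable (\<lambda>k. norm (D k \<zeta>))"
  proof -
    have "(\<integral>\<^sup>+\<zeta>. (\<Sum>k. ennreal (cmod (D k \<zeta>))) \<partial>circle_measure) = (\<Sum>k. \<integral>\<^sup>+\<zeta>. ennreal (cmod (D k \<zeta>)) \<partial>circle_measure)"
      by (rule nn_integral_suminf) measurable
    also have "\<dots> = (\<Sum>k. ennreal (LINT \<zeta>|circle_measure. cmod (D k \<zeta>)))"
      by (intro arg_cong[where f = suminf] ext nn_integral_eq_integral integrable_norm intD) simp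
    also have "\<dots> \<le> (\<Sum>k. ennreal ((1/2) ^ k))"
      by (intro suminf_le ennreal_leI D1) auto
    also have "\<dots> = ennreal (\<Sum>k. (1/2) ^ k)"
      by (rule suminf_ennreal2) (auto intro!: summable_geometric)
    finally have "(\<integral>\<^sup>+\<zeta>. (\<Sum>k. ennreal (cmod (D k \<zeta>))) \<partial>circle_measure) \<noteq> \<infinity>"
      by (metis ennreal_less_top infinity_ennreal_def leD)
    then have "AE \<zeta> in circle_measure. (\<Sum>k. ennreal (cmod (D k \<zeta>))) \<noteq> \<infinity>"
      by (intro nn_integral_PInf_AE) auto
    then show ?thesis
      by eventually_elim (auto intro!: summable_suminf_not_top)
  qed
  have summI: "summable (\<lambda>k. LINT \<zeta>|circle_measure. norm (D k \<zeta>))"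
    by (rule summable_comparison_test'[where g = "\<lambda>k. (1/2) ^ k"]) (use D1 in \<open>auto intro: summable_geometric\<close>)
  define f where "f \<zeta> = S (N 0) \<zeta> + (\<Sum>k. D k \<zeta>)" for \<zeta>
  have [measurable]: "f \<in> borel_measurable borel" unfolding f_def by measurable
  have conv: "AE \<zeta> in circle_measure. (\<lambda>k. S (N k) \<zeta>) \<longlonglongrightarrow> f \<zeta>"
    using summ
  proof eventually_elim
    case (elim \<zeta>)
    have "(\<lambda>k. S (N 0) \<zeta> + (\<Sum>j<k. D j \<zeta>)) \<longlonglongrightarrow> f \<zeta>" unfolding f_def
      by (intro tendsto_intros summable_LIMSEQ summable_norm_cancel[OF elim])
    then show ?case by (simp only: SD[symmetric])
  qed
  have intf: "integrable circle_measure f"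
    unfolding f_def by (intro Bochner_Integration.integrable_add intS integrable_suminf intD summ summI)
  have lim: "(\<lambda>k. LINT \<zeta>|circle_measure. S (N k) \<zeta> * h \<zeta>) \<longlonglongrightarrow> (LINT \<zeta>|circle_measure. f \<zeta> * h \<zeta>)"
    if [measurable]: "h \<in> borel_measurable borel" and h: "AE \<zeta> in circle_measure. cmod (h \<zeta>) \<le> 1" for h
  proof -
    have ih: "integrable circle_measure (\<lambda>\<zeta>. g \<zeta> * h \<zeta>)" if g: "integrable circle_measure g" for g
    proof (rule Bochner_Integration.integrable_bound[OF g])
      show "AE \<zeta> in circle_measure. norm (g \<zeta> * h \<zeta>) \<le> norm (g \<zeta>)"
        using h by eventually_elim (simp add: norm_mult mult_left_le)
    qed (use borel_measurable_integrable[OF g] in measurable)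
    have s1: "AE \<zeta> in circle_measure. summable (\<lambda>k. norm (D k \<zeta> * h \<zeta>))"
      using summ by eventually_elim (simp add: norm_mult summable_mult2)
    have s2: "summable (\<lambda>k. LINT \<zeta>|circle_measure. norm (D k \<zeta> * h \<zeta>))"
    proof (rule summable_comparison_test'[OF summI])
      fix k
      have "(LINT \<zeta>|circle_measure. norm (D k \<zeta> * h \<zeta>)) \<le> (LINT \<zeta>|circle_measure. norm (D k \<zeta>))"
        using h intD integrable_norm[OF ih[OF intD[of k]]]
        by (intro integral_mono_AE) (auto elim!: eventually_mono simp: norm_mult mult_left_le)
      then show "norm (LINT \<zeta>|circle_measure. norm (D k \<zeta> * h \<zeta>)) \<le> (LINT \<zeta>|circle_measure. norm (D k \<zeta>))" by simp
    qed
    have "(\<lambda>k. LINT \<zeta>|circle_measure. D k \<zeta> * h \<zeta>) sums (LINT \<zeta>|circle_measure. (\<Sum>k. D k \<zeta> * h \<zeta>))"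
      by (rule sums_integral[OF ih[OF intD] s1 s2])
    then have A: "(\<lambda>k. (LINT \<zeta>|circle_measure. S (N 0) \<zeta> * h \<zeta>) + (\<Sum>j<k. LINT \<zeta>|circle_measure. D j \<zeta> * h \<zeta>)) \<longlonglongrightarrow>
      (LINT \<zeta>|circle_measure. S (N 0) \<zeta> * h \<zeta>) + (LINT \<zeta>|circle_measure. (\<Sum>k. D k \<zeta> * h \<zeta>))"
      unfolding sums_def by (intro tendsto_intros)
    have B: "(LINT \<zeta>|circle_measure. S (N k) \<zeta> * h \<zeta>) =
        (LINT \<zeta>|circle_measure. S (N 0) \<zeta> * h \<zeta>) + (\<Sum>j<k. LINT \<zeta>|circle_measure. D j \<zeta> * h \<zeta>)" for k
      unfolding SD[of k] distrib_right sum_distrib_right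
      by (simp add: ih intS intD)
    have C: "(LINT \<zeta>|circle_measure. f \<zeta> * h \<zeta>) =
        (LINT \<zeta>|circle_measure. S (N 0) \<zeta> * h \<zeta>) + (LINT \<zeta>|circle_measure. (\<Sum>k. D k \<zeta> * h \<zeta>))"
    proof -
      have "AE \<zeta> in circle_measure. f \<zeta> * h \<zeta> = S (N 0) \<zeta> * h \<zeta> + (\<Sum>k. D k \<zeta> * h \<zeta>)"
        using summ by eventually_elim
          (simp add: f_def distrib_right suminf_mult2[OF summable_norm_cancel])
      then have "(LINT \<zeta>|circle_measure. f \<zeta> * h \<zeta>) = (LINT \<zeta>|circle_measure. S (N 0) \<zeta> * h \<zeta> + (\<Sum>k. D k \<zeta> * h \<zeta>))"
        by (intro integral_cong_AE) auto
      then show ?thesis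
        using ih[OF intS] integrable_suminf[OF ih[OF intD] s1 s2] by simp
    qed
    show ?thesis unfolding C using A by (simp only: B[symmetric])
  qed
  have AEp: "AE \<zeta> in circle_measure. cmod (cnj \<zeta> ^ k) \<le> 1" "AE \<zeta> in circle_measure. cmod (\<zeta> ^ k) \<le> 1" for k
    using AE_circle_norm by (auto elim!: eventually_mono simp: norm_power)
  have coef1: "(LINT \<zeta>|circle_measure. f \<zeta> * cnj \<zeta> ^ k) = coef x k" for k
  proof -
    have "(\<lambda>j. LINT \<zeta>|circle_measure. S (N j) \<zeta> * cnj \<zeta> ^ k) \<longlonglongrightarrow> coef x k"
    proof (rule tendsto_eventually)
      have "(LINT \<zeta>|circle_measure. S (N j) \<zeta> * cnj \<zeta> ^ k) = coef x k" if "j \<ge> Suc k" for j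
        using finite_Parseval(2)[of "{..<N j}" "coef x" k] seq_suble[OF N, of j] that by (simp add: S_def)
      then show "eventually (\<lambda>j. (LINT \<zeta>|circle_measure. S (N j) \<zeta> * cnj \<zeta> ^ k) = coef x k) sequentially"
        using eventually_sequentially by blast
    qed
    moreover have "(\<lambda>j. LINT \<zeta>|circle_measure. S (N j) \<zeta> * cnj \<zeta> ^ k) \<longlonglongrightarrow> (LINT \<zeta>|circle_measure. f \<zeta> * cnj \<zeta> ^ k)"
      by (rule lim) (use AEp in auto)
    ultimately show ?thesis using LIMSEQ_unique by blast
  qed
  have coef2: "(LINT \<zeta>|circle_measure. f \<zeta> * \<zeta> ^ Suc k) = 0" for k
  proof -
    have "(LINT \<zeta>|circle_measure. S j \<zeta> * \<zeta> ^ Suc k) = 0" for j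
    proof -
      have ip: "integrable circle_measure (\<lambda>\<zeta>. \<zeta> ^ m)" for m
        by (rule circle_integrable_bounded[of _ 1]) (use AEp in auto)
      have "(LINT \<zeta>|circle_measure. \<zeta> ^ (n + Suc k)) = 0" for n
        using integral_circle_powers[of "n + Suc k" 0] by simp
      then show ?thesis
        unfolding S_def sum_distrib_right mult.assoc power_add[symmetric] by (simp add: ip del: power_Suc)
    qed
    moreover have "(\<lambda>j. LINT \<zeta>|circle_measure. S (N j) \<zeta> * \<zeta> ^ Suc k) \<longlonglongrightarrow> (LINT \<zeta>|circle_measure. f \<zeta> * \<zeta> ^ Suc k)"
      by (rule lim) (use AEp(2)[of "Suc k"] in auto)
    ultimately show ?thesis using LIMSEQ_unique[OF _ tendsto_const] by fastforce
  qed
  have S2: "(LINT \<zeta>|circle_measure. (cmod (S k \<zeta>))\<^sup>2) = (\<Sum>n<k. (cmod (coef x n))\<^sup>2)"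
    and S2i: "integrable circle_measure (\<lambda>\<zeta>. (cmod (S k \<zeta>))\<^sup>2)" for k
    unfolding S_def using finite_Parseval(3,4)[of "{..<k}" "coef x"] by auto
  have partial: "(\<Sum>n<k. (cmod (coef x n))\<^sup>2) \<le> (norm x)\<^sup>2" for k
    unfolding norm_ell2_sq by (intro sum_le_suminf summable_coef_sq) auto
  have "(\<integral>\<^sup>+\<zeta>. ennreal ((cmod (f \<zeta>))\<^sup>2) \<partial>circle_measure) \<le>
      (\<integral>\<^sup>+\<zeta>. liminf (\<lambda>k. ennreal ((cmod (S (N k) \<zeta>))\<^sup>2)) \<partial>circle_measure)"
  proof (rule nn_integral_mono_AE)
    show "AE \<zeta> in circle_measure. ennreal ((cmod (f \<zeta>))\<^sup>2) \<le> liminf (\<lambda>k. ennreal ((cmod (S (N k) \<zeta>))\<^sup>2))"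
      using conv
    proof eventually_elim
      case (elim \<zeta>)
      have "(\<lambda>k. ennreal ((cmod (S (N k) \<zeta>))\<^sup>2)) \<longlonglongrightarrow> ennreal ((cmod (f \<zeta>))\<^sup>2)"
        by (intro tendsto_ennrealI tendsto_intros elim)
      then show ?case using lim_imp_Liminf[OF trivial_limit_sequentially] by (metis order_refl)
    qed
  qed
  also have "\<dots> \<le> liminf (\<lambda>k. \<integral>\<^sup>+\<zeta>. ennreal ((cmod (S (N k) \<zeta>))\<^sup>2) \<partial>circle_measure)"
    by (rule nn_integral_liminf) measurable
  also have "\<dots> \<le> ennreal ((norm x)\<^sup>2)"
  proof (rule Liminf_le)
    show "\<forall>\<^sub>F k in sequentially. (\<integral>\<^sup>+\<zeta>. ennreal ((cmod (S (N k) \<zeta>))\<^sup>2) \<partial>circle_measure) \<le> ennreal ((norm x)\<^sup>2)"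
      by (intro always_eventually allI)
        (simp add: nn_integral_eq_integral[OF S2i] S2 partial ennreal_leI)
  qed simp
  finally have nn: "(\<integral>\<^sup>+\<zeta>. ennreal ((cmod (f \<zeta>))\<^sup>2) \<partial>circle_measure) \<le> ennreal ((norm x)\<^sup>2)" .
  have f2: "integrable circle_measure (\<lambda>\<zeta>. (cmod (f \<zeta>))\<^sup>2)"
    using nn by (intro integrableI_bounded) (auto simp: le_less_trans)
  have upper: "(LINT \<zeta>|circle_measure. (cmod (f \<zeta>))\<^sup>2) \<le> (norm x)\<^sup>2"
    using nn by (subst (asm) nn_integral_eq_integral[OF f2]) auto
  have lower: "(\<Sum>n<k. (cmod (coef x n))\<^sup>2) \<le> (LINT \<zeta>|circle_measure. (cmod (f \<zeta>))\<^sup>2)" for k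
  proof -
    have fS: "integrable circle_measure (\<lambda>\<zeta>. f \<zeta> * cnj (S k \<zeta>))"
      by (rule L2_Cauchy_Schwarz(1)) (use f2 S2i in auto)
    have fp: "integrable circle_measure (\<lambda>\<zeta>. f \<zeta> * cnj \<zeta> ^ n)" for n
    proof (rule Bochner_Integration.integrable_bound[OF intf])
      show "AE \<zeta> in circle_measure. norm (f \<zeta> * cnj \<zeta> ^ n) \<le> norm (f \<zeta>)"
        using AEp(1)[of n] by eventually_elim (simp add: norm_mult mult_left_le)
    qed measurable
    have "(LINT \<zeta>|circle_measure. f \<zeta> * cnj (S k \<zeta>)) = (LINT \<zeta>|circle_measure. (\<Sum>n<k. cnj (coef x n) * (f \<zeta> * cnj \<zeta> ^ n)))"
      unfolding S_def by (simp add: sum_distrib_left mult_ac)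
    also have "\<dots> = (\<Sum>n<k. cnj (coef x n) * coef x n)"
      using fp by (simp add: coef1)
    also have "\<dots> = of_real (\<Sum>n<k. (cmod (coef x n))\<^sup>2)"
      by (simp add: complex_norm_square mult.commute del: of_real_power)
    finally have cross: "Re (LINT \<zeta>|circle_measure. f \<zeta> * cnj (S k \<zeta>)) = (\<Sum>n<k. (cmod (coef x n))\<^sup>2)" by simp
    \<comment> \<open>This is |f - S k|^2 \<ge> 0 expanded. The cross term and |S k|^2 integrate to
      the same partial sum, so one copy survives as the Bessel inequality.\<close>
    have pt: "2 * Re (f \<zeta> * cnj (S k \<zeta>)) \<le> (cmod (f \<zeta>))\<^sup>2 + (cmod (S k \<zeta>))\<^sup>2" for \<zeta>
    proof -
      have "Re (f \<zeta> * cnj (S k \<zeta>)) \<le> cmod (f \<zeta>) * cmod (S k \<zeta>)"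
        using complex_Re_le_cmod[of "f \<zeta> * cnj (S k \<zeta>)"] by (simp add: norm_mult)
      then show ?thesis using sum_squares_bound[of "cmod (f \<zeta>)" "cmod (S k \<zeta>)"] by linarith
    qed
    define R where "R \<zeta> = Re (f \<zeta> * cnj (S k \<zeta>))" for \<zeta>
    have iR: "integrable circle_measure R" unfolding R_def by (rule integrable_Re[OF fS])
    have vR: "integral\<^sup>L circle_measure R = (\<Sum>n<k. (cmod (coef x n))\<^sup>2)"
      unfolding R_def cross[symmetric] by (rule integral_Re[OF fS])
    have "(LINT \<zeta>|circle_measure. 2 * R \<zeta>) \<le>
        (LINT \<zeta>|circle_measure. (cmod (f \<zeta>))\<^sup>2 + (cmod (S k \<zeta>))\<^sup>2)"
      using iR f2 S2i pt unfolding R_def[symmetric] by (intro integral_mono) auto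
    also have "(LINT \<zeta>|circle_measure. 2 * R \<zeta>) = 2 * (\<Sum>n<k. (cmod (coef x n))\<^sup>2)"
      using vR by simp
    finally show ?thesis using f2 S2i by (simp add: S2)
  qed
  have "(norm x)\<^sup>2 \<le> (LINT \<zeta>|circle_measure. (cmod (f \<zeta>))\<^sup>2)"
    unfolding norm_ell2_sq by (rule suminf_le_const[OF summable_coef_sq lower])
  then show ?thesis using that[of f] intf f2 coef1 coef2 upper by simp
qed

section \<open>Power series on the disk and the identification of \<open>H2\<close> with
  \<open>ell2\<close>\<close>

text \<open>The value 0 off the disk matches the convention of \<open>disk_holomorphic\<close>,
  under which agreement on the disk is equality.\<close>

definition disk_series :: "(nat \<Rightarrow> complex) \<Rightarrow> complex \<Rightarrow> complex" where
  "disk_series c z = (if z \<in> ball 0 1 then \<Sum>n. c n * z ^ n else 0)"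

lemma summable_bounded_power_series:
  fixes c :: "nat \<Rightarrow> complex"
  assumes "\<And>n. cmod (c n) \<le> K" "cmod z < 1"
  shows "summable (\<lambda>n. norm (c n * z ^ n))"
proof (rule summable_comparison_test')
  show "summable (\<lambda>n. K * cmod z ^ n)" using assms(2) by (intro summable_mult summable_geometric) simp
  show "norm (norm (c n * z ^ n)) \<le> K * cmod z ^ n" for n
    using assms(1) by (simp add: norm_mult norm_power mult_right_mono)
qed

lemma disk_series_sums:
  assumes "\<And>n. cmod (c n) \<le> K" "cmod z < 1"
  shows "(\<lambda>n. c n * z ^ n) sums disk_series c z"
  using summable_norm_cancel[OF summable_bounded_power_series[OF assms]] assms(2)
  by (simp add: disk_series_def summable_sums)

lemma disk_series_holomorphic:
  assumes "\<And>n. cmod (c n) \<le> K"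
  shows "disk_series c \<in> disk_holomorphic"
proof -
  have "disk_series c holomorphic_on ball 0 1"
    using disk_series_sums[OF assms] by (intro power_series_holomorphic[where a = c]) simp
  then show ?thesis by (auto simp: disk_holomorphic_def disk_series_def)
qed

lemma disk_holomorphic_power_series:
  assumes "f \<in> disk_holomorphic"
  obtains c where "\<And>z. cmod z < 1 \<Longrightarrow> (\<lambda>n. c n * z ^ n) sums f z"
proof (rule that)
  fix z :: complex assume "cmod z < 1"
  then show "(\<lambda>n. (deriv ^^ n) f 0 / fact n * z ^ n) sums f z"
    using holomorphic_power_series[of f 0 1 z] assms by (simp add: disk_holomorphic_def)
qed

lemma disk_holomorphic_continuous:
  assumes "f \<in> disk_holomorphic"
  shows "continuous_on (ball 0 1) f"
  using assms holomorphic_on_imp_continuous_on by (auto simp: disk_holomorphic_def)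

lemma disk_holomorphic_borel:
  assumes "f \<in> disk_holomorphic"
  shows "f \<in> borel_measurable borel"
proof -
  have "(\<lambda>z. if z \<in> ball 0 1 then f z else 0) \<in> borel_measurable borel"
    by (rule borel_measurable_continuous_on_if) (auto intro!: disk_holomorphic_continuous assms)
  moreover have "(\<lambda>z. if z \<in> ball 0 1 then f z else 0) = f"
    using assms by (auto simp: disk_holomorphic_def fun_eq_iff)
  ultimately show ?thesis by simp
qed

lemma circle_mean_square:
  assumes f: "f \<in> disk_holomorphic" and c: "\<And>z. cmod z < 1 \<Longrightarrow> (\<lambda>n. c n * z ^ n) sums f z"
    and r: "0 \<le> r" "r < 1"
  shows "(\<lambda>n. (cmod (c n * of_real r ^ n))\<^sup>2) sums (LINT \<zeta>|circle_measure. (cmod (f (of_real r * \<zeta>)))\<^sup>2)"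
proof -
  have [measurable]: "f \<in> borel_measurable borel" by (rule disk_holomorphic_borel[OF f])
  \<comment> \<open>Convergence at a radius strictly between r and 1 upgrades to absolute
    convergence at r.\<close>
  obtain s where s: "r < s" "s < 1" using dense r by blast
  have "summable (\<lambda>n. c n * of_real s ^ n)" using c[of "of_real s"] r s by (simp add: sums_iff)
  then have d: "summable (\<lambda>n. norm (c n * of_real r ^ n))"
    by (rule powser_insidea) (use r s in simp)
  have eq: "AE \<zeta> in circle_measure. (\<Sum>n. c n * of_real r ^ n * \<zeta> ^ n) = f (of_real r * \<zeta>)"
    using AE_circle_norm
  proof eventually_elim
    case (elim \<zeta>)
    then show ?case using c[of "of_real r * \<zeta>"] r by (simp add: sums_iff norm_mult power_mult_distrib mult.assoc)
  qed
  have "(LINT \<zeta>|circle_measure. (cmod (\<Sum>n. c n * of_real r ^ n * \<zeta> ^ n))\<^sup>2) =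
      (LINT \<zeta>|circle_measure. (cmod (f (of_real r * \<zeta>)))\<^sup>2)"
    using eq by (intro integral_cong_AE) (auto elim: eventually_mono)
  then show ?thesis using absolutely_convergent_Parseval(4)[OF d] by simp
qed

text \<open>The unitary map from Taylor coefficients onto \<open>H2\<close>: it is onto by
  \<open>H2_eq_range_ev\<close> and preserves inner products by \<open>H2_inner_ev\<close>.\<close>

definition ev :: "ell2 \<Rightarrow> complex \<Rightarrow> complex" where
  "ev x = disk_series (coef x)"

lemma ev_sums: "cmod z < 1 \<Longrightarrow> (\<lambda>n. coef x n * z ^ n) sums ev x z"
  unfolding ev_def by (rule disk_series_sums[OF norm_coef_le])

lemma ev_disk_holomorphic: "ev x \<in> disk_holomorphic"
  unfolding ev_def by (rule disk_series_holomorphic[OF norm_coef_le])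

lemma ev_outside: "1 \<le> cmod z \<Longrightarrow> ev x z = 0"
  by (simp add: ev_def disk_series_def)

lemma ev_eqI:
  assumes "f \<in> disk_holomorphic" "\<And>z. cmod z < 1 \<Longrightarrow> (\<lambda>n. coef x n * z ^ n) sums f z"
  shows "f = ev x"
proof
  fix z
  show "f z = ev x z"
  proof (cases "cmod z < 1")
    case True
    then show ?thesis using sums_unique2 assms(2) ev_sums by blast
  next
    case False
    then show ?thesis using assms(1) by (simp add: ev_outside disk_holomorphic_def)
  qed
qed

lemma ev_add: "ev (x + y) = (\<lambda>z. ev x z + ev y z)"
proof (rule ext)
  fix z show "ev (x + y) z = ev x z + ev y z"
    using sums_unique2[OF ev_sums[of z "x + y"]] sums_add[OF ev_sums[of z x] ev_sums[of z y]]
    by (cases "cmod z < 1") (simp_all add: ev_outside algebra_simps)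
qed

lemma ev_cscale: "ev (cscale c x) = (\<lambda>z. c * ev x z)"
proof (rule ext)
  fix z show "ev (cscale c x) z = c * ev x z"
    using sums_unique2[OF ev_sums[of z "cscale c x"]] sums_mult[OF ev_sums[of z x], of c]
    by (cases "cmod z < 1") (simp_all add: ev_outside algebra_simps)
qed

lemma ev_diff: "ev (x - y) = (\<lambda>z. ev x z - ev y z)"
proof -
  have "x - y = x + cscale (-1) y" by (rule coef_eqI) simp
  then show ?thesis by (simp only: ev_add ev_cscale) simp
qed

lemma ev_in_H2: "ev x \<in> H2"
proof -
  have "(LINT \<zeta>|circle_measure. (cmod (ev x (of_real r * \<zeta>)))\<^sup>2) \<le> (norm x)\<^sup>2" if "0 \<le> r" "r < 1" for r
  proof -
    have s: "(\<lambda>n. (cmod (coef x n * of_real r ^ n))\<^sup>2) sums (LINT \<zeta>|circle_measure. (cmod (ev x (of_real r * \<zeta>)))\<^sup>2)"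
      by (rule circle_mean_square[OF ev_disk_holomorphic ev_sums that])
    have "(cmod (coef x n * of_real r ^ n))\<^sup>2 \<le> (cmod (coef x n))\<^sup>2" for n
      using that by (intro power_mono) (auto simp: norm_mult norm_power mult_left_le power_le_one)
    from sums_le[OF this s summable_sums[OF summable_coef_sq]] show ?thesis by (simp add: norm_ell2_sq)
  qed
  then have "bdd_above ((\<lambda>r. LINT \<zeta>|circle_measure. (cmod (ev x (of_real r * \<zeta>)))\<^sup>2) ` {0..<1})"
    by (intro bdd_aboveI2[where M = "(norm x)\<^sup>2"]) auto
  then show ?thesis using ev_disk_holomorphic by (simp add: H2_def)
qed

lemma H2_imp_ev:
  assumes "f \<in> H2"
  obtains x where "f = ev x"
proof -
  have f: "f \<in> disk_holomorphic" using assms by (simp add: H2_def)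
  obtain K where "\<forall>r\<in>{0..<1}. (LINT \<zeta>|circle_measure. (cmod (f (of_real r * \<zeta>)))\<^sup>2) \<le> K"
    using assms unfolding H2_def bdd_above_def by auto
  then have K: "(LINT \<zeta>|circle_measure. (cmod (f (of_real r * \<zeta>)))\<^sup>2) \<le> K" if "0 \<le> r" "r < 1" for r
    using that by auto
  obtain c where c: "\<And>z. cmod z < 1 \<Longrightarrow> (\<lambda>n. c n * z ^ n) sums f z"
    using disk_holomorphic_power_series[OF f] by blast
  have K0: "0 \<le> K" using order_trans[OF Bochner_Integration.integral_nonneg K[of 0]] by simp
  have "(\<Sum>n<N. (cmod (c n))\<^sup>2) \<le> (sqrt K)\<^sup>2" for N
  proof -
    \<comment> \<open>Only finitely many coefficients are compared with the mean at radius r, so r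
      -> 1 becomes the limit of a finite sum.\<close>
    have le: "(\<Sum>n<N. (cmod (c n * of_real r ^ n))\<^sup>2) \<le> K" if r: "r \<in> {0<..<1}" for r
    proof -
      have s: "(\<lambda>n. (cmod (c n * of_real r ^ n))\<^sup>2) sums (LINT \<zeta>|circle_measure. (cmod (f (of_real r * \<zeta>)))\<^sup>2)"
        by (rule circle_mean_square[OF f c]) (use r in auto)
      have "(\<Sum>n<N. (cmod (c n * of_real r ^ n))\<^sup>2) \<le> (LINT \<zeta>|circle_measure. (cmod (f (of_real r * \<zeta>)))\<^sup>2)"
        unfolding sums_unique[OF s] by (rule sum_le_suminf[OF sums_summable[OF s]]) auto
      also have "\<dots> \<le> K" using K r by simp
      finally show ?thesis .
    qed
    have lim: "((\<lambda>r. \<Sum>n<N. (cmod (c n * of_real r ^ n))\<^sup>2) \<longlongrightarrow> (\<Sum>n<N. (cmod (c n * of_real 1 ^ n))\<^sup>2)) (at_left (1::real))"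
      by (intro tendsto_intros)
    have "(\<Sum>n<N. (cmod (c n * of_real 1 ^ n))\<^sup>2) \<le> K"
      by (rule tendsto_upperbound[OF lim])
        (auto intro!: eventually_mono[OF eventually_at_left_real[of 0 1]] le)
    then show ?thesis using K0 by simp
  qed
  from ell2_partial_sums_bounded[OF this] obtain x where "coef x = c" using K0 by auto
  then have "f = ev x" using ev_eqI[OF f] c by simp
  then show ?thesis by (rule that)
qed

lemma H2_eq_range_ev: "H2 = range ev"
  by (auto intro: ev_in_H2 elim: H2_imp_ev)

subsection \<open>Radial limits\<close>

lemma boundary_eqI: "((\<lambda>r. f (of_real r * \<zeta>)) \<longlongrightarrow> l) (at_left (1::real)) \<Longrightarrow> boundary f \<zeta> = l"
  unfolding boundary_def by (rule tendsto_Lim) (auto simp: trivial_limit_at_left_real)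

text \<open>The right-hand side quantifies over countable sets only. Applied along rays, it makes
  the set of points with a radial limit Borel; continuity of \<open>g\<close> allows the passage
  from rational to real radii.\<close>

lemma tendsto_at_left_rational_Cauchy:
  fixes g :: "real \<Rightarrow> complex"
  assumes cont: "continuous_on {0..<1} g"
  shows "(\<exists>l. (g \<longlongrightarrow> l) (at_left 1)) \<longleftrightarrow>
    (\<forall>k::nat. \<exists>m::nat. \<forall>p q :: rat. 1 - 1 / real (Suc m) < of_rat p \<and> of_rat p < (1::real) \<and>
      1 - 1 / real (Suc m) < of_rat q \<and> of_rat q < (1::real) \<longrightarrow> dist (g (of_rat p)) (g (of_rat q)) \<le> 1 / real (Suc k))"
    (is "?lhs \<longleftrightarrow> (\<forall>k. \<exists>m. ?C k m)")
proof
  assume ?lhs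
  then obtain l where l: "(g \<longlongrightarrow> l) (at_left 1)" by blast
  show "\<forall>k. \<exists>m. ?C k m"
  proof
    fix k
    have "eventually (\<lambda>r. dist (g r) l < 1 / (2 * real (Suc k))) (at_left 1)"
      using l by (intro tendstoD) auto
    then obtain a where a: "a < 1" "\<And>r. a < r \<Longrightarrow> r < 1 \<Longrightarrow> dist (g r) l < 1 / (2 * real (Suc k))"
      unfolding eventually_at_left_field by blast
    obtain m where m: "1 / (1 - a) < real (Suc m)"
      using reals_Archimedean2 less_trans lessI of_nat_less_iff by metis
    then have m': "a < 1 - 1 / real (Suc m)" using a(1) by (simp add: field_simps)
    have "?C k m"
    proof (intro allI impI)
      fix p q :: rat
      assume *: "1 - 1 / real (Suc m) < of_rat p \<and> of_rat p < (1::real) \<and> 1 - 1 / real (Suc m) < of_rat q \<and> of_rat q < (1::real)"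
      have "dist (g (of_rat p)) (g (of_rat q)) \<le> dist (g (of_rat p)) l + dist (g (of_rat q)) l"
        by (rule dist_triangle2)
      also have "\<dots> \<le> 1 / (2 * real (Suc k)) + 1 / (2 * real (Suc k))"
        using a(2)[of "of_rat p"] a(2)[of "of_rat q"] * m' by (intro add_mono) auto
      finally show "dist (g (of_rat p)) (g (of_rat q)) \<le> 1 / real (Suc k)" by (simp add: field_simps)
    qed
    then show "\<exists>m. ?C k m" by blast
  qed
next
  assume C: "\<forall>k. \<exists>m. ?C k m"
  have near: "\<exists>q::rat. \<bar>of_rat q - r\<bar> < d \<and> a < of_rat q \<and> of_rat q < (1::real) \<and> dist (g (of_rat q)) (g r) < e"
    if "0 \<le> a" "a < r" "r < 1" "0 < e" "0 < d" for a r e d :: real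
  proof -
    have "continuous (at r within {0..<1}) g" using cont that by (auto simp: continuous_on_eq_continuous_within)
    then obtain d' where "d' > 0" "\<forall>s\<in>{0..<1}. dist s r < d' \<longrightarrow> dist (g s) (g r) < e"
      using \<open>0 < e\<close> unfolding continuous_within_eps_delta by blast
    then have d': "d' > 0" "\<And>s. s \<in> {0..<1} \<Longrightarrow> dist s r < d' \<Longrightarrow> dist (g s) (g r) < e" by auto
    have lt: "max a (r - min d d') < r" using d'(1) \<open>a < r\<close> \<open>0 < d\<close> by auto
    obtain q :: rat where q: "max a (r - min d d') < of_rat q" "of_rat q < r"
      using of_rat_dense[OF lt] by blast
    define w where "w = (of_rat q :: real)"
    have w: "a < w" "w < 1" "\<bar>w - r\<bar> < d" "w \<in> {0..<1}" "dist w r < d'"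
      using q that unfolding w_def[symmetric] by (auto simp: dist_real_def)
    then show ?thesis using d'(2)[OF w(4,5)] unfolding w_def by blast
  qed
  have real_C: "\<exists>a<1. \<forall>r s. a < r \<and> r < 1 \<and> a < s \<and> s < 1 \<longrightarrow> dist (g r) (g s) < e" if e: "0 < e" for e
  proof -
    obtain k where k: "1 / real (Suc k) < e / 3" using reals_Archimedean[of "e / 3"] e by (auto simp: inverse_eq_divide)
    obtain m where m: "?C k m" using C by blast
    define a where "a = 1 - 1 / real (Suc m)"
    have a: "0 \<le> a" "a < 1" by (simp_all add: a_def)
    have "dist (g r) (g s) < e" if rs: "a < r" "r < 1" "a < s" "s < 1" for r s
    proof -
      obtain p :: rat where p: "a < of_rat p" "of_rat p < (1::real)" "dist (g (of_rat p)) (g r) < e / 3"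
        using near[OF a(1) rs(1,2), of "e/3" 1] e by auto
      obtain q :: rat where q: "a < of_rat q" "of_rat q < (1::real)" "dist (g (of_rat q)) (g s) < e / 3"
        using near[OF a(1) rs(3,4), of "e/3" 1] e by auto
      have "dist (g (of_rat p)) (g (of_rat q)) \<le> 1 / real (Suc k)"
        using m p q unfolding a_def by blast
      then show ?thesis using p(3) q(3) k
          dist_triangle3[of "g r" "g s" "g (of_rat p)"] dist_triangle[of "g (of_rat p)" "g s" "g (of_rat q)"] by linarith
    qed
    then show ?thesis using a(2) by blast
  qed
  define t where "t n = 1 - 1 / real (Suc n)" for n
  have t: "t \<longlonglongrightarrow> 1"
    unfolding t_def using tendsto_diff[OF tendsto_const LIMSEQ_Suc[OF lim_1_over_n], of 1] by simp
  have t1: "t n < 1" for n by (simp add: t_def)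
  have "Cauchy (\<lambda>n. g (t n))"
  proof (rule metric_CauchyI)
    fix e :: real assume "0 < e"
    then obtain a where a: "a < 1" "\<And>r s. a < r \<Longrightarrow> r < 1 \<Longrightarrow> a < s \<Longrightarrow> s < 1 \<Longrightarrow> dist (g r) (g s) < e"
      using real_C by blast
    obtain M where "\<And>n. n \<ge> M \<Longrightarrow> a < t n"
      using order_tendstoD(1)[OF t a(1)] unfolding eventually_sequentially by blast
    then show "\<exists>M. \<forall>m\<ge>M. \<forall>n\<ge>M. dist (g (t m)) (g (t n)) < e" using a(2) t1 by blast
  qed
  then obtain l where l: "(\<lambda>n. g (t n)) \<longlonglongrightarrow> l" using Cauchy_convergent_iff convergent_def by blast
  have "(g \<longlongrightarrow> l) (at_left 1)"
  proof (rule tendstoI)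
    fix e :: real assume "0 < e"
    then have e2: "0 < e / 2" by simp
    obtain a where a: "a < 1" "\<And>r s. a < r \<Longrightarrow> r < 1 \<Longrightarrow> a < s \<Longrightarrow> s < 1 \<Longrightarrow> dist (g r) (g s) < e / 2"
      using real_C[OF e2] by blast
    have "eventually (\<lambda>n. a < t n \<and> dist (g (t n)) l < e / 2) sequentially"
      using order_tendstoD(1)[OF t a(1)] tendstoD[OF l e2] by (rule eventually_conj)
    then obtain n where n: "a < t n" "dist (g (t n)) l < e / 2"
      using eventually_happens'[OF sequentially_bot] by blast
    have "dist (g r) l < e" if "a < r" "r < 1" for r
      using a(2)[OF that n(1) t1] n(2) dist_triangle[of "g r" l "g (t n)"] by linarith
    then show "eventually (\<lambda>r. dist (g r) l < e) (at_left 1)"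
      unfolding eventually_at_left_field using a(1) by blast
  qed
  then show ?lhs by blast
qed

text \<open>
  Where the radial limit fails to exist, \<^const>\<open>Lim\<close> is one fixed value, so the boundary function
  is Borel measurable everywhere, not only up to a null set.
\<close>

lemma boundary_measurable:
  assumes f: "f \<in> disk_holomorphic"
  shows "boundary f \<in> borel_measurable borel"
proof -
  have [measurable]: "f \<in> borel_measurable borel" by (rule disk_holomorphic_borel[OF f])
  define C where "C \<zeta> \<longleftrightarrow> (\<forall>k::nat. \<exists>m::nat. \<forall>p q :: rat. 1 - 1 / real (Suc m) < of_rat p \<and> of_rat p < (1::real) \<and>
      1 - 1 / real (Suc m) < of_rat q \<and> of_rat q < (1::real) \<longrightarrow>
      dist (f (of_real (of_rat p) * \<zeta>)) (f (of_real (of_rat q) * \<zeta>)) \<le> 1 / real (Suc k))" for \<zeta>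
  define t where "t n = 1 - 1 / real (Suc n)" for n
  have t: "t \<longlonglongrightarrow> 1"
    unfolding t_def using tendsto_diff[OF tendsto_const LIMSEQ_Suc[OF lim_1_over_n], of 1] by simp
  \<comment> \<open>The value of \<open>Lim\<close> in the absence of a limit: the description of an
    empty predicate, hence the same at every such point.\<close>
  define junk :: complex where "junk = (THE l. False)"
  have C: "C \<zeta> \<longleftrightarrow> (\<exists>l. ((\<lambda>r. f (of_real r * \<zeta>)) \<longlongrightarrow> l) (at_left (1::real)))" if "cmod \<zeta> \<le> 1" for \<zeta>
  proof -
    have "of_real r * \<zeta> \<in> ball 0 1" if "r \<in> {0..<1}" for r
      using that \<open>cmod \<zeta> \<le> 1\<close> mult_left_le[of "cmod \<zeta>" r] by (auto simp: norm_mult)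
    then have "continuous_on {0..<1} (\<lambda>r. f (of_real r * \<zeta>))"
      by (intro continuous_on_compose2[OF disk_holomorphic_continuous[OF f]] continuous_intros) auto
    from tendsto_at_left_rational_Cauchy[OF this] show ?thesis unfolding C_def by simp
  qed
  have eq: "boundary f \<zeta> = (if cmod \<zeta> \<le> 1 then if C \<zeta> then lim (\<lambda>n. f (of_real (t n) * \<zeta>)) else junk else 0)" for \<zeta>
  proof (cases "cmod \<zeta> \<le> 1")
    case True
    show ?thesis
    proof (cases "C \<zeta>")
      case CT: True
      then obtain l where l: "((\<lambda>r. f (of_real r * \<zeta>)) \<longlongrightarrow> l) (at_left (1::real))" using C[OF True] by blast
      have "filterlim t (at_left 1) sequentially"
        using t by (auto simp: filterlim_at t_def)
      from filterlim_compose[OF l this] have "lim (\<lambda>n. f (of_real (t n) * \<zeta>)) = l" by (rule limI)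
      then show ?thesis using True CT boundary_eqI[OF l] by simp
    next
      case False
      then have "(\<lambda>l. ((\<lambda>r. f (of_real r * \<zeta>)) \<longlongrightarrow> l) (at_left (1::real))) = (\<lambda>l. False)"
        using C[OF True] by blast
      then show ?thesis using True False by (simp add: boundary_def Topological_Spaces.Lim_def junk_def)
    qed
  next
    case False
    \<comment> \<open>Outside the closed unit disk the ray is already off the open disk for r close
      to 1, where \<open>f\<close> is 0 by convention.\<close>
    then have "eventually (\<lambda>r. r \<in> {1 / cmod \<zeta><..<1}) (at_left (1::real))"
      by (intro eventually_at_left_real) (simp add: divide_less_eq)
    then have "eventually (\<lambda>r. f (of_real r * \<zeta>) = 0) (at_left (1::real))"
    proof eventually_elim
      case (elim r)
      have z1: "1 < cmod \<zeta>" using False by simp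
      then have "1 < r * cmod \<zeta>" using elim pos_divide_less_eq[of "cmod \<zeta>" 1 r] by fastforce
      have "0 < 1 / cmod \<zeta>" using z1 by (intro divide_pos_pos) linarith+
      also have "1 / cmod \<zeta> < r" using elim by (simp only: greaterThanLessThan_iff)
      finally have "0 < r" .
      with \<open>1 < r * cmod \<zeta>\<close> have "of_real r * \<zeta> \<notin> ball 0 1" by (simp add: norm_mult)
      then show ?case using f by (simp add: disk_holomorphic_def)
    qed
    then have "boundary f \<zeta> = 0" by (intro boundary_eqI tendsto_eventually)
    then show ?thesis using False by simp
  qed
  have [measurable]: "Measurable.pred borel C" unfolding C_def by measurable
  have "boundary f = (\<lambda>\<zeta>. if cmod \<zeta> \<le> 1 then if C \<zeta> then lim (\<lambda>n. f (of_real (t n) * \<zeta>)) else junk else 0)"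
    using eq by blast
  also have "\<dots> \<in> borel_measurable borel" by measurable
  finally show ?thesis .
qed

text \<open>On the circle the Poisson kernel is the mean of the Herglotz kernel H and its conjugate.
  H sees the nonnegative Fourier coefficients and yields 2 \<open>ev x z\<close> -
  \<open>coef x 0\<close>; its conjugate sees the nonpositive ones, of which only the constant term
  is left.\<close>

lemma ev_eq_poisson_integral:
  fixes f :: "complex \<Rightarrow> complex"
  assumes f: "integrable circle_measure f"
    and c1: "\<And>k. (LINT \<zeta>|circle_measure. f \<zeta> * cnj \<zeta> ^ k) = coef x k"
    and c2: "\<And>k. (LINT \<zeta>|circle_measure. f \<zeta> * \<zeta> ^ Suc k) = 0"
    and z: "cmod z < 1"
  shows "(LINT \<zeta>|circle_measure. poisson z \<zeta> *\<^sub>R f \<zeta>) = ev x z"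
proof -
  have [measurable]: "f \<in> borel_measurable borel" using borel_measurable_integrable[OF f] by simp
  define H where "H \<zeta> = (\<zeta> + z) / (\<zeta> - z)" for \<zeta>
  have s1: "(\<lambda>n. herglotz_coeff n * z ^ n * coef x n) sums (LINT \<zeta>|circle_measure. H \<zeta> * f \<zeta>)"
    using integral_herglotz_sums(2)[OF f z] unfolding H_def by (simp add: c1[symmetric] mult.commute)
  have "(\<lambda>n. 2 * (coef x n * z ^ n) - (if n = 0 then coef x 0 else 0)) sums (2 * ev x z - coef x 0)"
    using sums_single[of 0 "\<lambda>_. coef x 0"]
    by (intro sums_diff sums_mult ev_sums z) (simp add: eq_commute)
  also have "(\<lambda>n. 2 * (coef x n * z ^ n) - (if n = 0 then coef x 0 else 0)) = (\<lambda>n. herglotz_coeff n * z ^ n * coef x n)"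
    by (auto simp: herglotz_coeff_def fun_eq_iff)
  finally have I1: "(LINT \<zeta>|circle_measure. H \<zeta> * f \<zeta>) = 2 * ev x z - coef x 0"
    using s1 sums_unique2 by blast
  have fc: "integrable circle_measure (\<lambda>\<zeta>. cnj (f \<zeta>))" using f by simp
  have c2': "(LINT \<zeta>|circle_measure. cnj \<zeta> ^ n * cnj (f \<zeta>)) = (if n = 0 then cnj (coef x 0) else 0)" for n
  proof -
    have "(LINT \<zeta>|circle_measure. cnj \<zeta> ^ n * cnj (f \<zeta>)) = cnj (LINT \<zeta>|circle_measure. f \<zeta> * \<zeta> ^ n)"
      unfolding integral_cnj_complex[symmetric] by (simp add: mult.commute)
    then show ?thesis using c2[of "n - 1"] c1[of 0] by (cases n) simp_all
  qed
  have "(\<lambda>n. herglotz_coeff n * z ^ n * (if n = 0 then cnj (coef x 0) else 0)) sums (LINT \<zeta>|circle_measure. H \<zeta> * cnj (f \<zeta>))"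
    using integral_herglotz_sums(2)[OF fc z] unfolding H_def by (simp only: c2')
  moreover have "(\<lambda>n. herglotz_coeff n * z ^ n * (if n = 0 then cnj (coef x 0) else 0)) sums cnj (coef x 0)"
    using sums_single[of 0 "\<lambda>_. cnj (coef x 0)"]
    by (simp add: herglotz_coeff_def if_distrib eq_commute cong: if_cong)
  ultimately have "(LINT \<zeta>|circle_measure. H \<zeta> * cnj (f \<zeta>)) = cnj (coef x 0)"
    using sums_unique2 by blast
  then have I2: "(LINT \<zeta>|circle_measure. cnj (H \<zeta>) * f \<zeta>) = coef x 0"
    using integral_cnj_complex[of circle_measure "\<lambda>\<zeta>. H \<zeta> * cnj (f \<zeta>)"] by simp
  have i1: "integrable circle_measure (\<lambda>\<zeta>. H \<zeta> * f \<zeta>)"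
    unfolding H_def by (rule integral_herglotz_sums(1)[OF f z])
  have "integrable circle_measure (\<lambda>\<zeta>. cnj (H \<zeta> * cnj (f \<zeta>)))"
    unfolding integrable_cnj_iff H_def by (rule integral_herglotz_sums(1)[OF fc z])
  then have i2: "integrable circle_measure (\<lambda>\<zeta>. cnj (H \<zeta>) * f \<zeta>)" by simp
  have "AE \<zeta> in circle_measure. poisson z \<zeta> *\<^sub>R f \<zeta> = (H \<zeta> * f \<zeta> + cnj (H \<zeta>) * f \<zeta>) / 2"
    using AE_circle_norm
  proof eventually_elim
    case (elim \<zeta>)
    have "H \<zeta> + cnj (H \<zeta>) = of_real (2 * poisson z \<zeta>)"
      unfolding complex_add_cnj H_def Re_herglotz_kernel[OF elim z] ..
    then have "(H \<zeta> * f \<zeta> + cnj (H \<zeta>) * f \<zeta>) = of_real (2 * poisson z \<zeta>) * f \<zeta>"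
      unfolding distrib_right[symmetric] by simp
    then show ?case by (simp add: scaleR_conv_of_real)
  qed
  moreover have "H \<in> borel_measurable borel" unfolding H_def by measurable
  ultimately have "(LINT \<zeta>|circle_measure. poisson z \<zeta> *\<^sub>R f \<zeta>) = (LINT \<zeta>|circle_measure. (H \<zeta> * f \<zeta> + cnj (H \<zeta>) * f \<zeta>) / 2)"
    by (intro integral_cong_AE) auto
  also have "\<dots> = (2 * ev x z - coef x 0 + coef x 0) / 2"
    using i1 i2 by (simp add: I1 I2)
  finally show ?thesis by simp
qed

text \<open>The Riesz-Fischer function with these coefficients has Poisson integral
  \<open>ev x\<close>, so Fatou's theorem identifies it almost everywhere with the radial limit,
  which inherits integrability and norm.\<close>

lemma
  shows AE_ev_radial_limit: "AE \<zeta> in circle_measure.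
      ((\<lambda>r. ev x (of_real r * \<zeta>)) \<longlongrightarrow> boundary (ev x) \<zeta>) (at_left (1::real))"
    and integrable_boundary_sq: "integrable circle_measure (\<lambda>\<zeta>. (cmod (boundary (ev x) \<zeta>))\<^sup>2)"
    and integral_boundary_sq: "(LINT \<zeta>|circle_measure. (cmod (boundary (ev x) \<zeta>))\<^sup>2) = (norm x)\<^sup>2"
proof -
  obtain f where [measurable]: "f \<in> borel_measurable borel" and f: "integrable circle_measure f"
    "integrable circle_measure (\<lambda>\<zeta>. (cmod (f \<zeta>))\<^sup>2)"
    "\<And>k. (LINT \<zeta>|circle_measure. f \<zeta> * cnj \<zeta> ^ k) = coef x k"
    "\<And>k. (LINT \<zeta>|circle_measure. f \<zeta> * \<zeta> ^ Suc k) = 0"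
    "(LINT \<zeta>|circle_measure. (cmod (f \<zeta>))\<^sup>2) = (norm x)\<^sup>2"
    using Riesz_Fischer[of x] by blast
  have [measurable]: "boundary (ev x) \<in> borel_measurable borel"
    by (rule boundary_measurable[OF ev_disk_holomorphic])
  have lim: "AE \<zeta> in circle_measure. ((\<lambda>r. ev x (of_real r * \<zeta>)) \<longlongrightarrow> f \<zeta>) (at_left (1::real))"
    using Fatou_poisson[OF f(1)] AE_circle_norm
  proof eventually_elim
    case (elim \<zeta>)
    have "eventually (\<lambda>r. r \<in> {0<..<1}) (at_left (1::real))" by (rule eventually_at_left_real) simp
    then have "eventually (\<lambda>r. (LINT \<eta>|circle_measure. poisson (of_real r * \<zeta>) \<eta> *\<^sub>R f \<eta>) = ev x (of_real r * \<zeta>)) (at_left 1)"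
      by eventually_elim (use elim(2) in \<open>simp add: ev_eq_poisson_integral[OF f(1,3,4)] norm_mult\<close>)
    from Lim_transform_eventually[OF elim(1) this] show ?case .
  qed
  then have eq: "AE \<zeta> in circle_measure. boundary (ev x) \<zeta> = f \<zeta>"
    by eventually_elim (rule boundary_eqI)
  show "AE \<zeta> in circle_measure.
      ((\<lambda>r. ev x (of_real r * \<zeta>)) \<longlongrightarrow> boundary (ev x) \<zeta>) (at_left (1::real))"
    using lim eq by eventually_elim simp
  have eq2: "AE \<zeta> in circle_measure. (cmod (f \<zeta>))\<^sup>2 = (cmod (boundary (ev x) \<zeta>))\<^sup>2"
    using eq by eventually_elim simp
  show "integrable circle_measure (\<lambda>\<zeta>. (cmod (boundary (ev x) \<zeta>))\<^sup>2)"
    by (rule integrable_cong_AE_imp[OF f(2) _ ]) (use eq2 in \<open>auto simp: eq_commute\<close>)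
  show "(LINT \<zeta>|circle_measure. (cmod (boundary (ev x) \<zeta>))\<^sup>2) = (norm x)\<^sup>2"
    unfolding f(5)[symmetric] by (rule integral_cong_AE) (use eq in \<open>auto elim: eventually_mono\<close>)
qed

lemma boundary_ev_measurable [measurable]: "boundary (ev x) \<in> borel_measurable borel"
  by (rule boundary_measurable[OF ev_disk_holomorphic])

lemma AE_boundary_add:
  "AE \<zeta> in circle_measure. boundary (ev (x + y)) \<zeta> = boundary (ev x) \<zeta> + boundary (ev y) \<zeta>"
  using AE_ev_radial_limit[of x] AE_ev_radial_limit[of y]
  by eventually_elim (auto intro!: boundary_eqI tendsto_add simp: ev_add)

lemma AE_boundary_diff:
  "AE \<zeta> in circle_measure. boundary (ev (x - y)) \<zeta> = boundary (ev x) \<zeta> - boundary (ev y) \<zeta>"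
  using AE_ev_radial_limit[of x] AE_ev_radial_limit[of y]
  by eventually_elim (auto intro!: boundary_eqI tendsto_diff simp: ev_diff)

lemma AE_boundary_cscale:
  "AE \<zeta> in circle_measure. boundary (ev (cscale c x)) \<zeta> = c * boundary (ev x) \<zeta>"
  using AE_ev_radial_limit[of x]
  by eventually_elim (auto intro!: boundary_eqI tendsto_mult simp: ev_cscale)

lemma H2_norm_ev: "H2_norm (ev x) = norm x"
  by (simp add: H2_norm_def integral_boundary_sq)

lemma inj_ev: "inj ev"
proof (rule injI)
  fix x y assume "ev x = ev y"
  then have "ev (x - y) = ev 0" by (simp add: ev_diff[of x y] ev_diff[of 0 0, simplified])
  then have "norm (x - y) = 0" using H2_norm_ev[of "x - y"] H2_norm_ev[of 0] by simp
  then show "x = y" by simp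
qed

lemma L2_inner_integrable:
  assumes "f \<in> borel_measurable borel" "integrable circle_measure (\<lambda>\<zeta>. (cmod (f \<zeta>))\<^sup>2)"
    "g \<in> borel_measurable borel" "integrable circle_measure (\<lambda>\<zeta>. (cmod (g \<zeta>))\<^sup>2)"
  shows "integrable circle_measure (\<lambda>\<zeta>. f \<zeta> * cnj (g \<zeta>))"
  by (rule L2_Cauchy_Schwarz(1)) (use assms in auto)

text \<open>Polarisation: the real part comes from the norm of a sum, the imaginary part from
  replacing y by i y.\<close>

lemma H2_inner_ev: "H2_inner (ev x) (ev y) = cinner x y"
proof -
  have int: "integrable circle_measure (\<lambda>\<zeta>. boundary (ev u) \<zeta> * cnj (boundary (ev v) \<zeta>))" for u v
    by (rule L2_inner_integrable) (auto intro: integrable_boundary_sq)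
  have real_part: "Re (H2_inner (ev u) (ev v)) = inner u v" for u v
  proof -
    have pt: "AE \<zeta> in circle_measure. (cmod (boundary (ev (u + v)) \<zeta>))\<^sup>2 =
      (cmod (boundary (ev u) \<zeta>))\<^sup>2 + (cmod (boundary (ev v) \<zeta>))\<^sup>2 + 2 * Re (boundary (ev u) \<zeta> * cnj (boundary (ev v) \<zeta>))"
      using AE_boundary_add[of u v]
      by eventually_elim (simp only: cmod_power2, simp add: power2_eq_square algebra_simps)
    define R where "R \<zeta> = Re (boundary (ev u) \<zeta> * cnj (boundary (ev v) \<zeta>))" for \<zeta>
    have iR: "integrable circle_measure R" unfolding R_def by (rule integrable_Re[OF int])
    have "(norm (u + v))\<^sup>2 = (LINT \<zeta>|circle_measure. (cmod (boundary (ev u) \<zeta>))\<^sup>2 + (cmod (boundary (ev v) \<zeta>))\<^sup>2 + 2 * R \<zeta>)"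
      unfolding integral_boundary_sq[symmetric]
      by (rule integral_cong_AE) (use pt iR in \<open>auto simp: R_def\<close>)
    also have "\<dots> = (norm u)\<^sup>2 + (norm v)\<^sup>2 + 2 * integral\<^sup>L circle_measure R"
      using iR by (simp add: integrable_boundary_sq integral_boundary_sq)
    finally have "integral\<^sup>L circle_measure R = inner u v"
      by (simp add: power2_norm_eq_inner inner_add_left inner_add_right inner_commute[of v u])
    then show ?thesis
      unfolding H2_inner_def L2_inner_def R_def using integral_Re[OF int[of u v]] by simp
  qed
  have "H2_inner (ev x) (ev (cscale \<i> y)) = - \<i> * H2_inner (ev x) (ev y)"
  proof -
    have "H2_inner (ev x) (ev (cscale \<i> y)) = (LINT \<zeta>|circle_measure. - \<i> * (boundary (ev x) \<zeta> * cnj (boundary (ev y) \<zeta>)))"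
      unfolding H2_inner_def L2_inner_def
      by (rule integral_cong_AE) (use AE_boundary_cscale[of \<i> y] in \<open>auto elim: eventually_mono\<close>)
    then show ?thesis by (simp add: H2_inner_def L2_inner_def)
  qed
  then have "Im (H2_inner (ev x) (ev y)) = inner x (cscale \<i> y)"
    using real_part[of x "cscale \<i> y"] by simp
  then show ?thesis using real_part[of x y] by (simp add: cinner_eq_inner complex_eq_iff)
qed

section \<open>Multiplication and Toeplitz operators\<close>

text \<open>The Riesz representation of the functional \<open>\<lambda>x. inner (T x) y\<close>
  gives the value at y; the norm bound follows from |T' y|^2 = <T (T' y), y>.\<close>

lemma adjoint_exists:
  fixes T :: "'h::{real_inner,banach} \<Rightarrow>\<^sub>L 'h"
  obtains T' :: "'h \<Rightarrow>\<^sub>L 'h" where "\<And>x y. inner (T x) y = inner x (T' y)" "norm T' \<le> norm T"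
proof -
  have "\<exists>w. \<forall>x. inner (T x) y = inner x w" for y
  proof -
    obtain w where "w \<in> closure UNIV" "\<And>x. x \<in> UNIV \<Longrightarrow> inner w x = inner (T x) y"
    proof (rule riesz_on_subspace[of UNIV "\<lambda>x. inner (T x) y" "norm T * norm y"])
      show "\<bar>inner (T x) y\<bar> \<le> norm T * norm y * norm x" for x
      proof -
        have "\<bar>inner (T x) y\<bar> \<le> norm (T x) * norm y" by (rule Cauchy_Schwarz_ineq2)
        also have "\<dots> \<le> (norm T * norm x) * norm y" by (intro mult_right_mono norm_blinfun) simp
        finally show ?thesis by (simp add: mult_ac)
      qed
    qed (auto simp: blinfun.add_right blinfun.scaleR_right inner_add_left)
    then show ?thesis by (intro exI[of _ w]) (simp add: inner_commute)
  qed
  then obtain W where W: "\<And>x y. inner (T x) y = inner x (W y)" by metis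
  have eqI: "u = v" if "\<And>x. inner x u = inner x v" for u v :: 'h
  proof -
    have "inner (u - v) (u - v) = 0" using that[of "u - v"] by (simp only: inner_diff_right)
    then show ?thesis by simp
  qed
  have bound: "norm (W y) \<le> norm y * norm T" for y
  proof -
    have "norm (W y) * norm (W y) = inner (T (W y)) y"
      unfolding W by (simp only: dot_square_norm power2_eq_square)
    also have "\<dots> \<le> norm (T (W y)) * norm y" by (rule norm_cauchy_schwarz)
    also have "\<dots> \<le> (norm T * norm (W y)) * norm y" by (intro mult_right_mono norm_blinfun) simp
    finally have "norm (W y) * norm (W y) \<le> norm (W y) * (norm y * norm T)" by (simp add: mult_ac)
    then show ?thesis by (cases "W y = 0") simp_all
  qed
  have "bounded_linear W"
  proof (rule bounded_linear_intro[OF _ _ bound])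
    show "W (x + y) = W x + W y" for x y
      by (rule eqI) (simp add: W[symmetric] inner_add_right)
    show "W (r *\<^sub>R x) = r *\<^sub>R W x" for r x
      by (rule eqI) (simp add: W[symmetric])
  qed
  then have "inner (T x) y = inner x (Blinfun W y)" for x y
    by (simp add: bounded_linear_Blinfun_apply W)
  moreover have "norm (Blinfun W) \<le> norm T"
    by (rule norm_blinfun_bound) (simp_all add: bounded_linear_Blinfun_apply \<open>bounded_linear W\<close> bound mult.commute)
  ultimately show ?thesis by (rule that)
qed

lemma cinner_scale_right: "cinner x (cscale c y) = cnj c * cinner x y"
proof -
  have "cinner x (cscale c y) = cnj (cinner (cscale c y) x)" by (rule cinner_commute)
  also have "\<dots> = cnj c * cnj (cinner y x)" by (simp add: cinner_scale_left)
  also have "cnj (cinner y x) = cinner x y" by (rule cinner_commute[symmetric])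
  finally show ?thesis .
qed

lemma cinner_eqI: "(\<And>y. cinner u y = cinner v y) \<Longrightarrow> u = v"
  by (rule coef_eqI) (metis cinner_basis)

lemma scaleR_eq_cscale: "r *\<^sub>R x = cscale (of_real r) x"
  by (simp add: scaleR_ell2_def)

lemma cscale_add: "cscale c (x + y) = cscale c x + cscale c y"
  by (rule coef_eqI) (simp add: algebra_simps)

lemma cscale_cscale: "cscale c (cscale d x) = cscale (c * d) x"
  by (rule coef_eqI) simp

lemma bounded_linear_cscale: "bounded_linear (cscale c)"
  by (rule bounded_linear_intro[where K = "cmod c"])
    (simp_all add: cscale_add scaleR_eq_cscale cscale_cscale mult.commute)

text \<open>Testing the real identity at x and at i x gives the real and the imaginary part.\<close>

lemma complex_adjoint:
  fixes T T' :: "ell2 \<Rightarrow> ell2"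
  assumes "\<And>x. inner (T x) y = inner x (T' y)" "\<And>x. T (cscale \<i> x) = cscale \<i> (T x)"
  shows "cinner (T x) y = cinner x (T' y)"
proof -
  have "Re (cinner (T x) y) = Re (cinner x (T' y))" using assms(1) by (simp add: inner_eq_Re_cinner)
  moreover have "Re (cinner (T (cscale \<i> x)) y) = Re (cinner (cscale \<i> x) (T' y))"
    using assms(1) by (simp add: inner_eq_Re_cinner)
  ultimately show ?thesis by (simp add: assms(2) cinner_scale_left complex_eq_iff)
qed

section \<open>Bounded analytic functions as multipliers\<close>

lemma Hinf_bound:
  assumes "\<phi> \<in> Hinf"
  obtains K where "0 \<le> K" "\<And>z. cmod (\<phi> z) \<le> K"
proof -
  obtain K where "\<forall>w\<in>\<phi> ` ball 0 1. norm w \<le> K"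
    using assms unfolding Hinf_def bounded_iff by blast
  then have K: "cmod (\<phi> z) \<le> K" if "z \<in> ball 0 1" for z using that by blast
  have "0 \<le> K" using order_trans[OF norm_ge_zero K[of 0]] by simp
  moreover have "cmod (\<phi> z) \<le> K" for z
    using K[of z] assms \<open>0 \<le> K\<close> by (cases "z \<in> ball 0 1") (auto simp: Hinf_def disk_holomorphic_def)
  ultimately show ?thesis by (rule that)
qed

lemma HinfI:
  assumes "\<phi> \<in> disk_holomorphic" "\<And>z. cmod z < 1 \<Longrightarrow> cmod (\<phi> z) \<le> K"
  shows "\<phi> \<in> Hinf"
proof -
  have "\<forall>w\<in>\<phi> ` ball 0 1. norm w \<le> K" using assms(2) by auto
  then show ?thesis using assms(1) unfolding Hinf_def bounded_iff by blast
qed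

lemma Hinf_mult_H2:
  assumes \<phi>: "\<phi> \<in> Hinf" and f: "f \<in> H2"
  shows "(\<lambda>z. \<phi> z * f z) \<in> H2"
proof -
  obtain K where K: "0 \<le> K" "\<And>z. cmod (\<phi> z) \<le> K" using Hinf_bound[OF \<phi>] by blast
  have d: "\<phi> \<in> disk_holomorphic" "f \<in> disk_holomorphic" using assms by (auto simp: Hinf_def H2_def)
  then have [measurable]: "\<phi> \<in> borel_measurable borel" "f \<in> borel_measurable borel"
    by (auto intro: disk_holomorphic_borel)
  obtain B where "\<forall>m\<in>(\<lambda>r. LINT \<zeta>|circle_measure. (cmod (f (of_real r * \<zeta>)))\<^sup>2) ` {0..<1}. m \<le> B"
    using f unfolding H2_def bdd_above_def by blast
  then have B: "(LINT \<zeta>|circle_measure. (cmod (f (of_real r * \<zeta>)))\<^sup>2) \<le> B" if "r \<in> {0..<1}" for r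
    using that by blast
  have "(LINT \<zeta>|circle_measure. (cmod (\<phi> (of_real r * \<zeta>) * f (of_real r * \<zeta>)))\<^sup>2) \<le> K\<^sup>2 * B" if r: "r \<in> {0..<1}" for r
  proof -
    \<comment> \<open>Boundedness on the smaller closed disk makes the mean square of
      \<open>f\<close> at radius r a genuine integral, so that the comparison is not with the
      default value 0.\<close>
    have cont: "continuous_on (cball 0 r) f"
      by (rule continuous_on_subset[OF disk_holomorphic_continuous[OF d(2)]]) (use r in auto)
    obtain L where "\<forall>w\<in>f ` cball 0 r. norm w \<le> L"
      using compact_imp_bounded[OF compact_continuous_image[OF cont compact_cball]] unfolding bounded_iff by blast
    then have L: "cmod (f z) \<le> L" if "z \<in> cball 0 r" for z using that by blast
    have "integrable circle_measure (\<lambda>\<zeta>. (cmod (f (of_real r * \<zeta>)))\<^sup>2)"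
    proof (rule circle_integrable_bounded)
      show "AE \<zeta> in circle_measure. norm ((cmod (f (of_real r * \<zeta>)))\<^sup>2) \<le> L\<^sup>2"
        using AE_circle_norm by eventually_elim (use L r in \<open>auto intro!: power_mono simp: norm_mult\<close>)
    qed measurable
    then have i: "integrable circle_measure (\<lambda>\<zeta>. K\<^sup>2 * (cmod (f (of_real r * \<zeta>)))\<^sup>2)" by simp
    have "(LINT \<zeta>|circle_measure. (cmod (\<phi> (of_real r * \<zeta>) * f (of_real r * \<zeta>)))\<^sup>2) \<le>
        (LINT \<zeta>|circle_measure. K\<^sup>2 * (cmod (f (of_real r * \<zeta>)))\<^sup>2)"
    proof (rule order_trans[OF _ integral_norm_le_integral[OF i]])
      show "norm ((cmod (\<phi> (of_real r * \<zeta>) * f (of_real r * \<zeta>)))\<^sup>2) \<le> K\<^sup>2 * (cmod (f (of_real r * \<zeta>)))\<^sup>2" for \<zeta>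
        using K(2)[of "of_real r * \<zeta>"] by (simp add: norm_mult power_mult_distrib mult_right_mono power_mono)
    qed simp
    also have "\<dots> \<le> K\<^sup>2 * B" using B[OF r] by (simp add: mult_left_mono)
    finally show ?thesis .
  qed
  then have "bdd_above ((\<lambda>r. LINT \<zeta>|circle_measure. (cmod (\<phi> (of_real r * \<zeta>) * f (of_real r * \<zeta>)))\<^sup>2) ` {0..<1})"
    by (rule bdd_aboveI2)
  then show ?thesis using d by (auto simp: H2_def disk_holomorphic_def intro!: holomorphic_intros)
qed

lemma ev_basis: "ev (basis n) = (\<lambda>z. if z \<in> ball 0 1 then z ^ n else 0)"
proof
  fix z show "ev (basis n) z = (if z \<in> ball 0 1 then z ^ n else 0)"
    unfolding ev_def disk_series_def by (subst suminf_finite[of "{n}"]) auto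
qed

lemma Hinf_subset_H2: "Hinf \<subseteq> H2"
proof
  fix \<phi> assume \<phi>: "\<phi> \<in> Hinf"
  have "(\<lambda>z. \<phi> z * ev (basis 0) z) = \<phi>"
    using \<phi> by (auto simp: ev_basis Hinf_def disk_holomorphic_def)
  then show "\<phi> \<in> H2" using Hinf_mult_H2[OF \<phi> ev_in_H2[of "basis 0"]] by simp
qed

lemma AE_radial_limit:
  assumes "f \<in> H2"
  shows "AE \<zeta> in circle_measure. ((\<lambda>r. f (of_real r * \<zeta>)) \<longlongrightarrow> boundary f \<zeta>) (at_left (1::real))"
proof -
  obtain x where "f = ev x" using H2_imp_ev[OF assms] by blast
  then show ?thesis by (simp only: AE_ev_radial_limit)
qed

lemma H2_boundary_measurable: "f \<in> H2 \<Longrightarrow> boundary f \<in> borel_measurable borel"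
  by (auto simp: H2_def intro: boundary_measurable)

lemma AE_boundary_mult:
  assumes "f \<in> H2" "g \<in> H2"
  shows "AE \<zeta> in circle_measure. boundary (\<lambda>z. f z * g z) \<zeta> = boundary f \<zeta> * boundary g \<zeta>"
  using AE_radial_limit[OF assms(1)] AE_radial_limit[OF assms(2)]
  by eventually_elim (auto intro!: boundary_eqI tendsto_mult)

lemma AE_boundary_le:
  assumes "f \<in> H2" "\<And>z. cmod z < 1 \<Longrightarrow> cmod (f z) \<le> K"
  shows "AE \<zeta> in circle_measure. cmod (boundary f \<zeta>) \<le> K"
  using AE_radial_limit[OF assms(1)] AE_circle_norm
proof eventually_elim
  case (elim \<zeta>)
  have ev: "eventually (\<lambda>r. r \<in> {0<..<1}) (at_left (1::real))" by (rule eventually_at_left_real) simp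
  show ?case
    by (rule tendsto_upperbound[OF tendsto_norm[OF elim(1)] eventually_mono[OF ev]])
      (use elim(2) in \<open>auto intro!: assms(2) simp: norm_mult trivial_limit_at_left_real\<close>)
qed

text \<open>Multiplication by \<open>\<phi>\<close> transported to coefficients; meaningful for
  \<open>\<phi>\<close> in \<open>Hinf\<close>, where the product stays in the range of
  \<open>ev\<close>.\<close>

definition mulop :: "(complex \<Rightarrow> complex) \<Rightarrow> ell2 \<Rightarrow> ell2" where
  "mulop \<phi> x = inv ev (\<lambda>z. \<phi> z * ev x z)"

lemma ev_inv: "f \<in> H2 \<Longrightarrow> ev (inv ev f) = f"
  by (simp add: H2_eq_range_ev f_inv_into_f)

lemma ev_mulop: "\<phi> \<in> Hinf \<Longrightarrow> ev (mulop \<phi> x) = (\<lambda>z. \<phi> z * ev x z)"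
  unfolding mulop_def by (intro ev_inv Hinf_mult_H2 ev_in_H2)

lemma AE_boundary_mulop:
  assumes "\<phi> \<in> Hinf"
  shows "AE \<zeta> in circle_measure. boundary (ev (mulop \<phi> x)) \<zeta> = boundary \<phi> \<zeta> * boundary (ev x) \<zeta>"
  unfolding ev_mulop[OF assms] using Hinf_subset_H2 assms by (intro AE_boundary_mult ev_in_H2) auto

text \<open>The passage from the circle to operators: pointwise inequalities between boundary moduli
  turn into inequalities between norms of products.\<close>

lemma norm_mulop_sq:
  assumes "\<phi> \<in> Hinf"
  shows "(norm (mulop \<phi> x))\<^sup>2 = (LINT \<zeta>|circle_measure. (cmod (boundary \<phi> \<zeta>))\<^sup>2 * (cmod (boundary (ev x) \<zeta>))\<^sup>2)"
    and "integrable circle_measure (\<lambda>\<zeta>. (cmod (boundary \<phi> \<zeta>))\<^sup>2 * (cmod (boundary (ev x) \<zeta>))\<^sup>2)"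
proof -
  have [measurable]: "boundary \<phi> \<in> borel_measurable borel"
    using assms Hinf_subset_H2 by (auto intro: H2_boundary_measurable)
  have eq: "AE \<zeta> in circle_measure. (cmod (boundary (ev (mulop \<phi> x)) \<zeta>))\<^sup>2 =
      (cmod (boundary \<phi> \<zeta>))\<^sup>2 * (cmod (boundary (ev x) \<zeta>))\<^sup>2"
    using AE_boundary_mulop[OF assms, of x] by eventually_elim (simp add: norm_mult power_mult_distrib)
  show "(norm (mulop \<phi> x))\<^sup>2 = (LINT \<zeta>|circle_measure. (cmod (boundary \<phi> \<zeta>))\<^sup>2 * (cmod (boundary (ev x) \<zeta>))\<^sup>2)"
    unfolding integral_boundary_sq[symmetric] by (rule integral_cong_AE) (use eq in auto)
  show "integrable circle_measure (\<lambda>\<zeta>. (cmod (boundary \<phi> \<zeta>))\<^sup>2 * (cmod (boundary (ev x) \<zeta>))\<^sup>2)"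
    by (rule integrable_cong_AE_imp[OF integrable_boundary_sq[of "mulop \<phi> x"]]) (use eq in \<open>auto simp: eq_commute\<close>)
qed

lemma norm_mulop_le:
  assumes \<phi>: "\<phi> \<in> Hinf" and K: "0 \<le> K" "\<And>z. cmod z < 1 \<Longrightarrow> cmod (\<phi> z) \<le> K"
  shows "norm (mulop \<phi> x) \<le> K * norm x"
proof -
  have "AE \<zeta> in circle_measure. cmod (boundary \<phi> \<zeta>) \<le> K"
    using \<phi> Hinf_subset_H2 by (intro AE_boundary_le K) auto
  then have "AE \<zeta> in circle_measure. (cmod (boundary \<phi> \<zeta>))\<^sup>2 * (cmod (boundary (ev x) \<zeta>))\<^sup>2 \<le>
      K\<^sup>2 * (cmod (boundary (ev x) \<zeta>))\<^sup>2"
    by eventually_elim (intro mult_right_mono power_mono; simp)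
  then have "(LINT \<zeta>|circle_measure. (cmod (boundary \<phi> \<zeta>))\<^sup>2 * (cmod (boundary (ev x) \<zeta>))\<^sup>2) \<le>
      (LINT \<zeta>|circle_measure. K\<^sup>2 * (cmod (boundary (ev x) \<zeta>))\<^sup>2)"
    by (intro integral_mono_AE norm_mulop_sq[OF \<phi>] integrable_mult_right integrable_boundary_sq)
  then have "(norm (mulop \<phi> x))\<^sup>2 \<le> (K * norm x)\<^sup>2"
    unfolding norm_mulop_sq(1)[OF \<phi>] power_mult_distrib integral_mult_right_zero integral_boundary_sq .
  then show ?thesis by (rule power2_le_imp_le) (use K(1) in simp)
qed

lemma mulop_add: "\<phi> \<in> Hinf \<Longrightarrow> mulop \<phi> (x + y) = mulop \<phi> x + mulop \<phi> y"
  by (rule injD[OF inj_ev]) (simp add: ev_mulop ev_add algebra_simps)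

lemma mulop_cscale: "\<phi> \<in> Hinf \<Longrightarrow> mulop \<phi> (cscale c x) = cscale c (mulop \<phi> x)"
  by (rule injD[OF inj_ev]) (simp add: ev_mulop ev_cscale algebra_simps)

lemma bounded_linear_mulop:
  assumes "\<phi> \<in> Hinf"
  shows "bounded_linear (mulop \<phi>)"
proof -
  obtain K where K: "0 \<le> K" "\<And>z. cmod (\<phi> z) \<le> K" using Hinf_bound[OF assms] by blast
  show ?thesis
    by (rule bounded_linear_intro[where K = K])
      (use norm_mulop_le[OF assms K] in \<open>simp_all add: mulop_add mulop_cscale assms scaleR_eq_cscale mult.commute\<close>)
qed

section \<open>Toeplitz operators with analytic and coanalytic symbols\<close>

text \<open>An element of \<open>H2\<close> is determined by its inner products with
  \<open>H2\<close>, so the definite description in \<open>riesz_projection\<close> has at most one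
  candidate, and \<open>eq\<close> says that \<open>ev w\<close> is one.\<close>

lemma riesz_projection_eqI:
  assumes [measurable]: "g \<in> borel_measurable borel"
    and g: "integrable circle_measure (\<lambda>\<zeta>. (cmod (g \<zeta>))\<^sup>2)"
    and eq: "\<And>y. L2_inner g (boundary (ev y)) = cinner w y"
  shows "riesz_projection g = ev w"
proof -
  have diff: "L2_inner (\<lambda>\<zeta>. g \<zeta> - boundary (ev x) \<zeta>) (boundary (ev y)) = cinner w y - cinner x y" for x y
  proof -
    have i: "integrable circle_measure (\<lambda>\<zeta>. g \<zeta> * cnj (boundary (ev y) \<zeta>))"
      "integrable circle_measure (\<lambda>\<zeta>. boundary (ev x) \<zeta> * cnj (boundary (ev y) \<zeta>))"
      by (auto intro!: L2_inner_integrable integrable_boundary_sq g)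
    show ?thesis
      using i H2_inner_ev[of x y] eq[of y] by (simp add: L2_inner_def H2_inner_def left_diff_distrib)
  qed
  show ?thesis unfolding riesz_projection_def
  proof (rule the_equality)
    show "ev w \<in> H2 \<and> (\<forall>k\<in>H2. L2_inner (\<lambda>\<zeta>. g \<zeta> - boundary (ev w) \<zeta>) (boundary k) = 0)"
      using ev_in_H2 by (auto simp: H2_eq_range_ev diff)
    fix h assume h: "h \<in> H2 \<and> (\<forall>k\<in>H2. L2_inner (\<lambda>\<zeta>. g \<zeta> - boundary h \<zeta>) (boundary k) = 0)"
    then obtain x where x: "h = ev x" using H2_imp_ev by blast
    have "cinner w y - cinner x y = 0" for y
      using h ev_in_H2[of y] unfolding x diff[symmetric] by blast
    then have "w = x" by (intro cinner_eqI) simp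
    then show "h = ev w" using x by simp
  qed
qed

lemma toeplitz_analytic:
  assumes \<phi>: "\<phi> \<in> Hinf"
  shows "toeplitz (boundary \<phi>) (ev x) = ev (mulop \<phi> x)"
  unfolding toeplitz_def
proof (rule riesz_projection_eqI)
  have [measurable]: "boundary \<phi> \<in> borel_measurable borel"
    using \<phi> Hinf_subset_H2 by (auto intro: H2_boundary_measurable)
  show "(\<lambda>\<zeta>. boundary \<phi> \<zeta> * boundary (ev x) \<zeta>) \<in> borel_measurable borel" by measurable
  show "integrable circle_measure (\<lambda>\<zeta>. (cmod (boundary \<phi> \<zeta> * boundary (ev x) \<zeta>))\<^sup>2)"
    using norm_mulop_sq(2)[OF \<phi>] by (simp add: norm_mult power_mult_distrib)
  show "L2_inner (\<lambda>\<zeta>. boundary \<phi> \<zeta> * boundary (ev x) \<zeta>) (boundary (ev y)) = cinner (mulop \<phi> x) y" for y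
    unfolding H2_inner_ev[symmetric] H2_inner_def L2_inner_def
    by (rule integral_cong_AE) (use AE_boundary_mulop[OF \<phi>, of x] in \<open>auto elim: eventually_mono\<close>)
qed

text \<open>Moving cnj \<phi> to the other factor of the integral shows that this Toeplitz operator
  acts as the adjoint of multiplication by \<open>\<phi>\<close>.\<close>

lemma toeplitz_coanalytic:
  assumes \<phi>: "\<phi> \<in> Hinf" and w: "\<And>y. cinner (mulop \<phi> y) x = cinner y w"
  shows "toeplitz (\<lambda>\<zeta>. cnj (boundary \<phi> \<zeta>)) (ev x) = ev w"
  unfolding toeplitz_def
proof (rule riesz_projection_eqI)
  have [measurable]: "boundary \<phi> \<in> borel_measurable borel"
    using \<phi> Hinf_subset_H2 by (auto intro: H2_boundary_measurable)
  show "(\<lambda>\<zeta>. cnj (boundary \<phi> \<zeta>) * boundary (ev x) \<zeta>) \<in> borel_measurable borel" by measurable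
  show "integrable circle_measure (\<lambda>\<zeta>. (cmod (cnj (boundary \<phi> \<zeta>) * boundary (ev x) \<zeta>))\<^sup>2)"
    using norm_mulop_sq(2)[OF \<phi>] by (simp add: norm_mult power_mult_distrib)
  show "L2_inner (\<lambda>\<zeta>. cnj (boundary \<phi> \<zeta>) * boundary (ev x) \<zeta>) (boundary (ev y)) = cinner w y" for y
  proof -
    have "L2_inner (\<lambda>\<zeta>. cnj (boundary \<phi> \<zeta>) * boundary (ev x) \<zeta>) (boundary (ev y)) = cinner x (mulop \<phi> y)"
      unfolding H2_inner_ev[symmetric] H2_inner_def L2_inner_def
      by (rule integral_cong_AE) (use AE_boundary_mulop[OF \<phi>, of y] in \<open>auto elim: eventually_mono\<close>)
    also have "\<dots> = cnj (cinner (mulop \<phi> y) x)" by (rule cinner_commute)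
    also have "\<dots> = cinner w y" unfolding w by (rule cinner_commute[symmetric])
    finally show ?thesis .
  qed
qed

lemma inner_cscale_i: "inner (cscale \<i> x) y = - inner x (cscale \<i> y)"
  by (simp add: inner_eq_Re_cinner cinner_scale_left cinner_scale_right)

lemma Im_cinner_self_adjoint:
  assumes "\<And>x y. inner (T x) y = inner x (T y)" "\<And>x. T (cscale \<i> x) = cscale \<i> (T x)"
  shows "cinner (T x) x = of_real (inner (T x) x)"
proof -
  have "inner (T x) (cscale \<i> x) = inner x (cscale \<i> (T x))" using assms by simp
  also have "\<dots> = - inner (cscale \<i> x) (T x)" by (simp add: inner_cscale_i)
  also have "\<dots> = - inner (T x) (cscale \<i> x)" by (simp add: inner_commute)
  finally have "inner (T x) (cscale \<i> x) = 0" by simp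
  then show ?thesis by (simp add: cinner_eq_inner complex_eq_iff)
qed

text \<open>A real form means \<open>inner (T u) (cscale \<i> u) = 0\<close>. Polarising, and
  inserting i x for one of the vectors, gives symmetry. It is applied to competitors for the square
  root, of which \<open>positive_operator\<close> only says that the form is real and
  nonnegative.\<close>

lemma real_form_imp_self_adjoint:
  assumes T: "bounded_linear T" and Ti: "\<And>x. T (cscale \<i> x) = cscale \<i> (T x)"
    and real: "\<And>x. cinner (T x) x \<in> \<real>"
  shows "inner (T x) y = inner x (T y)"
proof -
  interpret T: bounded_linear T by (rule T)
  have 0: "inner (T u) (cscale \<i> u) = 0" for u
    using real[of u] by (simp add: cinner_eq_inner complex_is_Real_iff)
  have 1: "inner (T u) (cscale \<i> v) + inner (T v) (cscale \<i> u) = 0" for u v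
    using 0[of "u + v"] by (simp add: T.add cscale_add inner_add_left inner_add_right 0)
  have ii: "cscale \<i> (cscale \<i> x) = - x"
    by (rule coef_eqI) (simp flip: mult.assoc)
  have "inner (T (cscale \<i> x)) (cscale \<i> y) + inner (T y) (cscale \<i> (cscale \<i> x)) = 0" by (rule 1)
  then have "inner (cscale \<i> (T x)) (cscale \<i> y) = inner (T y) x" unfolding ii Ti by simp
  moreover have "inner (cscale \<i> (T x)) (cscale \<i> y) = inner (T x) y"
    by (simp add: inner_eq_Re_cinner cinner_scale_left cinner_scale_right)
  ultimately show ?thesis by (simp add: inner_commute)
qed

section \<open>The square root of the defect operator\<close>

text \<open>Existence is the root on \<open>ell2\<close> carried over by \<open>ev\<close>. For
  uniqueness, which the definite description demands, a competitor is carried back to a bounded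
  operator on \<open>ell2\<close> and shown to satisfy the hypotheses of
  \<open>positive_sqrt_unique\<close>.\<close>

lemma sqrt_operator_ev:
  fixes X :: "ell2 \<Rightarrow>\<^sub>L ell2"
  assumes X: "self_adjoint X" "norm X \<le> 1" and Xc: "\<And>c x. X (cscale c x) = cscale c (X x)"
    and A: "\<And>x. A (ev x) = ev (x - X x)"
  obtains S :: "ell2 \<Rightarrow>\<^sub>L ell2" where "self_adjoint S" "\<And>x. S (S x) = x - X x"
    "\<And>c x. S (cscale c x) = cscale c (S x)" "\<And>x. sqrt_operator A (ev x) = ev (S x)"
proof -
  obtain S :: "ell2 \<Rightarrow>\<^sub>L ell2" where S: "self_adjoint S" "\<And>x. 0 \<le> inner (S x) x" "\<And>x. S (S x) = x - X x"
    and comm: "\<And>T. X o\<^sub>L T = T o\<^sub>L X \<Longrightarrow> S o\<^sub>L T = T o\<^sub>L S"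
    using positive_sqrt_exists[OF X] by blast
  \<comment> \<open>Scaling by c is a bounded real-linear operator commuting with X, hence with the
    root.\<close>
  have Sc: "S (cscale c x) = cscale c (S x)" for c x
  proof -
    have C: "blinfun_apply (Blinfun (cscale c)) = cscale c"
      by (rule bounded_linear_Blinfun_apply[OF bounded_linear_cscale])
    have "X o\<^sub>L Blinfun (cscale c) = Blinfun (cscale c) o\<^sub>L X"
      by (rule blinfun_eqI) (simp add: C Xc)
    from arg_cong[OF comm[OF this], of "\<lambda>T. blinfun_apply T x"] show ?thesis by (simp add: C)
  qed
  define S0 where "S0 f = (if f \<in> H2 then ev (S (inv ev f)) else (\<lambda>z. 0))" for f
  have inv_ev: "inv ev (ev x) = x" for x by (rule inv_f_f[OF inj_ev])
  have S0: "S0 (ev x) = ev (S x)" for x by (simp add: S0_def ev_in_H2 inv_ev)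
  have evs: "(\<lambda>z. ev x z + ev y z) = ev (x + y)" "(\<lambda>z. c * ev x z) = ev (cscale c x)" for x y c
    by (simp_all add: ev_add ev_cscale)
  have H2_ball: "(\<forall>f\<in>H2. P f) \<longleftrightarrow> (\<forall>x. P (ev x))" for P
    by (simp add: H2_eq_range_ev)
  have S0_props: "positive_operator S0 \<and> (\<forall>f\<in>H2. S0 (S0 f) = A f) \<and> (\<forall>f. f \<notin> H2 \<longrightarrow> S0 f = (\<lambda>z. 0))"
    unfolding positive_operator_def bounded_operator_def H2_ball
  proof (intro conjI allI impI)
    show "S0 (ev x) \<in> H2" for x by (simp add: S0 ev_in_H2)
    show "S0 (\<lambda>z. ev x z + ev y z) = (\<lambda>z. S0 (ev x) z + S0 (ev y) z)" for x y
      by (simp only: evs S0 blinfun.add_right)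
    show "S0 (\<lambda>z. c * ev x z) = (\<lambda>z. c * S0 (ev x) z)" for c x
      by (simp only: evs S0 Sc)
    show "\<exists>K. \<forall>x. H2_norm (S0 (ev x)) \<le> K * H2_norm (ev x)"
      by (intro exI[of _ "norm S"]) (simp add: S0 H2_norm_ev norm_blinfun)
    have c: "cinner (S x) x = of_real (inner (S x) x)" for x
      using S(1) Sc by (intro Im_cinner_self_adjoint) (auto simp: self_adjoint_def)
    show "H2_inner (S0 (ev x)) (ev x) \<in> \<real>" for x by (simp add: S0 H2_inner_ev c)
    show "0 \<le> Re (H2_inner (S0 (ev x)) (ev x))" for x by (simp add: S0 H2_inner_ev c S(2))
    show "S0 (S0 (ev x)) = A (ev x)" for x by (simp add: S0 S(3) A)
    show "S0 f = (\<lambda>z. 0)" if "f \<notin> H2" for f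
      using that by (simp add: S0_def)
  qed
  have "sqrt_operator A = S0"
    unfolding sqrt_operator_def
  proof (rule the_equality, rule S0_props)
    fix T assume T: "positive_operator T \<and> (\<forall>f\<in>H2. T (T f) = A f) \<and> (\<forall>f. f \<notin> H2 \<longrightarrow> T f = (\<lambda>z. 0))"
    then have TH: "T f \<in> H2" if "f \<in> H2" for f
      using that by (auto simp: positive_operator_def bounded_operator_def)
    define T' where "T' x = inv ev (T (ev x))" for x
    have T': "T (ev x) = ev (T' x)" for x
      unfolding T'_def by (simp add: ev_inv TH ev_in_H2)
    have T'_add: "T' (x + y) = T' x + T' y" for x y
    proof (rule injD[OF inj_ev])
      have "T (\<lambda>z. ev x z + ev y z) = (\<lambda>z. T (ev x) z + T (ev y) z)"
        using T ev_in_H2 by (simp add: positive_operator_def bounded_operator_def)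
      then show "ev (T' (x + y)) = ev (T' x + T' y)" by (simp only: evs T')
    qed
    have T'_scale: "T' (cscale c x) = cscale c (T' x)" for c x
    proof (rule injD[OF inj_ev])
      have "T (\<lambda>z. c * ev x z) = (\<lambda>z. c * T (ev x) z)"
        using T ev_in_H2 by (simp add: positive_operator_def bounded_operator_def)
      then show "ev (T' (cscale c x)) = ev (cscale c (T' x))" by (simp only: evs T')
    qed
    obtain K where K: "\<forall>f\<in>H2. H2_norm (T f) \<le> K * H2_norm f"
      using T by (auto simp: positive_operator_def bounded_operator_def)
    have T'_bound: "norm (T' x) \<le> norm x * K" for x
      using K ev_in_H2[of x] by (metis H2_norm_ev T' mult.commute)
    have lin: "bounded_linear T'"
      by (rule bounded_linear_intro[OF _ _ T'_bound]) (simp_all add: T'_add scaleR_eq_cscale T'_scale)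
    define TB where "TB = Blinfun T'"
    have TB: "blinfun_apply TB = T'" unfolding TB_def by (rule bounded_linear_Blinfun_apply[OF lin])
    have form: "cinner (T' x) x \<in> \<real> \<and> 0 \<le> Re (cinner (T' x) x)" for x
      using T ev_in_H2[of x] unfolding positive_operator_def by (metis T' H2_inner_ev)
    have TB1: "self_adjoint TB"
      unfolding self_adjoint_def TB using form
      by (intro allI real_form_imp_self_adjoint[OF lin T'_scale]) blast
    have TB2: "0 \<le> inner (TB x) x" for x
      using form by (simp add: TB inner_eq_Re_cinner)
    have sq: "T' (T' x) = x - X x" for x
    proof (rule injD[OF inj_ev])
      show "ev (T' (T' x)) = ev (x - X x)"
        using T ev_in_H2[of x] by (metis A T')
    qed
    \<comment> \<open>X = I - T'^2 commutes with T', and the constructed root commutes with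
      everything that commutes with X.\<close>
    have TB3: "S o\<^sub>L TB = TB o\<^sub>L S"
    proof (rule comm, rule blinfun_eqI)
      fix x
      have "T' x - X (T' x) = T' (x - X x)" using sq[of "T' x"] sq[of x] by simp
      also have "\<dots> = T' x - T' (X x)" using bounded_linear.linear[OF lin] by (rule linear_diff)
      finally show "(X o\<^sub>L TB) x = (TB o\<^sub>L X) x" by (simp add: TB)
    qed
    have "S = TB"
      by (rule positive_sqrt_unique[OF S(1,2) TB1 TB2 _ TB3]) (simp add: TB S(3) sq)
    then have ST: "T' x = S x" for x by (simp add: TB)
    show "T = S0"
    proof
      fix f show "T f = S0 f"
      proof (cases "f \<in> H2")
        case True
        then obtain x where "f = ev x" using H2_imp_ev by blast
        then show ?thesis by (simp add: T' S0 ST)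
      next
        case False
        then show ?thesis using T by (simp add: S0_def)
      qed
    qed
  qed
  then show ?thesis using that[OF S(1,3) Sc] S0 by simp
qed

text \<open>The Toeplitz operator with symbol cnj \<phi>, encoded as the adjoint of multiplication
  by \<open>\<phi>\<close>. The norm clause belongs to the choice so that every bound of
  \<open>\<phi>\<close> on the disk bounds the operator.\<close>

definition coanalytic :: "(complex \<Rightarrow> complex) \<Rightarrow> ell2 \<Rightarrow>\<^sub>L ell2" where
  "coanalytic \<phi> = (SOME T. (\<forall>x y. cinner (mulop \<phi> x) y = cinner x (blinfun_apply T y)) \<and>
     (\<forall>K\<ge>0. (\<forall>z. cmod z < 1 \<longrightarrow> cmod (\<phi> z) \<le> K) \<longrightarrow> norm T \<le> K))"

lemma
  assumes \<phi>: "\<phi> \<in> Hinf"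
  shows cinner_coanalytic: "cinner (mulop \<phi> x) y = cinner x (coanalytic \<phi> y)"
    and norm_coanalytic_le: "0 \<le> K \<Longrightarrow> (\<And>z. cmod z < 1 \<Longrightarrow> cmod (\<phi> z) \<le> K) \<Longrightarrow> norm (coanalytic \<phi>) \<le> K"
proof -
  have M: "blinfun_apply (Blinfun (mulop \<phi>)) = mulop \<phi>"
    by (rule bounded_linear_Blinfun_apply[OF bounded_linear_mulop[OF \<phi>]])
  obtain T :: "ell2 \<Rightarrow>\<^sub>L ell2" where T: "\<And>x y. inner (Blinfun (mulop \<phi>) x) y = inner x (T y)"
    "norm T \<le> norm (Blinfun (mulop \<phi>))"
    using adjoint_exists by blast
  have "norm T \<le> K" if "0 \<le> K" "\<forall>z. cmod z < 1 \<longrightarrow> cmod (\<phi> z) \<le> K" for K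
  proof -
    have "norm (Blinfun (mulop \<phi>)) \<le> K"
      using that norm_mulop_le[OF \<phi>] by (intro norm_blinfun_bound) (auto simp: M)
    then show ?thesis using T(2) by simp
  qed
  moreover have "cinner (mulop \<phi> x) y = cinner x (T y)" for x y
    using T(1) by (intro complex_adjoint) (auto simp: M mulop_cscale[OF \<phi>])
  ultimately have "\<exists>T. (\<forall>x y. cinner (mulop \<phi> x) y = cinner x (blinfun_apply T y)) \<and>
     (\<forall>K\<ge>0. (\<forall>z. cmod z < 1 \<longrightarrow> cmod (\<phi> z) \<le> K) \<longrightarrow> norm T \<le> K)"
    by blast
  from someI_ex[OF this] show "cinner (mulop \<phi> x) y = cinner x (coanalytic \<phi> y)"
    "0 \<le> K \<Longrightarrow> (\<And>z. cmod z < 1 \<Longrightarrow> cmod (\<phi> z) \<le> K) \<Longrightarrow> norm (coanalytic \<phi>) \<le> K"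
    unfolding coanalytic_def[symmetric] by blast+
qed

lemma coanalytic_cscale:
  assumes "\<phi> \<in> Hinf"
  shows "coanalytic \<phi> (cscale c x) = cscale c (coanalytic \<phi> x)"
proof -
  have "cinner y (coanalytic \<phi> (cscale c x)) = cinner y (cscale c (coanalytic \<phi> x))" for y
    by (simp add: cinner_coanalytic[OF assms, symmetric] cinner_scale_right)
  then show ?thesis by (intro cinner_eqI) (metis cinner_commute)
qed

lemma Hinf_unit_ball_le_1:
  assumes "b \<in> Hinf_unit_ball"
  shows "b \<in> Hinf" "cmod z < 1 \<Longrightarrow> cmod (b z) \<le> 1"
proof -
  show b: "b \<in> Hinf" using assms by (simp add: Hinf_unit_ball_def)
  assume z: "cmod z < 1"
  have "bdd_above ((\<lambda>z. cmod (b z)) ` ball 0 1)"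
    using Hinf_bound[OF b] by (metis bdd_aboveI2)
  then have "cmod (b z) \<le> Hinf_norm b"
    unfolding Hinf_norm_def using z by (intro cSUP_upper) auto
  then show "cmod (b z) \<le> 1" using assms by (simp add: Hinf_unit_ball_def)
qed

text \<open>On coefficients the product of the two Toeplitz operators is X = M M*, with M
  multiplication by b. Since M is a contraction, X is self-adjoint of norm at most 1, as the square
  root construction asks.\<close>

lemma defect_root_ev:
  assumes b: "b \<in> Hinf_unit_ball"
  obtains D :: "ell2 \<Rightarrow>\<^sub>L ell2" where "\<And>x y. inner (D x) y = inner x (D y)"
    "\<And>x. D (D x) = x - mulop b (coanalytic b x)"
    "\<And>c x. D (cscale c x) = cscale c (D x)" "\<And>x. defect_root b (ev x) = ev (D x)"
proof -
  have bH: "b \<in> Hinf" and b1: "\<And>z. cmod z < 1 \<Longrightarrow> cmod (b z) \<le> 1"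
    using Hinf_unit_ball_le_1[OF b] by auto
  define M where "M = Blinfun (mulop b)"
  have M: "blinfun_apply M = mulop b"
    unfolding M_def by (rule bounded_linear_Blinfun_apply[OF bounded_linear_mulop[OF bH]])
  define X where "X = M o\<^sub>L coanalytic b"
  have X: "X x = mulop b (coanalytic b x)" for x by (simp add: X_def M)
  have adj: "inner (mulop b x) y = inner x (coanalytic b y)" for x y
    by (simp add: inner_eq_Re_cinner cinner_coanalytic[OF bH])
  have "norm M \<le> 1" using norm_mulop_le[OF bH _ b1] by (intro norm_blinfun_bound) (auto simp: M)
  moreover have "norm (coanalytic b) \<le> 1" by (rule norm_coanalytic_le[OF bH _ b1]) auto
  ultimately have X1: "norm X \<le> 1"
    unfolding X_def using norm_blinfun_compose[of M "coanalytic b"] mult_mono[of "norm M" 1 "norm (coanalytic b)" 1] by simp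
  have X2: "self_adjoint X"
    unfolding self_adjoint_def X by (metis adj inner_commute)
  have X3: "X (cscale c x) = cscale c (X x)" for c x
    by (simp add: X coanalytic_cscale[OF bH] mulop_cscale[OF bH])
  define A where "A f z = f z - toeplitz (boundary b) (toeplitz (\<lambda>\<zeta>. cnj (boundary b \<zeta>)) f) z" for f z
  have X4: "A (ev x) = ev (x - X x)" for x
    unfolding A_def by (simp add: X ev_diff toeplitz_analytic[OF bH] toeplitz_coanalytic[OF bH cinner_coanalytic[OF bH]])
  have root: "defect_root b = sqrt_operator A"
    by (simp add: defect_root_def A_def[abs_def])
  obtain S :: "ell2 \<Rightarrow>\<^sub>L ell2" where S: "self_adjoint S" "\<And>x. S (S x) = x - X x"
    "\<And>c x. S (cscale c x) = cscale c (S x)" "\<And>x. sqrt_operator A (ev x) = ev (S x)"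
    using sqrt_operator_ev[OF X2 X1 X3 X4] by blast
  show ?thesis using that[of S] S unfolding self_adjoint_def X root by blast
qed

section \<open>Outer functions\<close>

lemma ev_zero: "ev x 0 = coef x 0"
  using sums_unique2[OF ev_sums[of 0 x] powser_sums_zero] by simp

lemma ev_shift: "ev (shift k x) z = z ^ k * ev x z"
proof (cases "cmod z < 1")
  case True
  have "(\<lambda>n. coef (shift k x) (n + k) * z ^ (n + k)) sums (z ^ k * ev x z)"
    using sums_mult[OF ev_sums[OF True, of x], of "z ^ k"] by (simp add: coef_shift power_add mult_ac)
  then have "(\<lambda>n. coef (shift k x) n * z ^ n) sums (z ^ k * ev x z)"
    by (subst (asm) sums_zero_iff_shift) (auto simp: coef_shift)
  then show ?thesis using sums_unique2 ev_sums[OF True] by blast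
qed (simp add: ev_outside)

text \<open>E = exp G with G the Herglotz integral of \<open>u\<close>, so |E| is the exponential of
  the Poisson integral of \<open>u\<close>. The one-sided bound keeps E bounded even if
  \<open>u\<close> is unbounded below, as logarithms are. Fatou's theorem gives the boundary
  modulus, and the kernel at z = 0 being 1 gives E(0).\<close>

lemma exponential_of_Poisson_integral:
  fixes u :: "complex \<Rightarrow> real"
  assumes u: "integrable circle_measure u" and K: "AE \<zeta> in circle_measure. u \<zeta> \<le> K"
  obtains E where "E \<in> Hinf" "\<And>z. cmod z < 1 \<Longrightarrow> cmod (E z) \<le> exp K"
    "E 0 = of_real (exp (LINT \<zeta>|circle_measure. u \<zeta>))"
    "AE \<zeta> in circle_measure. cmod (boundary E \<zeta>) = exp (u \<zeta>)"
proof -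
  have [measurable]: "u \<in> borel_measurable borel" using borel_measurable_integrable[OF u] by simp
  define U where "U \<zeta> = complex_of_real (u \<zeta>)" for \<zeta>
  have U: "integrable circle_measure U" using u by (simp add: U_def[abs_def])
  define c where "c n = herglotz_coeff n * (LINT \<zeta>|circle_measure. cnj \<zeta> ^ n * U \<zeta>)" for n
  define B where "B = (LINT \<zeta>|circle_measure. cmod (U \<zeta>))"
  have cB: "cmod (c n) \<le> 2 * B" for n
  proof -
    have "cmod (LINT \<zeta>|circle_measure. cnj \<zeta> ^ n * U \<zeta>) \<le> (LINT \<zeta>|circle_measure. cmod (cnj \<zeta> ^ n * U \<zeta>))"
      by (rule integral_norm_bound)
    also have "\<dots> = B" unfolding B_def
      by (rule integral_cong_AE) (use AE_circle_norm in \<open>auto elim!: eventually_mono simp: norm_mult norm_power U_def\<close>)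
    finally have le: "cmod (LINT \<zeta>|circle_measure. cnj \<zeta> ^ n * U \<zeta>) \<le> B" .
    have "cmod (herglotz_coeff n) \<le> 2" by (simp add: herglotz_coeff_def)
    then show ?thesis unfolding c_def norm_mult using le by (intro mult_mono) auto
  qed
  define G where "G = disk_series c"
  have Gd: "G \<in> disk_holomorphic" unfolding G_def by (rule disk_series_holomorphic[OF cB])
  have GH: "G z = (LINT \<zeta>|circle_measure. (\<zeta> + z) / (\<zeta> - z) * U \<zeta>)" if z: "cmod z < 1" for z
  proof -
    have "(\<lambda>n. c n * z ^ n) sums G z" unfolding G_def by (rule disk_series_sums[OF cB z])
    moreover have "(\<lambda>n. c n * z ^ n) sums (LINT \<zeta>|circle_measure. (\<zeta> + z) / (\<zeta> - z) * U \<zeta>)"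
      using integral_herglotz_sums(2)[OF U z] by (simp add: c_def mult_ac)
    ultimately show ?thesis by (rule sums_unique2)
  qed
  have ReG: "Re (G z) = (LINT \<zeta>|circle_measure. poisson z \<zeta> * u \<zeta>)" if z: "cmod z < 1" for z
  proof -
    have "Re (G z) = (LINT \<zeta>|circle_measure. Re ((\<zeta> + z) / (\<zeta> - z) * U \<zeta>))"
      unfolding GH[OF z] by (rule integral_Re[symmetric], rule integral_herglotz_sums(1)[OF U z])
    also have "\<dots> = (LINT \<zeta>|circle_measure. poisson z \<zeta> * u \<zeta>)"
    proof (rule integral_cong_AE)
      show "AE \<zeta> in circle_measure. Re ((\<zeta> + z) / (\<zeta> - z) * U \<zeta>) = poisson z \<zeta> * u \<zeta>"
        using AE_circle_norm
      proof eventually_elim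
        case (elim \<zeta>)
        have "Re ((\<zeta> + z) / (\<zeta> - z) * U \<zeta>) = Re ((\<zeta> + z) / (\<zeta> - z)) * u \<zeta>"
          unfolding U_def by (simp only: times_complex.sel Re_complex_of_real Im_complex_of_real mult_zero_right diff_zero)
        then show ?case using Re_herglotz_kernel[OF elim z] by simp
      qed
    qed (auto simp: U_def)
    finally show ?thesis .
  qed
  have ip: "integrable circle_measure (\<lambda>\<zeta>. poisson z \<zeta> * v \<zeta>)" if z: "cmod z < 1" and v: "integrable circle_measure v"
    for z and v :: "complex \<Rightarrow> real"
  proof -
    have "integrable circle_measure (\<lambda>\<zeta>. Re (poisson z \<zeta> *\<^sub>R complex_of_real (v \<zeta>)))"
      using v by (intro integrable_Re integrable_poisson_mult z) simp
    then show ?thesis by simp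
  qed
  have ReG_le: "Re (G z) \<le> K" if z: "cmod z < 1" for z
  proof -
    have "Re (G z) \<le> (LINT \<zeta>|circle_measure. poisson z \<zeta> * K)"
      unfolding ReG[OF z] using K
      by (intro integral_mono_AE ip z u) (auto elim!: eventually_mono intro!: mult_left_mono poisson_nonneg z)
    then show ?thesis using integral_poisson[OF z] by simp
  qed
  have ReG0: "G 0 = of_real (LINT \<zeta>|circle_measure. u \<zeta>)"
  proof -
    have "G 0 = (LINT \<zeta>|circle_measure. (\<zeta> + 0) / (\<zeta> - 0) * U \<zeta>)" by (rule GH) simp
    also have "\<dots> = (LINT \<zeta>|circle_measure. U \<zeta>)"
    proof (rule integral_cong_AE)
      show "AE \<zeta> in circle_measure. (\<zeta> + 0) / (\<zeta> - 0) * U \<zeta> = U \<zeta>"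
        using AE_circle_norm by eventually_elim auto
    qed (auto simp: U_def)
    also have "\<dots> = of_real (LINT \<zeta>|circle_measure. u \<zeta>)"
      unfolding U_def by (rule integral_of_real[OF u])
    finally show ?thesis .
  qed
  define E where "E z = (if z \<in> ball 0 1 then exp (G z) else 0)" for z
  have E: "E z = exp (G z)" "cmod (E z) = exp (Re (G z))" if "cmod z < 1" for z
    using that by (simp_all add: E_def)
  have "(\<lambda>z. exp (G z)) holomorphic_on ball 0 1"
    using Gd by (auto simp: disk_holomorphic_def intro!: holomorphic_intros)
  then have "E holomorphic_on ball 0 1"
    by (rule holomorphic_transform) (simp add: E_def)
  then have Ed: "E \<in> disk_holomorphic"
    unfolding disk_holomorphic_def by (auto simp: E_def)
  have Ebd: "cmod (E z) \<le> exp K" if "cmod z < 1" for z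
    using ReG_le[OF that] by (simp add: E(2)[OF that])
  have EH: "E \<in> Hinf" by (rule HinfI[OF Ed Ebd])
  have "AE \<zeta> in circle_measure. cmod (boundary E \<zeta>) = exp (u \<zeta>)"
    using Fatou_poisson[OF U] AE_radial_limit[OF subsetD[OF Hinf_subset_H2 EH]] AE_circle_norm
  proof eventually_elim
    case (elim \<zeta>)
    have "((\<lambda>r. exp (Re (LINT \<eta>|circle_measure. poisson (of_real r * \<zeta>) \<eta> *\<^sub>R U \<eta>))) \<longlongrightarrow> exp (Re (U \<zeta>))) (at_left (1::real))"
      by (intro tendsto_intros elim)
    moreover have "eventually (\<lambda>r. r \<in> {0<..<1}) (at_left (1::real))" by (rule eventually_at_left_real) simp
    then have "eventually (\<lambda>r. exp (Re (LINT \<eta>|circle_measure. poisson (of_real r * \<zeta>) \<eta> *\<^sub>R U \<eta>)) = cmod (E (of_real r * \<zeta>))) (at_left 1)"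
    proof eventually_elim
      case (elim r)
      then have z: "cmod (of_real r * \<zeta>) < 1" using \<open>cmod \<zeta> = 1\<close> by (simp add: norm_mult)
      have "(LINT \<eta>|circle_measure. poisson (of_real r * \<zeta>) \<eta> *\<^sub>R U \<eta>) = of_real (LINT \<eta>|circle_measure. poisson (of_real r * \<zeta>) \<eta> * u \<eta>)"
        unfolding U_def integral_of_real[OF ip[OF z u], symmetric] by (simp add: scaleR_conv_of_real)
      then show ?case unfolding E(2)[OF z] ReG[OF z] by simp
    qed
    ultimately have "((\<lambda>r. cmod (E (of_real r * \<zeta>))) \<longlongrightarrow> exp (Re (U \<zeta>))) (at_left (1::real))"
      by (rule Lim_transform_eventually)
    from tendsto_unique[OF _ tendsto_norm[OF elim(2)] this] show ?case
      by (simp add: U_def trivial_limit_at_left_real)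
  qed
  then show ?thesis
    using that[of E] EH Ebd E(1)[of 0] by (simp add: ReG0 exp_of_real)
qed

section \<open>Logarithmic integrability and outer cut-offs\<close>

lemma norm_ev_le_of_boundary:
  assumes "AE \<zeta> in circle_measure. cmod (boundary (ev x) \<zeta>) \<le> 1"
  shows "norm x \<le> 1"
proof -
  have "(norm x)\<^sup>2 \<le> (LINT \<zeta>|circle_measure. 1)"
    unfolding integral_boundary_sq[symmetric] using assms
    by (intro integral_mono_AE integrable_boundary_sq) (auto elim!: eventually_mono simp: power_le_one)
  then have "(norm x)\<^sup>2 \<le> 1\<^sup>2" by simp
  then show ?thesis by (rule power2_le_imp_le) simp
qed

text \<open>
  Dividing \<open>ev x\<close> by an exponential with boundary modulus \<open>max \<bar>ev x\<bar> e\<^sup>-\<^sup>m\<close> leaves a function bounded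
  by 1 on the circle, hence of modulus at most 1 at the origin.
\<close>

lemma log_boundary_integrable:
  assumes h0: "coef x 0 \<noteq> 0" and h1: "AE \<zeta> in circle_measure. cmod (boundary (ev x) \<zeta>) \<le> 1"
  shows "AE \<zeta> in circle_measure. boundary (ev x) \<zeta> \<noteq> 0"
    and "integrable circle_measure (\<lambda>\<zeta>. ln (cmod (boundary (ev x) \<zeta>)))"
proof -
  define \<eta> where "\<eta> \<zeta> = cmod (boundary (ev x) \<zeta>)" for \<zeta>
  have [measurable]: "\<eta> \<in> borel_measurable borel" unfolding \<eta>_def by measurable
  have \<eta>: "AE \<zeta> in circle_measure. 0 \<le> \<eta> \<zeta> \<and> \<eta> \<zeta> \<le> 1" using h1 by (simp add: \<eta>_def)
  \<comment> \<open>The zeros of \<open>\<eta>\<close> are treated separately because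
    \<open>ln\<close> is total and not infinite there; the value m makes the truncations grow to
    infinity on the zero set.\<close>
  define v where "v m \<zeta> = (if \<eta> \<zeta> = 0 then real m else min (- ln (\<eta> \<zeta>)) (real m))" for m \<zeta>
  have [measurable]: "v m \<in> borel_measurable borel" for m unfolding v_def by measurable
  have vbd: "AE \<zeta> in circle_measure. 0 \<le> v m \<zeta> \<and> v m \<zeta> \<le> real m" for m
    using \<eta> by eventually_elim (auto simp: v_def ln_le_zero_iff)
  have vi: "integrable circle_measure (v m)" for m
  proof (rule circle_integrable_bounded)
    show "AE \<zeta> in circle_measure. norm (v m \<zeta>) \<le> real m" using vbd[of m] by eventually_elim simp
  qed measurable
  \<comment> \<open>The estimate |E(0)| |\<open>coef x 0\<close>| \<le> 1 read in logarithms; it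
    does not depend on m.\<close>
  define C where "C = - ln (cmod (coef x 0))"
  have vC: "(LINT \<zeta>|circle_measure. v m \<zeta>) \<le> C" for m
  proof -
    have "AE \<zeta> in circle_measure. v m \<zeta> \<le> real m" using vbd[of m] by eventually_elim simp
    from exponential_of_Poisson_integral[OF vi this] obtain E where E: "E \<in> Hinf"
      "E 0 = of_real (exp (LINT \<zeta>|circle_measure. v m \<zeta>))"
      "AE \<zeta> in circle_measure. cmod (boundary E \<zeta>) = exp (v m \<zeta>)" by metis
    have "AE \<zeta> in circle_measure. cmod (boundary (ev (mulop E x)) \<zeta>) \<le> 1"
      using AE_boundary_mulop[OF E(1), of x] E(3) \<eta>
    proof eventually_elim
      case (elim \<zeta>)
      have "exp (v m \<zeta>) * \<eta> \<zeta> \<le> 1"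
      proof (cases "\<eta> \<zeta> = 0")
        case False
        then have p: "0 < \<eta> \<zeta>" using elim by simp
        have "exp (v m \<zeta>) \<le> exp (- ln (\<eta> \<zeta>))" using False by (simp add: v_def)
        also have "\<dots> = 1 / \<eta> \<zeta>" using p by (simp add: exp_minus inverse_eq_divide)
        finally show ?thesis using p by (simp add: field_simps)
      qed simp
      then show ?case using elim by (simp add: norm_mult \<eta>_def)
    qed
    then have "norm (mulop E x) \<le> 1" by (rule norm_ev_le_of_boundary)
    then have "cmod (coef (mulop E x) 0) \<le> 1" using norm_coef_le order_trans by blast
    also have "coef (mulop E x) 0 = E 0 * coef x 0"
      using ev_mulop[OF E(1), of x] by (metis ev_zero)
    finally have "exp (LINT \<zeta>|circle_measure. v m \<zeta>) * cmod (coef x 0) \<le> 1" by (simp add: E(2) norm_mult)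
    then have "exp (LINT \<zeta>|circle_measure. v m \<zeta>) \<le> exp C"
      using h0 by (simp add: C_def exp_minus field_simps)
    then show ?thesis by simp
  qed
  have "(\<integral>\<^sup>+\<zeta>. liminf (\<lambda>m. ennreal (v m \<zeta>)) \<partial>circle_measure) \<le> liminf (\<lambda>m. \<integral>\<^sup>+\<zeta>. ennreal (v m \<zeta>) \<partial>circle_measure)"
    by (rule nn_integral_liminf) measurable
  also have "\<dots> \<le> ennreal C"
  proof (rule Liminf_le)
    have "(\<integral>\<^sup>+\<zeta>. ennreal (v m \<zeta>) \<partial>circle_measure) = ennreal (LINT \<zeta>|circle_measure. v m \<zeta>)" for m
      by (rule nn_integral_eq_integral[OF vi]) (use vbd in \<open>auto elim!: eventually_mono\<close>)
    then show "\<forall>\<^sub>F m in sequentially. (\<integral>\<^sup>+\<zeta>. ennreal (v m \<zeta>) \<partial>circle_measure) \<le> ennreal C"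
      using vC by (simp add: ennreal_leI)
  qed simp
  \<comment> \<open>This bound does double duty: the limit inferior is infinite at the zeros of
    \<open>\<eta>\<close>, which are therefore negligible, and elsewhere it is minus the logarithm,
    which is therefore integrable.\<close>
  finally have nn: "(\<integral>\<^sup>+\<zeta>. liminf (\<lambda>m. ennreal (v m \<zeta>)) \<partial>circle_measure) \<le> ennreal C" .
  then have "(\<integral>\<^sup>+\<zeta>. liminf (\<lambda>m. ennreal (v m \<zeta>)) \<partial>circle_measure) \<noteq> \<infinity>"
    by (metis ennreal_less_top infinity_ennreal_def leD)
  then have fin: "AE \<zeta> in circle_measure. liminf (\<lambda>m. ennreal (v m \<zeta>)) \<noteq> \<infinity>"
    by (intro nn_integral_PInf_AE) auto
  have nz: "AE \<zeta> in circle_measure. \<eta> \<zeta> \<noteq> 0"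
    using fin
  proof eventually_elim
    case (elim \<zeta>)
    show ?case
    proof
      assume "\<eta> \<zeta> = 0"
      then have "(\<lambda>m. ennreal (v m \<zeta>)) = (\<lambda>m. of_nat m)" by (simp add: v_def ennreal_of_nat_eq_real_of_nat)
      moreover have "(\<lambda>m. of_nat m :: ennreal) \<longlonglongrightarrow> \<infinity>" by (simp add: of_nat_tendsto_top_ennreal)
      ultimately have "liminf (\<lambda>m. ennreal (v m \<zeta>)) = \<infinity>"
        using lim_imp_Liminf[OF trivial_limit_sequentially] by metis
      then show False using elim by simp
    qed
  qed
  then show "AE \<zeta> in circle_measure. boundary (ev x) \<zeta> \<noteq> 0" by (simp add: \<eta>_def)
  have "(\<integral>\<^sup>+\<zeta>. ennreal (norm (ln (\<eta> \<zeta>))) \<partial>circle_measure) = (\<integral>\<^sup>+\<zeta>. liminf (\<lambda>m. ennreal (v m \<zeta>)) \<partial>circle_measure)"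
  proof (rule nn_integral_cong_AE)
    show "AE \<zeta> in circle_measure. ennreal (norm (ln (\<eta> \<zeta>))) = liminf (\<lambda>m. ennreal (v m \<zeta>))"
      using nz \<eta>
    proof eventually_elim
      case (elim \<zeta>)
      then have le: "ln (\<eta> \<zeta>) \<le> 0" by (simp add: ln_le_zero_iff)
      obtain M where M: "- ln (\<eta> \<zeta>) \<le> real M" using real_arch_simple by blast
      have "v m \<zeta> = - ln (\<eta> \<zeta>)" if "m \<ge> M" for m
        using elim(1) M that by (simp add: v_def)
      then have "eventually (\<lambda>m. ennreal (v m \<zeta>) = ennreal (- ln (\<eta> \<zeta>))) sequentially"
        unfolding eventually_sequentially by metis
      then have "(\<lambda>m. ennreal (v m \<zeta>)) \<longlonglongrightarrow> ennreal (- ln (\<eta> \<zeta>))" by (rule tendsto_eventually)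
      then have "liminf (\<lambda>m. ennreal (v m \<zeta>)) = ennreal (- ln (\<eta> \<zeta>))"
        by (rule lim_imp_Liminf[OF trivial_limit_sequentially])
      then show ?case using le by simp
    qed
  qed
  then have "(\<integral>\<^sup>+\<zeta>. ennreal (norm (ln (\<eta> \<zeta>))) \<partial>circle_measure) < \<infinity>"
    using nn by (metis ennreal_less_top infinity_ennreal_def le_less_trans)
  then have "integrable circle_measure (\<lambda>\<zeta>. ln (\<eta> \<zeta>))" by (intro integrableI_bounded) auto
  then show "integrable circle_measure (\<lambda>\<zeta>. ln (cmod (boundary (ev x) \<zeta>)))" by (simp add: \<eta>_def)
qed

lemma boundary_basis_0: "cmod \<zeta> = 1 \<Longrightarrow> boundary (ev (basis 0)) \<zeta> = 1"
proof (rule boundary_eqI)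
  assume "cmod \<zeta> = 1"
  have "eventually (\<lambda>r. r \<in> {0<..<1}) (at_left (1::real))" by (rule eventually_at_left_real) simp
  then have "eventually (\<lambda>r. ev (basis 0) (of_real r * \<zeta>) = 1) (at_left (1::real))"
    by eventually_elim (use \<open>cmod \<zeta> = 1\<close> in \<open>simp add: ev_basis norm_mult\<close>)
  then show "((\<lambda>r. ev (basis 0) (of_real r * \<zeta>)) \<longlongrightarrow> 1) (at_left (1::real))"
    by (rule tendsto_eventually)
qed

text \<open>\<open>F n\<close> is the outer function with boundary modulus \<open>min 1 ((n + 1) \<bar>ev x\<bar>)\<close>.\<close>

lemma approximate_unit:
  assumes h0: "coef x 0 \<noteq> 0" and h1: "AE \<zeta> in circle_measure. cmod (boundary (ev x) \<zeta>) \<le> 1"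
  shows "\<exists>F :: nat \<Rightarrow> complex \<Rightarrow> complex. (\<forall>n. F n \<in> Hinf \<and> F n 0 \<noteq> 0 \<and>
      (AE \<zeta> in circle_measure. cmod (boundary (F n) \<zeta>) \<le> real (Suc n) * cmod (boundary (ev x) \<zeta>)) \<and>
      integrable circle_measure (\<lambda>\<zeta>. (cmod (1 - boundary (F n) \<zeta>))\<^sup>2)) \<and>
    (\<lambda>n. LINT \<zeta>|circle_measure. (cmod (1 - boundary (F n) \<zeta>))\<^sup>2) \<longlonglongrightarrow> 0"
proof -
  define l where "l \<zeta> = ln (cmod (boundary (ev x) \<zeta>))" for \<zeta>
  note nz = log_boundary_integrable(1)[OF h0 h1]
  have l: "integrable circle_measure l" unfolding l_def by (rule log_boundary_integrable(2)[OF h0 h1])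
  have [measurable]: "l \<in> borel_measurable borel" unfolding l_def by measurable
  have l0: "AE \<zeta> in circle_measure. l \<zeta> \<le> 0"
    using h1 nz by eventually_elim (simp add: l_def ln_le_zero_iff)
  define U where "U n \<zeta> = min 0 (ln (real (Suc n)) + l \<zeta>)" for n \<zeta>
  have [measurable]: "U n \<in> borel_measurable borel" for n unfolding U_def by measurable
  have Ul: "AE \<zeta> in circle_measure. norm (U n \<zeta>) \<le> norm (l \<zeta>)" for n
    using l0 by eventually_elim (auto simp: U_def min_def)
  have U: "integrable circle_measure (U n)" for n
    by (rule Bochner_Integration.integrable_bound[OF l _ Ul]) measurable
  have "AE \<zeta> in circle_measure. U n \<zeta> \<le> 0" for n by (simp add: U_def)
  from exponential_of_Poisson_integral[OF U this]
  have "\<exists>E. E \<in> Hinf \<and> (\<forall>z. cmod z < 1 \<longrightarrow> cmod (E z) \<le> exp 0) \<and>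
    E 0 = of_real (exp (LINT \<zeta>|circle_measure. U n \<zeta>)) \<and>
    (AE \<zeta> in circle_measure. cmod (boundary E \<zeta>) = exp (U n \<zeta>))" for n by metis
  then obtain F where F: "\<And>n. F n \<in> Hinf" "\<And>n z. cmod z < 1 \<Longrightarrow> cmod (F n z) \<le> 1"
    "\<And>n. F n 0 = of_real (exp (LINT \<zeta>|circle_measure. U n \<zeta>))"
    "\<And>n. AE \<zeta> in circle_measure. cmod (boundary (F n) \<zeta>) = exp (U n \<zeta>)"
    unfolding exp_zero by metis
  have bound: "AE \<zeta> in circle_measure. cmod (boundary (F n) \<zeta>) \<le> real (Suc n) * cmod (boundary (ev x) \<zeta>)" for n
    using F(4)[of n] nz
  proof eventually_elim
    case (elim \<zeta>)
    have "exp (U n \<zeta>) \<le> exp (ln (real (Suc n)) + l \<zeta>)" by (simp add: U_def)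
    also have "\<dots> = real (Suc n) * cmod (boundary (ev x) \<zeta>)"
      using elim(2) by (simp add: exp_add l_def)
    finally show ?case using elim(1) by simp
  qed
  \<comment> \<open>The mean of \<open>U n\<close> is the logarithm of F n (0). All
    \<open>U n\<close> are dominated by |l| and vanish eventually at each point, so F n (0) ->
    1.\<close>
  have "(\<lambda>n. LINT \<zeta>|circle_measure. U n \<zeta>) \<longlonglongrightarrow> (LINT \<zeta>|circle_measure. 0)"
  proof (rule integral_dominated_convergence[where w = "\<lambda>\<zeta>. norm (l \<zeta>)"])
    show "AE \<zeta> in circle_measure. (\<lambda>n. U n \<zeta>) \<longlonglongrightarrow> 0"
    proof (rule AE_I2)
      fix \<zeta>
      obtain N where N: "exp (- l \<zeta>) \<le> real N" using real_arch_simple by blast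
      have "U n \<zeta> = 0" if "n \<ge> N" for n
      proof -
        have "exp (- l \<zeta>) \<le> real (Suc n)" using N that by simp
        then have "- l \<zeta> \<le> ln (real (Suc n))" by (subst ln_ge_iff) auto
        then show ?thesis by (simp add: U_def)
      qed
      then show "(\<lambda>n. U n \<zeta>) \<longlonglongrightarrow> 0"
        by (intro tendsto_eventually) (auto simp: eventually_sequentially)
    qed
  qed (use l Ul in auto)
  then have "(\<lambda>n. LINT \<zeta>|circle_measure. U n \<zeta>) \<longlonglongrightarrow> 0" by simp
  then have e1: "(\<lambda>n. exp (LINT \<zeta>|circle_measure. U n \<zeta>)) \<longlonglongrightarrow> exp 0" by (rule tendsto_exp)
  have lim: "(\<lambda>n. 2 - 2 * exp (LINT \<zeta>|circle_measure. U n \<zeta>)) \<longlonglongrightarrow> 2 - 2 * exp 0"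
    by (intro tendsto_diff tendsto_mult tendsto_const e1)
  define y where "y n = inv ev (F n)" for n
  have y: "ev (y n) = F n" for n unfolding y_def using F(1) Hinf_subset_H2 by (intro ev_inv) auto
  have ynorm: "norm (y n) \<le> 1" for n
    using F(1,2) Hinf_subset_H2 by (intro norm_ev_le_of_boundary) (auto simp: y intro!: AE_boundary_le)
  have eq: "AE \<zeta> in circle_measure. (cmod (boundary (ev (basis 0 - y n)) \<zeta>))\<^sup>2 = (cmod (1 - boundary (F n) \<zeta>))\<^sup>2" for n
    using AE_boundary_diff[of "basis 0" "y n"] AE_circle_norm by eventually_elim (simp add: boundary_basis_0 y)
  have [measurable]: "boundary (F n) \<in> borel_measurable borel" for n using boundary_ev_measurable[of "y n"] by (simp add: y)
  have int: "integrable circle_measure (\<lambda>\<zeta>. (cmod (1 - boundary (F n) \<zeta>))\<^sup>2)" for n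
    by (rule integrable_cong_AE_imp[OF integrable_boundary_sq[of "basis 0 - y n"] _ eq]) measurable
  have val: "(LINT \<zeta>|circle_measure. (cmod (1 - boundary (F n) \<zeta>))\<^sup>2) = (norm (basis 0 - y n))\<^sup>2" for n
    unfolding integral_boundary_sq[symmetric] by (rule integral_cong_AE) (use eq[of n] in \<open>auto simp: eq_commute\<close>)
  \<comment> \<open>In norm, |1 - F|^2 = 1 - 2 Re F(0) + |F|^2 with |F| \<le> 1. For functions in
    the unit ball, convergence to 1 at the origin alone thus forces convergence to 1 in
    \<open>H2\<close>.\<close>
  have le: "(norm (basis 0 - y n))\<^sup>2 \<le> 2 - 2 * exp (LINT \<zeta>|circle_measure. U n \<zeta>)" for n
  proof -
    have "inner (y n) (basis 0) = exp (LINT \<zeta>|circle_measure. U n \<zeta>)"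
    proof -
      have "coef (y n) 0 = of_real (exp (LINT \<zeta>|circle_measure. U n \<zeta>))"
        unfolding ev_zero[symmetric] y F(3) ..
      then show ?thesis by (simp add: inner_eq_Re_cinner)
    qed
    moreover have "inner (basis 0) (basis 0) = 1" by (simp add: inner_eq_Re_cinner)
    moreover have "inner (y n) (y n) \<le> 1" using ynorm[of n] by (simp add: dot_square_norm power_le_one)
    moreover have "(norm (basis 0 - y n))\<^sup>2 = inner (basis 0) (basis 0) - 2 * inner (y n) (basis 0) + inner (y n) (y n)"
      unfolding power2_norm_eq_inner by (simp add: inner_diff_left inner_diff_right inner_commute[of "basis 0" "y n"])
    ultimately show ?thesis by simp
  qed
  have "(\<lambda>n. LINT \<zeta>|circle_measure. (cmod (1 - boundary (F n) \<zeta>))\<^sup>2) \<longlonglongrightarrow> 0"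
    unfolding val
    by (rule tendsto_sandwich[OF _ _ tendsto_const lim[simplified]]) (use le in auto)
  moreover have "F n 0 \<noteq> 0" for n by (simp add: F(3))
  ultimately show ?thesis using F(1) bound int by blast
qed

text \<open>The companion is sqrt (u (1 - u)) (p - q), by |(1 - u) s + u t|^2 + u (1 - u) |s - t|^2
  = (1 - u) |s|^2 + u |t|^2 in the disk. Its zero at the origin is then divided out as a power of z:
  the modulus on the circle does not change, and the value at 0 becomes nonzero, which is the
  starting point of the logarithmic bound.\<close>

lemma nonextreme_companion:
  assumes b: "b \<in> Hinf_unit_ball" and ne: "\<not> b extreme_point_of Hinf_unit_ball"
  obtains x where "coef x 0 \<noteq> 0"
    "AE \<zeta> in circle_measure. (cmod (boundary b \<zeta>))\<^sup>2 + (cmod (boundary (ev x) \<zeta>))\<^sup>2 \<le> 1"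
proof -
  obtain p q where pq: "p \<in> Hinf_unit_ball" "q \<in> Hinf_unit_ball" "b \<in> open_segment p q"
    using b ne unfolding extreme_point_of_def by blast
  then obtain u where u: "0 < u" "u < 1" "b = (1 - u) *\<^sub>R p + u *\<^sub>R q" and neq: "p \<noteq> q"
    unfolding in_segment by blast
  have H: "p \<in> H2" "q \<in> H2" "b \<in> H2" using pq(1,2) b Hinf_unit_ball_le_1(1) Hinf_subset_H2 by blast+
  obtain xp xq xb where xpq: "p = ev xp" "q = ev xq" "b = ev xb" using H H2_imp_ev by metis
  have bz: "b z = (1 - of_real u) * p z + of_real u * q z" for z
    by (simp add: u(3) scaleR_fun_def plus_fun_def scaleR_conv_of_real)
  define x0 where "x0 = cscale (of_real (sqrt (u * (1 - u)))) (xp - xq)"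
  have su: "0 < u * (1 - u)" using u by simp
  have pt: "(cmod (ev xb z))\<^sup>2 + (cmod (ev x0 z))\<^sup>2 \<le> 1" if z: "cmod z < 1" for z
  proof -
    have identity: "(cmod ((1 - of_real u) * s + of_real u * t))\<^sup>2 + u * (1 - u) * (cmod (s - t))\<^sup>2 =
        (1 - u) * (cmod s)\<^sup>2 + u * (cmod t)\<^sup>2" for s t
      unfolding cmod_power2 by (simp add: power2_eq_square algebra_simps)
    have "(cmod (ev x0 z))\<^sup>2 = u * (1 - u) * (cmod (p z - q z))\<^sup>2"
      using su by (simp add: x0_def ev_cscale ev_diff xpq(1,2) norm_mult power_mult_distrib)
    then have "(cmod (ev xb z))\<^sup>2 + (cmod (ev x0 z))\<^sup>2 = (1 - u) * (cmod (p z))\<^sup>2 + u * (cmod (q z))\<^sup>2"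
      using identity[of "p z" "q z"] bz[of z] by (simp add: xpq(3))
    also have "\<dots> \<le> (1 - u) * 1 + u * 1"
      using u Hinf_unit_ball_le_1(2)[OF pq(1) z] Hinf_unit_ball_le_1(2)[OF pq(2) z]
      by (intro add_mono mult_left_mono) (auto simp: power_le_one)
    finally show ?thesis by simp
  qed
  have bd: "AE \<zeta> in circle_measure. (cmod (boundary b \<zeta>))\<^sup>2 + (cmod (boundary (ev x0) \<zeta>))\<^sup>2 \<le> 1"
    using AE_ev_radial_limit[of xb] AE_ev_radial_limit[of x0] AE_circle_norm
  proof eventually_elim
    case (elim \<zeta>)
    have evt: "eventually (\<lambda>r. r \<in> {0<..<1}) (at_left (1::real))" by (rule eventually_at_left_real) simp
    have lim: "((\<lambda>r. (cmod (ev xb (of_real r * \<zeta>)))\<^sup>2 + (cmod (ev x0 (of_real r * \<zeta>)))\<^sup>2) \<longlongrightarrow>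
      (cmod (boundary b \<zeta>))\<^sup>2 + (cmod (boundary (ev x0) \<zeta>))\<^sup>2) (at_left (1::real))"
      unfolding xpq(3) by (intro tendsto_intros elim)
    show ?case
      by (rule tendsto_upperbound[OF lim eventually_mono[OF evt]])
        (use elim(3) in \<open>auto intro!: pt simp: norm_mult trivial_limit_at_left_real\<close>)
  qed
  have "x0 \<noteq> 0"
  proof
    assume "x0 = 0"
    then have "cmod (of_real (sqrt (u * (1 - u)))) * norm (xp - xq) = 0"
      unfolding x0_def norm_cscale[symmetric] by simp
    then have "xp = xq" using u(1,2) by simp
    then show False using neq xpq by simp
  qed
  then have "\<exists>k. coef x0 k \<noteq> 0" using coef_eqI[of x0 0] by auto
  then obtain k where k: "coef x0 k \<noteq> 0" "\<And>n. n < k \<Longrightarrow> coef x0 n = 0"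
    using exists_least_iff[of "\<lambda>k. coef x0 k \<noteq> 0"] by auto
  define x where "x = Abs_ell2 (\<lambda>n. coef x0 (n + k))"
  have x: "coef x n = coef x0 (n + k)" for n
    unfolding x_def using summable_ignore_initial_segment[OF summable_coef_sq[of x0], of k]
    by (subst Abs_ell2_inverse) auto
  have sh: "x0 = shift k x" by (rule coef_eqI) (auto simp: coef_shift x k(2))
  have "AE \<zeta> in circle_measure. (cmod (boundary b \<zeta>))\<^sup>2 + (cmod (boundary (ev x) \<zeta>))\<^sup>2 \<le> 1"
    using bd AE_ev_radial_limit[of x] AE_circle_norm
  proof eventually_elim
    case (elim \<zeta>)
    have "((\<lambda>r. ev (shift k x) (of_real r * \<zeta>)) \<longlongrightarrow> (of_real 1 * \<zeta>) ^ k * boundary (ev x) \<zeta>) (at_left (1::real))"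
      unfolding ev_shift by (intro tendsto_intros elim)
    then have "boundary (ev x0) \<zeta> = \<zeta> ^ k * boundary (ev x) \<zeta>" unfolding sh by (simp add: boundary_eqI)
    then show ?case using elim by (simp add: norm_mult norm_power)
  qed
  then show ?thesis using that[of x] k(1) by (simp add: x)
qed

section \<open>Density of the polynomials\<close>

lemma mulop_basis:
  assumes "\<phi> \<in> Hinf" "\<phi> = ev f"
  shows "mulop \<phi> (basis m) = shift m f"
proof (rule injD[OF inj_ev], rule ext)
  fix z
  have "ev (mulop \<phi> (basis m)) z = ev f z * ev (basis m) z"
    by (simp only: ev_mulop[OF assms(1)] assms(2)[symmetric])
  also have "\<dots> = ev (shift m f) z"
    by (cases "cmod z < 1") (simp_all add: ev_shift ev_basis ev_outside)
  finally show "ev (mulop \<phi> (basis m)) z = ev (shift m f) z" .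
qed

text \<open>In the monomial basis the operator is an upper triangular Toeplitz matrix with diagonal
  entry cnj (\<phi>(0)), so it sends polynomials to polynomials without raising the degree.\<close>

lemma coef_coanalytic_basis:
  assumes "\<phi> \<in> Hinf" "\<phi> = ev f"
  shows "coef (coanalytic \<phi> (basis m)) n = (if n \<le> m then cnj (coef f (m - n)) else 0)"
proof -
  have "coef (coanalytic \<phi> (basis m)) n = cinner (coanalytic \<phi> (basis m)) (basis n)" by simp
  also have "\<dots> = cnj (cinner (mulop \<phi> (basis n)) (basis m))"
    unfolding cinner_coanalytic[OF assms(1)] by (rule cinner_commute)
  also have "\<dots> = (if n \<le> m then cnj (coef f (m - n)) else 0)"
    by (simp add: mulop_basis[OF assms] coef_shift)
  finally show ?thesis .
qed

definition poly_space :: "ell2 set" where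
  "poly_space = {x. \<exists>N. \<forall>n\<ge>N. coef x n = 0}"

lemma poly_space_basis: "basis m \<in> poly_space"
  unfolding poly_space_def by (auto intro: exI[of _ "Suc m"])

lemma poly_space_add: "x \<in> poly_space \<Longrightarrow> y \<in> poly_space \<Longrightarrow> x + y \<in> poly_space"
proof -
  assume "x \<in> poly_space" "y \<in> poly_space"
  then obtain N M where "\<forall>n\<ge>N. coef x n = 0" "\<forall>n\<ge>M. coef y n = 0" unfolding poly_space_def by auto
  then have "\<forall>n\<ge>max N M. coef (x + y) n = 0" by simp
  then show "x + y \<in> poly_space" unfolding poly_space_def by blast
qed

lemma poly_space_cscale: "x \<in> poly_space \<Longrightarrow> cscale c x \<in> poly_space"
  unfolding poly_space_def by auto

lemma coanalytic_basis_in_poly_space: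
  assumes "\<phi> \<in> Hinf" shows "coanalytic \<phi> (basis m) \<in> poly_space"
proof -
  obtain f where "\<phi> = ev f" using assms Hinf_subset_H2 H2_imp_ev by blast
  from coef_coanalytic_basis[OF assms this] have "\<forall>n\<ge>Suc m. coef (coanalytic \<phi> (basis m)) n = 0" by simp
  then show ?thesis unfolding poly_space_def by blast
qed

lemma poly_space_eq_sum:
  assumes "\<And>n. n \<ge> N \<Longrightarrow> coef x n = 0"
  shows "x = (\<Sum>n<N. cscale (coef x n) (basis n))"
proof (rule coef_eqI)
  have c: "coef (sum g A) k = (\<Sum>n\<in>A. coef (g n) k)" if "finite A" for g k and A :: "nat set"
    using that by (induction A) auto
  show "coef x k = coef (\<Sum>n<N. cscale (coef x n) (basis n)) k" for k
    using assms[of k] by (simp add: c if_distrib sum.delta cong: if_cong)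
qed

lemma poly_space_induct:
  assumes "x \<in> poly_space" "\<And>n. basis n \<in> V" "\<And>x y. x \<in> V \<Longrightarrow> y \<in> V \<Longrightarrow> x + y \<in> V"
    "\<And>c x. x \<in> V \<Longrightarrow> cscale c x \<in> V"
  shows "x \<in> V"
proof -
  obtain N where N: "\<And>n. n \<ge> N \<Longrightarrow> coef x n = 0" using assms(1) by (auto simp: poly_space_def)
  have "cscale 0 (basis 0) = 0" by (rule coef_eqI) simp
  then have "0 \<in> V" using assms(2,4) by metis
  then have "(\<Sum>n<M. cscale (coef x n) (basis n)) \<in> V" for M
    by (induction M) (auto intro: assms)
  then show ?thesis using poly_space_eq_sum[OF N] by metis
qed

lemma polynomial_functions_eq: "polynomial_functions = ev ` poly_space"
proof (intro set_eqI iffI)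
  fix f assume "f \<in> polynomial_functions"
  then obtain p where p: "f = (\<lambda>z. if z \<in> ball 0 1 then poly p z else 0)"
    by (auto simp: polynomial_functions_def)
  define x where "x = Abs_ell2 (coeff p)"
  have "summable (\<lambda>n. (cmod (coeff p n))\<^sup>2)"
    by (rule summable_finite[of "{..degree p}"]) (auto simp: coeff_eq_0)
  then have x: "coef x = coeff p" by (simp add: x_def Abs_ell2_inverse)
  have "f z = ev x z" for z
  proof (cases "z \<in> ball 0 1")
    case True
    then show ?thesis unfolding p ev_def disk_series_def x
      by (subst suminf_finite[of "{..degree p}"]) (auto simp: coeff_eq_0 poly_altdef)
  qed (simp add: p ev_outside)
  moreover have "x \<in> poly_space"
    unfolding poly_space_def using x by (auto intro!: exI[of _ "Suc (degree p)"] coeff_eq_0)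
  ultimately show "f \<in> ev ` poly_space" by auto
next
  fix f assume "f \<in> ev ` poly_space"
  then obtain x N where x: "f = ev x" and N: "\<And>n. n \<ge> N \<Longrightarrow> coef x n = 0"
    by (auto simp: poly_space_def)
  define p where "p = (\<Sum>n<N. monom (coef x n) n)"
  have "f z = (if z \<in> ball 0 1 then poly p z else 0)" for z
    unfolding x ev_def disk_series_def p_def
    by (subst suminf_finite[of "{..<N}"]) (auto simp: N not_less poly_sum poly_monom)
  then show "f \<in> polynomial_functions" by (auto simp: polynomial_functions_def)
qed

text \<open>Projecting cnj \<phi> f does not increase its norm, which is that of \<phi> f. The proof
  pairs \<open>x\<close> with \<phi> w for w the image itself and applies the Cauchy-Schwarz
  inequality on the circle.\<close>

lemma norm_coanalytic_le_L2:
  assumes "\<phi> \<in> Hinf"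
  shows "norm (coanalytic \<phi> x) \<le> norm (mulop \<phi> x)"
proof -
  define w where "w = coanalytic \<phi> x"
  have [measurable]: "boundary \<phi> \<in> borel_measurable borel"
    using assms Hinf_subset_H2 by (auto intro: H2_boundary_measurable)
  have "cinner x (mulop \<phi> w) = (LINT \<zeta>|circle_measure. (cnj (boundary \<phi> \<zeta>) * boundary (ev x) \<zeta>) * cnj (boundary (ev w) \<zeta>))"
    unfolding H2_inner_ev[symmetric] H2_inner_def L2_inner_def
    by (rule integral_cong_AE) (use AE_boundary_mulop[OF assms, of w] in \<open>auto elim: eventually_mono\<close>)
  also have "cmod \<dots> \<le> sqrt (LINT \<zeta>|circle_measure. (cmod (cnj (boundary \<phi> \<zeta>) * boundary (ev x) \<zeta>))\<^sup>2) *
      sqrt (LINT \<zeta>|circle_measure. (cmod (cnj (boundary (ev w) \<zeta>)))\<^sup>2)"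
    using norm_mulop_sq(2)[OF assms, of x]
    by (intro L2_Cauchy_Schwarz(2)) (auto simp: norm_mult power_mult_distrib integrable_boundary_sq)
  also have "\<dots> = norm (mulop \<phi> x) * norm w"
    by (simp add: norm_mult power_mult_distrib norm_mulop_sq(1)[OF assms, symmetric] integral_boundary_sq)
  finally have "cmod (cinner x (mulop \<phi> w)) \<le> norm (mulop \<phi> x) * norm w" .
  moreover have "cinner x (mulop \<phi> w) = of_real (norm w * norm w)"
  proof -
    have "cinner x (mulop \<phi> w) = cnj (cinner (mulop \<phi> w) x)" by (rule cinner_commute)
    also have "\<dots> = cnj (cinner w w)" by (simp add: cinner_coanalytic[OF assms] w_def)
    finally show ?thesis by (simp add: cinner_self norm_ell2_sq[symmetric] power2_eq_square[symmetric])
  qed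
  ultimately have "norm w * norm w \<le> norm (mulop \<phi> x) * norm w" by (simp add: norm_mult)
  then show ?thesis unfolding w_def[symmetric] by (cases "w = 0") simp_all
qed

section \<open>The defect form as an integral over the circle\<close>

text \<open>A predicate on genuine functions: the defect form is taken apart into boundary terms
  that no longer belong to \<open>H2\<close>.\<close>

definition L2 :: "(complex \<Rightarrow> complex) \<Rightarrow> bool" where
  "L2 f \<longleftrightarrow> f \<in> borel_measurable borel \<and> integrable circle_measure (\<lambda>\<zeta>. (cmod (f \<zeta>))\<^sup>2)"

definition L2_norm :: "(complex \<Rightarrow> complex) \<Rightarrow> real" where
  "L2_norm f = sqrt (LINT \<zeta>|circle_measure. (cmod (f \<zeta>))\<^sup>2)"

lemma L2_boundary: "L2 (boundary (ev x))"
  by (simp add: L2_def integrable_boundary_sq)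

lemma L2_cnj: "L2 f \<Longrightarrow> L2 (\<lambda>\<zeta>. cnj (f \<zeta>))"
  by (auto simp: L2_def)

lemma L2_diff: "L2 f \<Longrightarrow> L2 g \<Longrightarrow> L2 (\<lambda>\<zeta>. f \<zeta> - g \<zeta>)"
  using integrable_square_add[of f circle_measure "\<lambda>\<zeta>. - g \<zeta>"] by (auto simp: L2_def)

lemma L2_integrable: "L2 f \<Longrightarrow> L2 g \<Longrightarrow> integrable circle_measure (\<lambda>\<zeta>. f \<zeta> * g \<zeta>)"
  by (rule L2_Cauchy_Schwarz(1)) (auto simp: L2_def)

lemma L2_Cauchy_Schwarz_norm: "L2 f \<Longrightarrow> L2 g \<Longrightarrow> cmod (LINT \<zeta>|circle_measure. f \<zeta> * g \<zeta>) \<le> L2_norm f * L2_norm g"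
  unfolding L2_norm_def by (rule L2_Cauchy_Schwarz(2)) (auto simp: L2_def)

lemma
  assumes f: "L2 f" and [measurable]: "g \<in> borel_measurable borel" and K: "0 \<le> K"
    and g: "AE \<zeta> in circle_measure. cmod (g \<zeta>) \<le> K"
  shows L2_mult_bounded: "L2 (\<lambda>\<zeta>. f \<zeta> * g \<zeta>)"
    and L2_norm_mult_bounded: "L2_norm (\<lambda>\<zeta>. f \<zeta> * g \<zeta>) \<le> K * L2_norm f"
proof -
  have [measurable]: "f \<in> borel_measurable borel" and fi: "integrable circle_measure (\<lambda>\<zeta>. (cmod (f \<zeta>))\<^sup>2)"
    using f by (auto simp: L2_def)
  have le: "AE \<zeta> in circle_measure. (cmod (f \<zeta> * g \<zeta>))\<^sup>2 \<le> K\<^sup>2 * (cmod (f \<zeta>))\<^sup>2"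
    using g
  proof eventually_elim
    case (elim \<zeta>)
    then have "cmod (f \<zeta> * g \<zeta>) \<le> K * cmod (f \<zeta>)"
      using mult_right_mono[OF elim norm_ge_zero[of "f \<zeta>"]] by (simp add: norm_mult mult.commute)
    then show ?case unfolding power_mult_distrib[symmetric] by (intro power_mono) auto
  qed
  have ki: "integrable circle_measure (\<lambda>\<zeta>. K\<^sup>2 * (cmod (f \<zeta>))\<^sup>2)" using fi by simp
  have fg: "integrable circle_measure (\<lambda>\<zeta>. (cmod (f \<zeta> * g \<zeta>))\<^sup>2)"
    by (rule Bochner_Integration.integrable_bound[OF ki]) (use le in \<open>auto elim!: eventually_mono\<close>)
  then show "L2 (\<lambda>\<zeta>. f \<zeta> * g \<zeta>)" by (auto simp: L2_def)
  have "(LINT \<zeta>|circle_measure. (cmod (f \<zeta> * g \<zeta>))\<^sup>2) \<le> (LINT \<zeta>|circle_measure. K\<^sup>2 * (cmod (f \<zeta>))\<^sup>2)"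
    by (rule integral_mono_AE[OF fg ki le])
  then have "L2_norm (\<lambda>\<zeta>. f \<zeta> * g \<zeta>) \<le> sqrt (K\<^sup>2 * (LINT \<zeta>|circle_measure. (cmod (f \<zeta>))\<^sup>2))"
    unfolding L2_norm_def by simp
  then show "L2_norm (\<lambda>\<zeta>. f \<zeta> * g \<zeta>) \<le> K * L2_norm f"
    unfolding L2_norm_def real_sqrt_mult using K by simp
qed

lemma L2_norm_boundary: "L2_norm (boundary (ev x)) = norm x"
  by (simp add: L2_norm_def integral_boundary_sq)

lemma poly_space_bounded:
  assumes "x \<in> poly_space"
  obtains K where "0 \<le> K" "\<And>z. cmod z < 1 \<Longrightarrow> cmod (ev x z) \<le> K"
proof -
  obtain N where N: "\<And>n. n \<ge> N \<Longrightarrow> coef x n = 0" using assms by (auto simp: poly_space_def)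
  have "cmod (ev x z) \<le> (\<Sum>n<N. cmod (coef x n))" if z: "cmod z < 1" for z
  proof -
    have "ev x z = (\<Sum>n<N. coef x n * z ^ n)"
      unfolding ev_def disk_series_def using z by (subst suminf_finite[of "{..<N}"]) (auto simp: N not_less)
    also have "cmod \<dots> \<le> (\<Sum>n<N. cmod (coef x n * z ^ n))" by (rule norm_sum)
    also have "\<dots> \<le> (\<Sum>n<N. cmod (coef x n))"
      using z by (intro sum_mono) (simp add: norm_mult norm_power mult_left_le power_le_one)
    finally show ?thesis .
  qed
  then show ?thesis by (intro that[of "\<Sum>n<N. cmod (coef x n)"]) (auto intro: sum_nonneg)
qed

text \<open>
  With \<open>B\<close>, \<open>f\<close>, \<open>e\<close> denoting boundary functions, the form \<open>\<langle>f, e\<rangle> - \<langle>T f, T e\<rangle>\<close> for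
  \<open>T\<close> the Toeplitz operator with symbol \<open>cnj B\<close> equals
  \<open>\<integral> (1 - \<bar>B\<bar>\<^sup>2) f cnj e + \<integral> v cnj \<epsilon>\<close> with \<open>v = cnj B f - T f\<close> and \<open>\<epsilon> = cnj B e - T e\<close>, both orthogonal
  to \<open>H2\<close>. Splitting with \<open>1 = \<phi> + (1 - \<phi>)\<close>, the term \<open>\<phi> T f\<close> drops out because \<open>\<phi>\<close> is analytic.
\<close>

lemma defect_form_estimate:
  assumes b: "b \<in> Hinf_unit_ball" and e: "e \<in> poly_space" and te: "coanalytic b e \<in> poly_space"
  shows "\<exists>K. \<forall>\<phi> f d. \<phi> \<in> Hinf \<and> L2 (\<lambda>\<zeta>. 1 - boundary \<phi> \<zeta>) \<and> 0 \<le> d \<and>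
      d\<^sup>2 = (norm f)\<^sup>2 - (norm (coanalytic b f))\<^sup>2 \<longrightarrow>
      cmod (cinner f e - cinner (coanalytic b f) (coanalytic b e)) \<le>
        K * (norm (mulop \<phi> f) + L2_norm (\<lambda>\<zeta>. 1 - boundary \<phi> \<zeta>) * d)"
proof -
  have bH: "b \<in> Hinf" and b1: "\<And>z. cmod z < 1 \<Longrightarrow> cmod (b z) \<le> 1"
    using Hinf_unit_ball_le_1[OF b] by auto
  define t where "t = coanalytic b e"
  obtain K1 where K1: "0 \<le> K1" "\<And>z. cmod z < 1 \<Longrightarrow> cmod (ev e z) \<le> K1" using poly_space_bounded[OF e] by blast
  obtain K2 where K2: "0 \<le> K2" "\<And>z. cmod z < 1 \<Longrightarrow> cmod (ev t z) \<le> K2" using poly_space_bounded[OF te] unfolding t_def by blast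
  define B where "B = boundary b"
  define es where "es = boundary (ev e)"
  define ts where "ts = boundary (ev t)"
  define \<epsilon> where "\<epsilon> \<zeta> = cnj (B \<zeta>) * es \<zeta> - ts \<zeta>" for \<zeta>
  \<comment> \<open>The cofactor of \<phi> f once the \<phi>-parts of the two integrands are
    collected. It is bounded because e and T e are polynomials.\<close>
  define R where "R \<zeta> = (1 - of_real ((cmod (B \<zeta>))\<^sup>2)) * cnj (es \<zeta>) + cnj (B \<zeta>) * cnj (\<epsilon> \<zeta>)" for \<zeta>
  have [measurable]: "B \<in> borel_measurable borel"
    unfolding B_def using bH Hinf_subset_H2 by (auto intro: H2_boundary_measurable)
  then have [measurable]: "boundary b \<in> borel_measurable borel" by (simp add: B_def)
  have [measurable]: "es \<in> borel_measurable borel" "ts \<in> borel_measurable borel" by (simp_all add: es_def ts_def)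
  have [measurable]: "\<epsilon> \<in> borel_measurable borel" unfolding \<epsilon>_def by measurable
  have [measurable]: "R \<in> borel_measurable borel" unfolding R_def by measurable
  have B1: "AE \<zeta> in circle_measure. cmod (B \<zeta>) \<le> 1"
    unfolding B_def using bH Hinf_subset_H2 by (intro AE_boundary_le b1) auto
  have es1: "AE \<zeta> in circle_measure. cmod (es \<zeta>) \<le> K1"
    unfolding es_def by (intro AE_boundary_le ev_in_H2 K1)
  have ts1: "AE \<zeta> in circle_measure. cmod (ts \<zeta>) \<le> K2"
    unfolding ts_def by (intro AE_boundary_le ev_in_H2 K2)
  have \<epsilon>1: "AE \<zeta> in circle_measure. cmod (\<epsilon> \<zeta>) \<le> K1 + K2"
    using B1 es1 ts1
  proof eventually_elim
    case (elim \<zeta>)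
    have "cmod (B \<zeta>) * cmod (es \<zeta>) \<le> 1 * K1" using elim by (intro mult_mono) auto
    then show ?case using norm_triangle_ineq4[of "cnj (B \<zeta>) * es \<zeta>" "ts \<zeta>"] elim
      by (simp add: \<epsilon>_def norm_mult)
  qed
  have m1: "AE \<zeta> in circle_measure. cmod (1 - of_real ((cmod (B \<zeta>))\<^sup>2)) \<le> 1"
    using B1
  proof eventually_elim
    case (elim \<zeta>)
    have "1 - complex_of_real ((cmod (B \<zeta>))\<^sup>2) = of_real (1 - (cmod (B \<zeta>))\<^sup>2)" by simp
    then have "cmod (1 - of_real ((cmod (B \<zeta>))\<^sup>2)) = \<bar>1 - (cmod (B \<zeta>))\<^sup>2\<bar>" by (simp only: norm_of_real)
    then show ?case using elim power_le_one[of "cmod (B \<zeta>)" 2] by simp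
  qed
  \<comment> \<open>The same constant bounds |R| and is the sum of the factors \<open>K1\<close> and
    \<open>K1 + K2\<close> of the two terms with 1 - \<phi>.\<close>
  define K where "K = K1 + (K1 + K2)"
  have R1: "AE \<zeta> in circle_measure. cmod (R \<zeta>) \<le> K"
    using m1 es1 \<epsilon>1 B1
  proof eventually_elim
    case (elim \<zeta>)
    have "cmod (1 - of_real ((cmod (B \<zeta>))\<^sup>2)) * cmod (es \<zeta>) \<le> 1 * K1" using elim by (intro mult_mono) auto
    moreover have "cmod (B \<zeta>) * cmod (\<epsilon> \<zeta>) \<le> 1 * (K1 + K2)" using elim by (intro mult_mono) auto
    ultimately have "cmod ((1 - of_real ((cmod (B \<zeta>))\<^sup>2)) * cnj (es \<zeta>)) + cmod (cnj (B \<zeta>) * cnj (\<epsilon> \<zeta>)) \<le> K"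
      unfolding norm_mult complex_mod_cnj K_def mult_1 by (rule add_mono)
    then show ?case unfolding R_def by (rule order_trans[OF norm_triangle_ineq])
  qed
  have one: "L2 (\<lambda>_. 1)" "L2_norm (\<lambda>_. 1) = 1" by (simp_all add: L2_def L2_norm_def)
  have K0: "0 \<le> K" using K1 K2 by (simp add: K_def)
  have LB: "L2 (\<lambda>\<zeta>. f \<zeta> * cnj (B \<zeta>))" if "L2 f" for f
    by (rule L2_mult_bounded[OF that, of _ 1]) (use B1 in auto)
  \<comment> \<open>T e is the projection of cnj B e onto \<open>H2\<close>, so the remainder
    \<open>\<epsilon>\<close> is orthogonal to \<open>H2\<close>.\<close>
  have orth: "(LINT \<zeta>|circle_measure. boundary (ev u) \<zeta> * cnj (\<epsilon> \<zeta>)) = 0"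
    and orth_int: "integrable circle_measure (\<lambda>\<zeta>. boundary (ev u) \<zeta> * cnj (\<epsilon> \<zeta>))" for u
  proof -
    define us where "us = boundary (ev u)"
    have us: "L2 us" unfolding us_def by (rule L2_boundary)
    have L: "L2 (\<lambda>\<zeta>. cnj (B \<zeta>) * es \<zeta>)"
      using LB[OF L2_boundary[of e]] by (simp add: es_def mult.commute)
    have i: "integrable circle_measure (\<lambda>\<zeta>. us \<zeta> * cnj (cnj (B \<zeta>) * es \<zeta>))" "integrable circle_measure (\<lambda>\<zeta>. us \<zeta> * cnj (ts \<zeta>))"
      unfolding ts_def by (rule L2_integrable[OF us L2_cnj[OF L]] L2_integrable[OF us L2_cnj[OF L2_boundary]])+
    have split: "us \<zeta> * cnj (\<epsilon> \<zeta>) = us \<zeta> * cnj (cnj (B \<zeta>) * es \<zeta>) - us \<zeta> * cnj (ts \<zeta>)" for \<zeta>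
      by (simp add: \<epsilon>_def right_diff_distrib)
    show "integrable circle_measure (\<lambda>\<zeta>. boundary (ev u) \<zeta> * cnj (\<epsilon> \<zeta>))"
      using i unfolding us_def[symmetric] split by simp
    have "(LINT \<zeta>|circle_measure. us \<zeta> * cnj (cnj (B \<zeta>) * es \<zeta>)) = cinner (mulop b u) e"
      unfolding H2_inner_ev[symmetric] H2_inner_def L2_inner_def
      by (rule integral_cong_AE)
        (use AE_boundary_mulop[OF bH, of u] in \<open>auto elim!: eventually_mono simp: us_def es_def B_def\<close>)
    moreover have "(LINT \<zeta>|circle_measure. us \<zeta> * cnj (ts \<zeta>)) = cinner u t"
      unfolding H2_inner_ev[symmetric] H2_inner_def L2_inner_def us_def ts_def ..
    ultimately show "(LINT \<zeta>|circle_measure. boundary (ev u) \<zeta> * cnj (\<epsilon> \<zeta>)) = 0"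
      using i unfolding us_def[symmetric] split by (simp add: cinner_coanalytic[OF bH] t_def)
  qed
  have main: "cmod (cinner f e - cinner (coanalytic b f) (coanalytic b e)) \<le>
        K * (norm (mulop \<phi> f) + L2_norm (\<lambda>\<zeta>. 1 - boundary \<phi> \<zeta>) * d)"
    if \<phi>: "\<phi> \<in> Hinf" and L\<phi>: "L2 (\<lambda>\<zeta>. 1 - boundary \<phi> \<zeta>)" and d0: "0 \<le> d"
      and d: "d\<^sup>2 = (norm f)\<^sup>2 - (norm (coanalytic b f))\<^sup>2" for \<phi> f d
  proof -
    define c where "c = coanalytic b f"
    define fs where "fs = boundary (ev f)"
    define cs where "cs = boundary (ev c)"
    define \<phi>s where "\<phi>s = boundary \<phi>"
    have [measurable]: "\<phi>s \<in> borel_measurable borel"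
      unfolding \<phi>s_def using \<phi> Hinf_subset_H2 by (auto intro: H2_boundary_measurable)
    have fs: "L2 fs" and cs: "L2 cs" unfolding fs_def cs_def by (rule L2_boundary)+
    have [measurable]: "fs \<in> borel_measurable borel" "cs \<in> borel_measurable borel" using fs cs by (auto simp: L2_def)
    have Nf: "(LINT \<zeta>|circle_measure. (cmod (fs \<zeta>))\<^sup>2) = (norm f)\<^sup>2" unfolding fs_def by (rule integral_boundary_sq)
    have Nc: "(LINT \<zeta>|circle_measure. (cmod (cs \<zeta>))\<^sup>2) = (norm c)\<^sup>2" unfolding cs_def by (rule integral_boundary_sq)
    have Nbf: "(LINT \<zeta>|circle_measure. (cmod (B \<zeta>))\<^sup>2 * (cmod (fs \<zeta>))\<^sup>2) = (norm (mulop b f))\<^sup>2"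
      and Ibf: "integrable circle_measure (\<lambda>\<zeta>. (cmod (B \<zeta>))\<^sup>2 * (cmod (fs \<zeta>))\<^sup>2)"
      unfolding B_def fs_def by (simp_all add: norm_mulop_sq[OF bH])
    have fi: "integrable circle_measure (\<lambda>\<zeta>. (cmod (fs \<zeta>))\<^sup>2)" using fs by (simp add: L2_def)
    have ci: "integrable circle_measure (\<lambda>\<zeta>. (cmod (cs \<zeta>))\<^sup>2)" using cs by (simp add: L2_def)
    have c_le: "norm c \<le> norm (mulop b f)" unfolding c_def by (rule norm_coanalytic_le_L2[OF bH])
    have b_le: "norm (mulop b f) \<le> norm f" using norm_mulop_le[OF bH _ b1, of f] by simp
    define p where "p \<zeta> = fs \<zeta> * (1 - of_real ((cmod (B \<zeta>))\<^sup>2))" for \<zeta>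
    define v where "v \<zeta> = fs \<zeta> * cnj (B \<zeta>) - cs \<zeta>" for \<zeta>
    have p: "L2 p" unfolding p_def by (rule L2_mult_bounded[OF fs _ _ m1]) auto
    have v: "L2 v" unfolding v_def by (intro L2_diff LB fs cs)
    have [measurable]: "p \<in> borel_measurable borel" "v \<in> borel_measurable borel" using p v by (auto simp: L2_def)
    have p_le: "L2_norm p \<le> d"
    proof -
      have "(LINT \<zeta>|circle_measure. (cmod (p \<zeta>))\<^sup>2) \<le> (LINT \<zeta>|circle_measure. (cmod (fs \<zeta>))\<^sup>2 - (cmod (B \<zeta>))\<^sup>2 * (cmod (fs \<zeta>))\<^sup>2)"
      proof (rule integral_mono_AE)
        show "integrable circle_measure (\<lambda>\<zeta>. (cmod (p \<zeta>))\<^sup>2)" using p by (simp add: L2_def)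
        show "integrable circle_measure (\<lambda>\<zeta>. (cmod (fs \<zeta>))\<^sup>2 - (cmod (B \<zeta>))\<^sup>2 * (cmod (fs \<zeta>))\<^sup>2)"
          using fi Ibf by simp
        show "AE \<zeta> in circle_measure. (cmod (p \<zeta>))\<^sup>2 \<le> (cmod (fs \<zeta>))\<^sup>2 - (cmod (B \<zeta>))\<^sup>2 * (cmod (fs \<zeta>))\<^sup>2"
          using B1
        proof eventually_elim
          case (elim \<zeta>)
          define s where "s = 1 - (cmod (B \<zeta>))\<^sup>2"
          have s: "0 \<le> s" "s \<le> 1" using elim power_le_one[of "cmod (B \<zeta>)" 2] by (auto simp: s_def)
          have "p \<zeta> = fs \<zeta> * of_real s" by (simp add: p_def s_def)
          then have "(cmod (p \<zeta>))\<^sup>2 = s\<^sup>2 * (cmod (fs \<zeta>))\<^sup>2" by (simp add: norm_mult power_mult_distrib)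
          also have "\<dots> \<le> s * (cmod (fs \<zeta>))\<^sup>2"
            using s by (intro mult_right_mono) (auto simp: power2_eq_square mult_left_le)
          finally show ?case by (simp add: s_def left_diff_distrib)
        qed
      qed
      also have "\<dots> = (norm f)\<^sup>2 - (norm (mulop b f))\<^sup>2" using fi Ibf by (simp add: Nf Nbf)
      also have "\<dots> \<le> d\<^sup>2" unfolding d using c_le by (simp add: c_def power_mono)
      finally show ?thesis unfolding L2_norm_def using d0 by (simp add: real_le_lsqrt)
    qed
    \<comment> \<open>Pythagoras for the projection T f of cnj B f: |v|^2 = |b f|^2 - |T f|^2, and
      |b f| \<le> |f|.\<close>
    have v_le: "L2_norm v \<le> d"
    proof -
      define X where "X \<zeta> = (fs \<zeta> * cnj (B \<zeta>)) * cnj (cs \<zeta>)" for \<zeta>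
      have Xi: "integrable circle_measure X" unfolding X_def by (intro L2_integrable LB fs L2_cnj cs)
      have "integral\<^sup>L circle_measure X = cinner f (mulop b c)"
        unfolding H2_inner_ev[symmetric] H2_inner_def L2_inner_def X_def
        by (rule integral_cong_AE)
          (use AE_boundary_mulop[OF bH, of c] in \<open>auto elim!: eventually_mono simp: fs_def cs_def B_def\<close>)
      also have "\<dots> = cnj (cinner (mulop b c) f)" by (rule cinner_commute)
      also have "\<dots> = of_real ((norm c)\<^sup>2)"
        by (simp add: cinner_coanalytic[OF bH] flip: c_def) (simp add: cinner_self norm_ell2_sq[symmetric])
      finally have X: "(LINT \<zeta>|circle_measure. Re (X \<zeta>)) = (norm c)\<^sup>2"
        using integral_Re[OF Xi] by simp
      have "(LINT \<zeta>|circle_measure. (cmod (v \<zeta>))\<^sup>2) =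
          (LINT \<zeta>|circle_measure. (cmod (B \<zeta>))\<^sup>2 * (cmod (fs \<zeta>))\<^sup>2 - 2 * Re (X \<zeta>) + (cmod (cs \<zeta>))\<^sup>2)"
      proof (rule Bochner_Integration.integral_cong)
        have id: "(cmod (s - u))\<^sup>2 = (cmod s)\<^sup>2 - 2 * Re (s * cnj u) + (cmod u)\<^sup>2" for s u
          unfolding cmod_power2 by (simp add: power2_eq_square algebra_simps)
        show "(cmod (v \<zeta>))\<^sup>2 = (cmod (B \<zeta>))\<^sup>2 * (cmod (fs \<zeta>))\<^sup>2 - 2 * Re (X \<zeta>) + (cmod (cs \<zeta>))\<^sup>2" for \<zeta>
          unfolding v_def X_def id by (simp add: norm_mult power_mult_distrib)
      qed simp
      also have "\<dots> = (norm (mulop b f))\<^sup>2 - 2 * (norm c)\<^sup>2 + (norm c)\<^sup>2"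
        using Ibf integrable_Re[OF Xi] ci by (simp add: Nbf X Nc)
      also have "\<dots> \<le> d\<^sup>2" unfolding d c_def[symmetric] using b_le by (simp add: power_mono)
      finally show ?thesis unfolding L2_norm_def using d0 by (simp add: real_le_lsqrt)
    qed
    have I1: "(LINT \<zeta>|circle_measure. fs \<zeta> * cnj (es \<zeta>)) = cinner f e"
      unfolding H2_inner_ev[symmetric] H2_inner_def L2_inner_def fs_def es_def ..
    have I2: "(LINT \<zeta>|circle_measure. (fs \<zeta> * cnj (B \<zeta>)) * cnj (ts \<zeta>)) = cinner c t"
    proof -
      have "(LINT \<zeta>|circle_measure. (fs \<zeta> * cnj (B \<zeta>)) * cnj (ts \<zeta>)) = cinner f (mulop b t)"
        unfolding H2_inner_ev[symmetric] H2_inner_def L2_inner_def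
        by (rule integral_cong_AE)
          (use AE_boundary_mulop[OF bH, of t] in \<open>auto elim!: eventually_mono simp: fs_def ts_def B_def\<close>)
      also have "\<dots> = cnj (cinner t c)" unfolding c_def cinner_coanalytic[OF bH, symmetric] by (rule cinner_commute)
      also have "\<dots> = cinner c t" by (rule cinner_commute[symmetric])
      finally show ?thesis .
    qed
    define \<psi> where "\<psi> \<zeta> = 1 - \<phi>s \<zeta>" for \<zeta>
    have \<psi>: "L2 \<psi>" using L\<phi> unfolding \<psi>_def \<phi>s_def .
    have \<phi>f: "AE \<zeta> in circle_measure. boundary (ev (mulop \<phi> f)) \<zeta> = \<phi>s \<zeta> * fs \<zeta>"
      "AE \<zeta> in circle_measure. boundary (ev (mulop \<phi> c)) \<zeta> = \<phi>s \<zeta> * cs \<zeta>"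
      unfolding \<phi>s_def fs_def cs_def by (rule AE_boundary_mulop[OF \<phi>])+
    define w where "w = boundary (ev (mulop \<phi> f))"
    have w: "L2 w" "L2_norm w = norm (mulop \<phi> f)" unfolding w_def by (rule L2_boundary L2_norm_boundary)+
    have LR: "L2 R" using L2_mult_bounded[OF one(1) _ K0 R1] by simp
    have NR: "L2_norm R \<le> K" using L2_norm_mult_bounded[OF one(1) _ K0 R1] one(2) by simp
    have pe: "L2 (\<lambda>\<zeta>. p \<zeta> * cnj (es \<zeta>))" "L2_norm (\<lambda>\<zeta>. p \<zeta> * cnj (es \<zeta>)) \<le> K1 * L2_norm p"
      by (rule L2_mult_bounded[OF p _ K1(1)] L2_norm_mult_bounded[OF p _ K1(1)]; use es1 in simp)+
    have ve: "L2 (\<lambda>\<zeta>. v \<zeta> * cnj (\<epsilon> \<zeta>))" "L2_norm (\<lambda>\<zeta>. v \<zeta> * cnj (\<epsilon> \<zeta>)) \<le> (K1 + K2) * L2_norm v"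
      by (rule L2_mult_bounded[OF v, where K = "K1 + K2"] L2_norm_mult_bounded[OF v]; use \<epsilon>1 K1 K2 in simp)+
    have T1: "integrable circle_measure (\<lambda>\<zeta>. w \<zeta> * R \<zeta>)" by (rule L2_integrable[OF w(1) LR])
    have T2: "integrable circle_measure (\<lambda>\<zeta>. \<psi> \<zeta> * (p \<zeta> * cnj (es \<zeta>)))" by (rule L2_integrable[OF \<psi> pe(1)])
    have T3: "integrable circle_measure (\<lambda>\<zeta>. \<psi> \<zeta> * (v \<zeta> * cnj (\<epsilon> \<zeta>)))" by (rule L2_integrable[OF \<psi> ve(1)])
    have J1: "integrable circle_measure (\<lambda>\<zeta>. fs \<zeta> * cnj (es \<zeta>))" unfolding es_def by (intro L2_integrable fs L2_cnj L2_boundary)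
    have J2: "integrable circle_measure (\<lambda>\<zeta>. (fs \<zeta> * cnj (B \<zeta>)) * cnj (ts \<zeta>))"
      unfolding ts_def by (intro L2_integrable LB fs L2_cnj L2_boundary)
    \<comment> \<open>Without the cut-off the left side is p cnj e + v cnj \<epsilon>. Inserting 1 =
      \<phi> + \<psi>, the \<phi>-part is \<phi> f R minus \<phi> (T f) cnj \<epsilon>; the latter
      integrates to 0, as does the term (T f) cnj \<epsilon> on the left.\<close>
    have pt: "AE \<zeta> in circle_measure. fs \<zeta> * cnj (es \<zeta>) - (fs \<zeta> * cnj (B \<zeta>)) * cnj (ts \<zeta>) - cs \<zeta> * cnj (\<epsilon> \<zeta>) =
        w \<zeta> * R \<zeta> + \<psi> \<zeta> * (p \<zeta> * cnj (es \<zeta>)) + \<psi> \<zeta> * (v \<zeta> * cnj (\<epsilon> \<zeta>)) - boundary (ev (mulop \<phi> c)) \<zeta> * cnj (\<epsilon> \<zeta>)"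
      using \<phi>f
    proof eventually_elim
      case (elim \<zeta>)
      have "complex_of_real ((cmod (B \<zeta>))\<^sup>2) = B \<zeta> * cnj (B \<zeta>)" by (rule complex_norm_square)
      then show ?case
        unfolding w_def elim R_def \<psi>_def p_def v_def \<epsilon>_def by (simp add: algebra_simps)
    qed
    have "cinner f e - cinner c t - 0 =
        (LINT \<zeta>|circle_measure. fs \<zeta> * cnj (es \<zeta>) - (fs \<zeta> * cnj (B \<zeta>)) * cnj (ts \<zeta>) - cs \<zeta> * cnj (\<epsilon> \<zeta>))"
      using J1 J2 orth_int[of c] unfolding cs_def
      by (simp add: I1[symmetric] I2[symmetric] orth)
    also have "\<dots> = (LINT \<zeta>|circle_measure. w \<zeta> * R \<zeta> + \<psi> \<zeta> * (p \<zeta> * cnj (es \<zeta>)) + \<psi> \<zeta> * (v \<zeta> * cnj (\<epsilon> \<zeta>)) - boundary (ev (mulop \<phi> c)) \<zeta> * cnj (\<epsilon> \<zeta>))"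
    proof (rule integral_cong_AE[OF _ _ pt])
      have [measurable]: "w \<in> borel_measurable borel" "\<psi> \<in> borel_measurable borel" using w \<psi> by (auto simp: L2_def)
      show "(\<lambda>\<zeta>. fs \<zeta> * cnj (es \<zeta>) - (fs \<zeta> * cnj (B \<zeta>)) * cnj (ts \<zeta>) - cs \<zeta> * cnj (\<epsilon> \<zeta>)) \<in> borel_measurable circle_measure"
        "(\<lambda>\<zeta>. w \<zeta> * R \<zeta> + \<psi> \<zeta> * (p \<zeta> * cnj (es \<zeta>)) + \<psi> \<zeta> * (v \<zeta> * cnj (\<epsilon> \<zeta>)) - boundary (ev (mulop \<phi> c)) \<zeta> * cnj (\<epsilon> \<zeta>)) \<in> borel_measurable circle_measure"
        by measurable
    qed
    also have "\<dots> = (LINT \<zeta>|circle_measure. w \<zeta> * R \<zeta>) + (LINT \<zeta>|circle_measure. \<psi> \<zeta> * (p \<zeta> * cnj (es \<zeta>))) + (LINT \<zeta>|circle_measure. \<psi> \<zeta> * (v \<zeta> * cnj (\<epsilon> \<zeta>)))"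
      using T1 T2 T3 orth_int[of "mulop \<phi> c"] by (simp add: orth)
    finally have "cmod (cinner f e - cinner c t) \<le> cmod (LINT \<zeta>|circle_measure. w \<zeta> * R \<zeta>) +
        cmod (LINT \<zeta>|circle_measure. \<psi> \<zeta> * (p \<zeta> * cnj (es \<zeta>))) + cmod (LINT \<zeta>|circle_measure. \<psi> \<zeta> * (v \<zeta> * cnj (\<epsilon> \<zeta>)))"
      by (simp only: diff_zero) (intro order_trans[OF norm_triangle_ineq] add_right_mono norm_triangle_ineq)
    also have "\<dots> \<le> norm (mulop \<phi> f) * K + L2_norm \<psi> * (K1 * d) + L2_norm \<psi> * ((K1 + K2) * d)"
    proof (intro add_mono)
      have psi0: "0 \<le> L2_norm \<psi>" by (simp add: L2_norm_def)
      show "cmod (LINT \<zeta>|circle_measure. w \<zeta> * R \<zeta>) \<le> norm (mulop \<phi> f) * K"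
        using order_trans[OF L2_Cauchy_Schwarz_norm[OF w(1) LR] mult_left_mono[OF NR]] w(2) by simp
      have "L2_norm (\<lambda>\<zeta>. p \<zeta> * cnj (es \<zeta>)) \<le> K1 * d"
        using order_trans[OF pe(2) mult_left_mono[OF p_le K1(1)]] .
      from order_trans[OF L2_Cauchy_Schwarz_norm[OF \<psi> pe(1)] mult_left_mono[OF this psi0]]
      show "cmod (LINT \<zeta>|circle_measure. \<psi> \<zeta> * (p \<zeta> * cnj (es \<zeta>))) \<le> L2_norm \<psi> * (K1 * d)" .
      have "0 \<le> K1 + K2" using K1 K2 by simp
      then have "L2_norm (\<lambda>\<zeta>. v \<zeta> * cnj (\<epsilon> \<zeta>)) \<le> (K1 + K2) * d"
        using order_trans[OF ve(2) mult_left_mono[OF v_le]] by blast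
      from order_trans[OF L2_Cauchy_Schwarz_norm[OF \<psi> ve(1)] mult_left_mono[OF this psi0]]
      show "cmod (LINT \<zeta>|circle_measure. \<psi> \<zeta> * (v \<zeta> * cnj (\<epsilon> \<zeta>))) \<le> L2_norm \<psi> * ((K1 + K2) * d)" .
    qed
    also have "\<dots> = K * (norm (mulop \<phi> f) + L2_norm \<psi> * d)" by (simp add: K_def algebra_simps)
    finally show ?thesis unfolding c_def t_def \<psi>_def \<phi>s_def .
  qed
  then show ?thesis by blast
qed

text \<open>A triangular matrix with nonzero diagonal entry cnj (\<phi>(0)): modulo lower monomials,
  already reached by induction, the image of \<open>basis m\<close> is a nonzero multiple of
  \<open>basis m\<close>.\<close>

lemma coanalytic_surj_poly_space:
  assumes \<phi>: "\<phi> \<in> Hinf" and 0: "\<phi> 0 \<noteq> 0" and y: "y \<in> poly_space"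
  obtains p where "p \<in> poly_space" "coanalytic \<phi> p = y"
proof -
  obtain f where f: "\<phi> = ev f" using \<phi> Hinf_subset_H2 H2_imp_ev by blast
  have f0: "coef f 0 \<noteq> 0" using 0 by (simp add: f ev_zero)
  define V where "V = coanalytic \<phi> ` poly_space"
  have Vadd: "u + v \<in> V" if "u \<in> V" "v \<in> V" for u v
    using that unfolding V_def by (auto simp: blinfun.add_right[symmetric] intro: poly_space_add)
  have Vscale: "cscale c u \<in> V" if "u \<in> V" for c u
    using that unfolding V_def by (auto simp: coanalytic_cscale[OF \<phi>, symmetric] intro: poly_space_cscale)
  have "basis m \<in> V" for m
  proof (induction m rule: less_induct)
    case (less m)
    define u where "u = coanalytic \<phi> (basis m)"
    have uV: "u \<in> V" unfolding u_def V_def using poly_space_basis by blast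
    define r where "r = u + cscale (- cnj (coef f 0)) (basis m)"
    have r0: "coef r n = 0" if "n \<ge> m" for n
      using that by (auto simp: r_def u_def coef_coanalytic_basis[OF \<phi> f])
    have z: "0 \<in> V" unfolding V_def
      by (rule image_eqI[of _ _ 0]) (auto simp: blinfun.zero_right poly_space_def)
    have "(\<Sum>n<M. cscale (coef r n) (basis n)) \<in> V" if "M \<le> m" for M
      using that by (induction M) (auto intro!: z Vadd Vscale less)
    then have "r \<in> V" using poly_space_eq_sum[OF r0] by (metis order_refl)
    moreover have "basis m = cscale (1 / cnj (coef f 0)) (u + cscale (-1) r)"
      by (rule coef_eqI) (use f0 in \<open>simp add: r_def\<close>)
    ultimately show ?case using uV Vadd Vscale by metis
  qed
  then have "y \<in> V" using poly_space_induct[OF y, of V] Vadd Vscale by blast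
  then show ?thesis using that unfolding V_def by blast
qed

theorem theorem4p4:
  fixes b :: "complex \<Rightarrow> complex"
  assumes "b \<in> Hinf_unit_ball"
    and "\<not> b extreme_point_of Hinf_unit_ball"
  shows "polynomial_functions \<subseteq> dBR_space b \<and>
         (\<forall>f\<in>dBR_space b. \<forall>\<epsilon>>0. \<exists>p\<in>polynomial_functions. dBR_norm b (\<lambda>z. f z - p z) < \<epsilon>)"
proof -
  note b = assms(1)
  have bH: "b \<in> Hinf" and b1: "\<And>z. cmod z < 1 \<Longrightarrow> cmod (b z) \<le> 1"
    using Hinf_unit_ball_le_1[OF b] by auto
  obtain D :: "ell2 \<Rightarrow>\<^sub>L ell2" where Dsa: "\<And>x y. inner (D x) y = inner x (D y)"
    and DD: "\<And>x. D (D x) = x - mulop b (coanalytic b x)"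
    and Dc: "\<And>c x. D (cscale c x) = cscale c (D x)"
    and root: "\<And>x. defect_root b (ev x) = ev (D x)"
    using defect_root_ev[OF b] by blast
  have Dcin: "cinner (D x) y = cinner x (D y)" for x y
    by (rule complex_adjoint[OF Dsa Dc])
  have Dform: "cinner (D x) (D y) = cinner x y - cinner (coanalytic b x) (coanalytic b y)" for x y
  proof -
    have "cinner (D (D x)) y = cinner (x + cscale (-1) (mulop b (coanalytic b x))) y"
      unfolding DD by (rule arg_cong[of _ _ "\<lambda>u. cinner u y"], rule coef_eqI) simp
    also have "\<dots> = cinner x y - cinner (coanalytic b x) (coanalytic b y)"
      by (simp add: cinner_add_left cinner_scale_left cinner_coanalytic[OF bH])
    finally show ?thesis by (simp add: Dcin)
  qed
  have normD: "(norm (D x))\<^sup>2 = (norm x)\<^sup>2 - (norm (coanalytic b x))\<^sup>2" for x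
  proof -
    have "complex_of_real ((norm (D x))\<^sup>2) = of_real ((norm x)\<^sup>2) - of_real ((norm (coanalytic b x))\<^sup>2)"
      using Dform[of x x] unfolding cinner_self norm_ell2_sq[symmetric] .
    then show ?thesis by (simp only: of_real_diff[symmetric] of_real_eq_iff)
  qed
  obtain h where h0: "coef h 0 \<noteq> 0"
    and bh: "AE \<zeta> in circle_measure. (cmod (boundary b \<zeta>))\<^sup>2 + (cmod (boundary (ev h) \<zeta>))\<^sup>2 \<le> 1"
    using nonextreme_companion[OF assms] by blast
  have h1: "AE \<zeta> in circle_measure. cmod (boundary (ev h) \<zeta>) \<le> 1"
    using bh
  proof eventually_elim
    case (elim \<zeta>)
    have "(cmod (boundary (ev h) \<zeta>))\<^sup>2 \<le> 1" using elim zero_le_power2[of "cmod (boundary b \<zeta>)"] by linarith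
    then have "(cmod (boundary (ev h) \<zeta>))\<^sup>2 \<le> 1\<^sup>2" by simp
    then show ?case by (rule power2_le_imp_le) simp
  qed
  obtain F :: "nat \<Rightarrow> complex \<Rightarrow> complex" where F': "(\<forall>n. F n \<in> Hinf \<and> F n 0 \<noteq> 0 \<and>
      (AE \<zeta> in circle_measure. cmod (boundary (F n) \<zeta>) \<le> real (Suc n) * cmod (boundary (ev h) \<zeta>)) \<and>
      integrable circle_measure (\<lambda>\<zeta>. (cmod (1 - boundary (F n) \<zeta>))\<^sup>2)) \<and>
    (\<lambda>n. LINT \<zeta>|circle_measure. (cmod (1 - boundary (F n) \<zeta>))\<^sup>2) \<longlonglongrightarrow> 0"
    using approximate_unit[OF h0 h1] by (rule exE)
  then have F: "\<And>n. F n \<in> Hinf" "\<And>n. F n 0 \<noteq> 0"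
    and Fh: "\<And>n. AE \<zeta> in circle_measure. cmod (boundary (F n) \<zeta>) \<le> real (Suc n) * cmod (boundary (ev h) \<zeta>)"
    and Flim: "(\<lambda>n. LINT \<zeta>|circle_measure. (cmod (1 - boundary (F n) \<zeta>))\<^sup>2) \<longlonglongrightarrow> 0"
    and Fint: "\<And>n. integrable circle_measure (\<lambda>\<zeta>. (cmod (1 - boundary (F n) \<zeta>))\<^sup>2)"
    by blast+
  have FD: "norm (mulop (F n) f) \<le> real (Suc n) * norm (D f)" for n f
  proof -
    define C where "C = real (Suc n)"
    have C: "0 \<le> C" by (simp add: C_def)
    have "(norm (mulop (F n) f))\<^sup>2 \<le>
        (LINT \<zeta>|circle_measure. C\<^sup>2 * ((cmod (boundary (ev f) \<zeta>))\<^sup>2 - (cmod (boundary b \<zeta>))\<^sup>2 * (cmod (boundary (ev f) \<zeta>))\<^sup>2))"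
      unfolding norm_mulop_sq(1)[OF F(1)]
    proof (rule integral_mono_AE)
      show "integrable circle_measure (\<lambda>\<zeta>. (cmod (boundary (F n) \<zeta>))\<^sup>2 * (cmod (boundary (ev f) \<zeta>))\<^sup>2)"
        by (rule norm_mulop_sq(2)[OF F(1)])
      show "integrable circle_measure (\<lambda>\<zeta>. C\<^sup>2 * ((cmod (boundary (ev f) \<zeta>))\<^sup>2 - (cmod (boundary b \<zeta>))\<^sup>2 * (cmod (boundary (ev f) \<zeta>))\<^sup>2))"
        by (intro integrable_mult_right Bochner_Integration.integrable_diff integrable_boundary_sq norm_mulop_sq(2)[OF bH])
      show "AE \<zeta> in circle_measure. (cmod (boundary (F n) \<zeta>))\<^sup>2 * (cmod (boundary (ev f) \<zeta>))\<^sup>2 \<le>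
          C\<^sup>2 * ((cmod (boundary (ev f) \<zeta>))\<^sup>2 - (cmod (boundary b \<zeta>))\<^sup>2 * (cmod (boundary (ev f) \<zeta>))\<^sup>2)"
        using Fh[of n] bh
      proof eventually_elim
        case (elim \<zeta>)
        have "(cmod (boundary (F n) \<zeta>))\<^sup>2 \<le> (C * cmod (boundary (ev h) \<zeta>))\<^sup>2"
          using elim(1) unfolding C_def by (intro power_mono) auto
        also have "\<dots> = C\<^sup>2 * (cmod (boundary (ev h) \<zeta>))\<^sup>2" by (rule power_mult_distrib)
        also have "\<dots> \<le> C\<^sup>2 * (1 - (cmod (boundary b \<zeta>))\<^sup>2)"
          using elim(2) by (intro mult_left_mono) auto
        finally have "(cmod (boundary (F n) \<zeta>))\<^sup>2 * (cmod (boundary (ev f) \<zeta>))\<^sup>2 \<le>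
            C\<^sup>2 * (1 - (cmod (boundary b \<zeta>))\<^sup>2) * (cmod (boundary (ev f) \<zeta>))\<^sup>2"
          by (rule mult_right_mono) simp
        then show ?case by (simp only: right_diff_distrib left_diff_distrib mult_1_right mult.assoc)
      qed
    qed
    also have "\<dots> = C\<^sup>2 * ((norm f)\<^sup>2 - (norm (mulop b f))\<^sup>2)"
      by (simp only: integral_mult_right_zero Bochner_Integration.integral_diff[OF integrable_boundary_sq norm_mulop_sq(2)[OF bH]]
          integral_boundary_sq norm_mulop_sq(1)[OF bH])
    also have "\<dots> \<le> C\<^sup>2 * (norm (D f))\<^sup>2"
      unfolding normD using norm_coanalytic_le_L2[OF bH, of f] by (intro mult_left_mono) (auto simp: power_mono)
    finally have "(norm (mulop (F n) f))\<^sup>2 \<le> (C * norm (D f))\<^sup>2" by (simp only: power_mult_distrib)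
    then show ?thesis unfolding C_def[symmetric] using C by (rule power2_le_imp_le[OF _ mult_nonneg_nonneg]) simp
  qed
  have inner_F: "inner (mulop (F n) f) y = inner f (coanalytic (F n) y)" for n f y
    by (simp add: inner_eq_Re_cinner cinner_coanalytic[OF F(1)])
  \<comment> \<open>D x = 0 forces F x = 0, so x is orthogonal to the range of the adjoint of
    multiplication by F, which contains every monomial.\<close>
  have D_inj: "x = 0" if Dx: "D x = 0" for x
  proof (rule cinner_eqI)
    fix y
    have "cinner x (basis m) = 0" for m
    proof -
      obtain p where p: "coanalytic (F 0) p = basis m"
        using coanalytic_surj_poly_space[OF F poly_space_basis] by blast
      have "mulop (F 0) x = 0" using FD[of 0 x] Dx by simp
      then have "cinner (mulop (F 0) x) p = 0" by (simp add: cinner_def)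
      then show ?thesis by (simp only: cinner_coanalytic[OF F(1)] p)
    qed
    then have "x = 0" by (intro coef_eqI) simp
    then show "cinner x y = cinner 0 y" by simp
  qed
  then have inj_D: "inj (blinfun_apply D)"
    by (intro injI) (metis blinfun.diff_right right_minus_eq)
  have subR: "subspace (range (blinfun_apply D))"
    by (intro linear_subspace_image) (auto simp: blinfun.bounded_linear_right bounded_linear.linear)
  \<comment> \<open>An instance of Douglas' factorisation lemma: the map sending D f to <F f, y> is
    well defined by injectivity of D and bounded by \<open>FD\<close>. A vector q representing it on
    the range of D satisfies <f, D q> = <F f, y> for all f.\<close>
  have range_D: "\<exists>q. D q = coanalytic (F n) y" for n y
  proof -
    define \<Phi> where "\<Phi> u = inner (mulop (F n) (inv D u)) y" for u
    have \<Phi>D: "\<Phi> (D f) = inner (mulop (F n) f) y" for f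
      unfolding \<Phi>_def by (simp add: inv_f_f[OF inj_D])
    obtain q where q: "\<And>u. u \<in> range (blinfun_apply D) \<Longrightarrow> inner q u = \<Phi> u"
    proof (rule riesz_on_subspace[OF subR, where \<phi> = \<Phi> and K = "real (Suc n) * norm y"])
      show "\<Phi> (u + v) = \<Phi> u + \<Phi> v" if "u \<in> range D" "v \<in> range D" for u v
        using that by (auto simp: \<Phi>D blinfun.add_right[symmetric] mulop_add[OF F(1)] inner_add_left)
      show "\<Phi> (c *\<^sub>R u) = c * \<Phi> u" if "u \<in> range D" for c u
        using that by (auto simp: \<Phi>D blinfun.scaleR_right[symmetric] linear_scale[OF bounded_linear.linear[OF bounded_linear_mulop[OF F(1)]]])
      show "\<bar>\<Phi> u\<bar> \<le> real (Suc n) * norm y * norm u" if uD: "u \<in> range D" for u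
      proof -
        obtain f where f: "u = D f" using uD by blast
        have "\<bar>\<Phi> u\<bar> \<le> norm (mulop (F n) f) * norm y" unfolding f \<Phi>D by (rule Cauchy_Schwarz_ineq2)
        also have "\<dots> \<le> (real (Suc n) * norm u) * norm y" unfolding f by (intro mult_right_mono FD) simp
        finally show ?thesis by (simp add: mult_ac)
      qed
    qed blast
    have "inner f (D q) = inner f (coanalytic (F n) y)" for f
    proof -
      have "inner f (D q) = inner (D f) q" by (rule Dsa[symmetric])
      also have "\<dots> = inner q (D f)" by (rule inner_commute)
      also have "\<dots> = \<Phi> (D f)" by (rule q) simp
      also have "\<dots> = inner f (coanalytic (F n) y)" by (simp only: \<Phi>D inner_F)
      finally show ?thesis .
    qed
    then have "inner (D q - coanalytic (F n) y) (D q - coanalytic (F n) y) = 0"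
      by (simp only: inner_diff_right)
    then show ?thesis by auto
  qed
  \<comment> \<open>Since D is injective, the orthogonality condition in \<open>dBR_norm\<close> is
    vacuous and the preimage is unique.\<close>
  have norm_root: "dBR_norm b (ev (D g)) = norm g" for g
    unfolding dBR_norm_def
  proof (rule the_equality)
    have "H2_inner (ev g) k = 0" if k: "k \<in> H2" "defect_root b k = (\<lambda>z. 0)" for k
    proof -
      obtain x where x: "k = ev x" using H2_imp_ev[OF k(1)] by blast
      have "ev (D x) = ev 0" using k(2) ev_cscale[of 0 0] by (simp add: x root ev_diff[of 0 0, simplified])
      then have "x = 0" using D_inj injD[OF inj_ev] by blast
      then show ?thesis unfolding x H2_inner_ev by (simp add: cinner_def)
    qed
    then show "\<exists>g'\<in>H2. (\<forall>k\<in>H2. defect_root b k = (\<lambda>z. 0) \<longrightarrow> H2_inner g' k = 0) \<and>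
        ev (D g) = defect_root b g' \<and> norm g = H2_norm g'"
      by (intro bexI[of _ "ev g"]) (auto simp: root H2_norm_ev ev_in_H2)
    fix c assume "\<exists>g'\<in>H2. (\<forall>k\<in>H2. defect_root b k = (\<lambda>z. 0) \<longrightarrow> H2_inner g' k = 0) \<and>
        ev (D g) = defect_root b g' \<and> c = H2_norm g'"
    then obtain g' where g': "g' \<in> H2" "ev (D g) = defect_root b g'" "c = H2_norm g'" by blast
    obtain x where x: "g' = ev x" using H2_imp_ev[OF g'(1)] by blast
    have "g = x" using g'(2) unfolding x root by (metis injD[OF inj_ev] injD[OF inj_D])
    then show "c = norm g" using g'(3) by (simp add: x H2_norm_ev)
  qed
  \<comment> \<open>D maps coefficients isometrically onto H(b), so density of the polynomials there
    is density of their preimages \<open>W\<close> in \<open>ell2\<close>.\<close>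
  define W where "W = {q. D q \<in> poly_space}"
  have W_cscale: "cscale c q \<in> W" if "q \<in> W" for c q
    using that by (simp add: W_def Dc poly_space_cscale)
  have subW: "subspace W"
    unfolding subspace_def
  proof (intro conjI ballI allI)
    show "0 \<in> W" by (auto simp: W_def blinfun.zero_right poly_space_def)
    show "x + y \<in> W" if "x \<in> W" "y \<in> W" for x y
      using that by (simp add: W_def blinfun.add_right poly_space_add)
    show "c *\<^sub>R x \<in> W" if "x \<in> W" for c x
      using W_cscale[OF that] by (simp only: scaleR_eq_cscale)
  qed
  have orth_W: "g1 = 0" if g1: "\<And>q. q \<in> W \<Longrightarrow> inner g1 q = 0" for g1
  proof -
    have cg1: "cinner g1 q = 0" if "q \<in> W" for q
      using g1[OF that] g1[OF W_cscale[OF that, of \<i>]] by (simp add: cinner_eq_inner complex_eq_iff)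
    \<comment> \<open>g2 is the projection of g1 onto the closure of the range of D.
      Self-adjointness gives D (g1 - g2) = 0, so g1 lies in that closure and is a limit of vectors D
      f_k.\<close>
    obtain g2 where g2: "g2 \<in> closure (range (blinfun_apply D))" "\<And>u. u \<in> range D \<Longrightarrow> inner g2 u = inner g1 u"
    proof (rule riesz_on_subspace[OF subR, where \<phi> = "inner g1" and K = "norm g1"])
      show "\<bar>inner g1 u\<bar> \<le> norm g1 * norm u" for u by (rule Cauchy_Schwarz_ineq2)
    qed (auto simp: inner_add_right)
    have "inner (D (g1 - g2)) (D (g1 - g2)) = inner (g1 - g2) (D (D (g1 - g2)))" by (rule Dsa)
    also have "\<dots> = 0"
      unfolding inner_diff_left using g2(2)[OF rangeI, of "D (g1 - g2)", symmetric] by (simp only: right_minus_eq)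
    finally have "inner (D (g1 - g2)) (D (g1 - g2)) = 0" .
    then have "g1 = g2" using D_inj[of "g1 - g2"] by simp
    then have "g1 \<in> closure (range (blinfun_apply D))" using g2(1) by simp
    then obtain u where u: "\<forall>k. u k \<in> range (blinfun_apply D)" "u \<longlonglongrightarrow> g1"
      unfolding closure_sequential by blast
    define f where "f k = inv (blinfun_apply D) (u k)" for k
    have "D (f k) = u k" for k unfolding f_def by (rule f_inv_into_f) (use u(1) in blast)
    then have Df: "(\<lambda>k. D (f k)) \<longlonglongrightarrow> g1" using u(2) by simp
    have Ff: "(\<lambda>k. mulop (F n) (f k)) \<longlonglongrightarrow> 0" for n
    proof -
      \<comment> \<open>By \<open>FD\<close> the products F f_k inherit the Cauchy property from D
        f_k, whatever f_k itself does.\<close>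
      have "Cauchy (\<lambda>k. mulop (F n) (f k))"
      proof (rule metric_CauchyI)
        fix e :: real assume e: "0 < e"
        then have "0 < e / real (Suc n)" by simp
        then obtain M where M: "\<forall>j\<ge>M. \<forall>k\<ge>M. dist (D (f j)) (D (f k)) < e / real (Suc n)"
          using metric_CauchyD[OF LIMSEQ_imp_Cauchy[OF Df]] by blast
        have "dist (mulop (F n) (f j)) (mulop (F n) (f k)) < e" if "j \<ge> M" "k \<ge> M" for j k
        proof -
          have "dist (mulop (F n) (f j)) (mulop (F n) (f k)) = norm (mulop (F n) (f j - f k))"
            by (simp add: dist_norm linear_diff[OF bounded_linear.linear[OF bounded_linear_mulop[OF F(1)]]])
          also have "\<dots> \<le> real (Suc n) * dist (D (f j)) (D (f k))"
            using FD[of n "f j - f k"] by (simp add: dist_norm blinfun.diff_right)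
          also have "\<dots> < e"
            using M[rule_format, OF that] by (simp add: pos_less_divide_eq mult.commute del: of_nat_Suc)
          finally show ?thesis .
        qed
        then show "\<exists>M. \<forall>j\<ge>M. \<forall>k\<ge>M. dist (mulop (F n) (f j)) (mulop (F n) (f k)) < e" by blast
      qed
      then obtain w where w: "(\<lambda>k. mulop (F n) (f k)) \<longlonglongrightarrow> w"
        using Cauchy_convergent_iff convergent_def by blast
      \<comment> \<open>For a polynomial y the coanalytic image of y is again a polynomial and
        equals D q with q in \<open>W\<close>; hence <F f_k, y> = <D f_k, q> tends to <g1, q> =
        0.\<close>
      have iw: "inner w y = 0" if y: "y \<in> poly_space" "coanalytic (F n) y \<in> poly_space" for y
      proof -
        obtain q where q: "D q = coanalytic (F n) y" using range_D by blast
        then have "q \<in> W" using y by (simp add: W_def)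
        have "inner (mulop (F n) (f k)) y = inner (D (f k)) q" for k
          by (simp add: inner_F q[symmetric] Dsa)
        then have "(\<lambda>k. inner (D (f k)) q) \<longlonglongrightarrow> inner w y"
          using tendsto_inner[OF w tendsto_const, of y] by simp
        moreover have "(\<lambda>k. inner (D (f k)) q) \<longlonglongrightarrow> inner g1 q"
          by (rule tendsto_inner[OF Df tendsto_const])
        ultimately show ?thesis using LIMSEQ_unique g1[OF \<open>q \<in> W\<close>] by metis
      qed
      have "w = 0"
      proof (rule coef_eqI)
        fix m
        have "inner w (basis m) = 0"
          by (rule iw[OF poly_space_basis coanalytic_basis_in_poly_space[OF F(1)]])
        \<comment> \<open>The inner product is real, so the coefficient of w vanishes only after
          testing with i times the monomial too.\<close>
        moreover have "inner w (cscale \<i> (basis m)) = 0"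
          by (rule iw) (simp_all add: coanalytic_cscale[OF F(1)] poly_space_cscale poly_space_basis
              coanalytic_basis_in_poly_space[OF F(1)])
        ultimately have "cinner w (basis m) = 0" by (simp add: cinner_eq_inner complex_eq_iff)
        then show "coef w m = coef 0 m" by simp
      qed
      then show ?thesis using w by simp
    qed
    have "cinner (D g1) (basis m) = 0" for m
    proof -
      define e where "e = basis m"
      obtain K where "\<forall>\<phi> f d. \<phi> \<in> Hinf \<and> L2 (\<lambda>\<zeta>. 1 - boundary \<phi> \<zeta>) \<and> 0 \<le> d \<and>
          d\<^sup>2 = (norm f)\<^sup>2 - (norm (coanalytic b f))\<^sup>2 \<longrightarrow>
          cmod (cinner f e - cinner (coanalytic b f) (coanalytic b e)) \<le>
            K * (norm (mulop \<phi> f) + L2_norm (\<lambda>\<zeta>. 1 - boundary \<phi> \<zeta>) * d)"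
        unfolding e_def
        using defect_form_estimate[OF b poly_space_basis coanalytic_basis_in_poly_space[OF bH]] by (rule exE)
      then have est: "\<And>\<phi> f d. \<phi> \<in> Hinf \<Longrightarrow> L2 (\<lambda>\<zeta>. 1 - boundary \<phi> \<zeta>) \<Longrightarrow> 0 \<le> d \<Longrightarrow>
          d\<^sup>2 = (norm f)\<^sup>2 - (norm (coanalytic b f))\<^sup>2 \<Longrightarrow>
          cmod (cinner f e - cinner (coanalytic b f) (coanalytic b e)) \<le>
            K * (norm (mulop \<phi> f) + L2_norm (\<lambda>\<zeta>. 1 - boundary \<phi> \<zeta>) * d)"
        by blast
      define \<delta> where "\<delta> n = L2_norm (\<lambda>\<zeta>. 1 - boundary (F n) \<zeta>)" for n
      have L2F: "L2 (\<lambda>\<zeta>. 1 - boundary (F n) \<zeta>)" for n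
        using Fint H2_boundary_measurable[OF subsetD[OF Hinf_subset_H2 F(1)]] by (auto simp: L2_def)
      have est': "cmod (cinner (D (f k)) (D e)) \<le> K * (norm (mulop (F n) (f k)) + \<delta> n * norm (D (f k)))" for n k
        unfolding \<delta>_def Dform by (rule est[OF F(1) L2F norm_ge_zero normD])
      have lim1: "(\<lambda>k. cinner (D (f k)) (D e)) \<longlonglongrightarrow> cinner g1 (D e)"
        unfolding cinner_eq_inner by (intro tendsto_Complex tendsto_inner Df tendsto_const)
      \<comment> \<open>The order of the limits matters: k -> infinity with n fixed removes F_n f_k,
        and only then n -> infinity removes the factor \<open>\<delta> n\<close>.\<close>
      have est2: "cmod (cinner g1 (D e)) \<le> K * (0 + \<delta> n * norm g1)" for n
      proof (rule LIMSEQ_le[OF tendsto_norm[OF lim1]])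
        show "(\<lambda>k. K * (norm (mulop (F n) (f k)) + \<delta> n * norm (D (f k)))) \<longlonglongrightarrow> K * (0 + \<delta> n * norm g1)"
          by (intro tendsto_mult tendsto_add tendsto_const tendsto_norm Df tendsto_norm_zero Ff)
      qed (use est' in blast)
      have "\<delta> \<longlonglongrightarrow> sqrt 0" unfolding \<delta>_def L2_norm_def by (intro tendsto_real_sqrt Flim)
      then have "(\<lambda>n. K * (0 + \<delta> n * norm g1)) \<longlonglongrightarrow> K * (0 + sqrt 0 * norm g1)"
        by (intro tendsto_mult tendsto_add tendsto_const)
      then have "cmod (cinner g1 (D e)) \<le> K * (0 + sqrt 0 * norm g1)"
        using est2 by (intro LIMSEQ_le_const) auto
      then have "cinner g1 (D e) = 0" by simp
      then show ?thesis by (simp only: Dcin e_def)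
    qed
    then have "D g1 = 0" by (intro coef_eqI) simp
    then show ?thesis by (rule D_inj)
  qed
  \<comment> \<open>The projection g0 of g onto the closure of \<open>W\<close> leaves a remainder
    orthogonal to \<open>W\<close>, which vanishes by \<open>orth_W\<close>.\<close>
  have dense_W: "g \<in> closure W" for g
  proof -
    obtain g0 where g0: "g0 \<in> closure W" "\<And>q. q \<in> W \<Longrightarrow> inner g0 q = inner g q"
    proof (rule riesz_on_subspace[OF subW, where \<phi> = "inner g" and K = "norm g"])
      show "\<bar>inner g u\<bar> \<le> norm g * norm u" for u by (rule Cauchy_Schwarz_ineq2)
    qed (auto simp: inner_add_right)
    have "g - g0 = 0" by (rule orth_W) (simp add: inner_diff_left g0(2))
    then show ?thesis using g0(1) by simp
  qed
  have "polynomial_functions \<subseteq> dBR_space b"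
  proof
    fix p assume "p \<in> polynomial_functions"
    then obtain y where y: "p = ev y" "y \<in> poly_space" by (auto simp: polynomial_functions_eq)
    obtain u where u: "coanalytic (F 0) u = y"
      using coanalytic_surj_poly_space[OF F y(2)] by blast
    obtain q where "D q = y" using range_D[of 0 u] u by auto
    then have "p = defect_root b (ev q)" by (simp add: y root)
    then show "p \<in> dBR_space b" unfolding dBR_space_def using ev_in_H2 by blast
  qed
  moreover have "\<exists>p\<in>polynomial_functions. dBR_norm b (\<lambda>z. f z - p z) < \<epsilon>"
    if f: "f \<in> dBR_space b" and \<epsilon>: "0 < \<epsilon>" for f \<epsilon>
  proof -
    obtain g where g: "f = ev (D g)" using f by (auto simp: dBR_space_def H2_eq_range_ev root)
    obtain q where q: "q \<in> W" "dist q g < \<epsilon>" using dense_W[of g] \<epsilon> by (auto simp: closure_approachable)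
    have "(\<lambda>z. f z - ev (D q) z) = ev (D (g - q))" by (simp add: g ev_diff blinfun.diff_right)
    then have "dBR_norm b (\<lambda>z. f z - ev (D q) z) < \<epsilon>"
      using q(2) by (simp add: norm_root dist_norm norm_minus_commute)
    moreover have "ev (D q) \<in> polynomial_functions"
      using q(1) by (auto simp: polynomial_functions_eq W_def)
    ultimately show ?thesis by blast
  qed
  ultimately show ?thesis by blast
qed

end
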